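(* Let $x:M^2\to\mathbb{R}^3$ be a flat Calabi affine maximal surface (i.e. its Calabi metric is flat) whose Tchebychev vector field $T$ is nowhere zero on $M^2$ and satisfies $|\hat\nabla T|=c>0$, where $c$ is a constant. Then $x(M^2)$ is Calabi affinely equivalent to an open part of the surface parameterized locally by $(u_1,u_2)$ as $$x_1=\int_0^{u_1}e^{\frac{c_1}{2}t^2+c_2t}\,dt,\qquad x_2=\int_0^{u_2}e^{-\frac{c_1}{2}t^2+c_3t}\,dt,$$ $$x_3=\int_0^{u_1}\Big(e^{\frac{c_1}{2}t^2+c_2t}\int_0^te^{-\frac{c_1}{2}s^2-c_2s}ds\Big)dt+\int_0^{u_2}\Big(e^{-\frac{c_1}{2}t^2+c_3t}\int_0^te^{\frac{c_1}{2}s^2-c_3s}ds\Big)dt,$$ where $c_1,c_2,c_3\in\mathbb{R}$ are constants and $c_1=\sqrt2\,c$.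
   Context: A Calabi surface is a locally strongly convex immersion $x:M^2\to\mathbb{R}^3$ of a smooth connected surface equipped with the constant transversal field $Y=(0,0,1)$. With $D$ the flat connection of $\mathbb{R}^3$, write $D_Xx_*Z=x_*(\nabla_XZ)+G(X,Z)Y$; $G$ (positive definite after choice of orientation) is the Calabi metric. $\hat\nabla$ is the Levi-Civita connection of $G$, $A=\nabla-\hat\nabla$ is the Fubini-Pick tensor, and $T=\frac12\operatorname{tr}_GA$ is the Tchebychev vector field; norms are taken with respect to $G$. Locally $x(M^2)$ is a graph $x_3=f(x_1,x_2)$ of a strictly convex function $f$; then $G=\sum f_{ij}dx_idx_j$, $A_{ijk}=-\frac12f_{ijk}$. The surface is Calabi affine maximal if $\Delta\ln\det(f_{ij})=0$ ($\Delta$ the Laplacian of $G$), equivalently $\operatorname{tr}(\hat\nabla T)=0$. Two Calabi surfaces are Calabi affinely equivalent if they differ by an affine transformation of $\mathbb{R}^3$ whose linear part fixes $Y=(0,0,1)^t$, i.e. $X\mapsto\begin{pmatrix}P&0\\ q&1\end{pmatrix}X+b$ with $P\in GL(2,\mathbb{R})$, $q\in\mathbb{R}^{1\times2}$, $b\in\mathbb{R}^3$. *)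

theory Defs
  imports "HOL-Analysis.Analysis"
begin

section \<open>Smooth maps and smooth surfaces\<close>

fun Ck_on :: "nat \<Rightarrow> 'a::real_normed_vector set \<Rightarrow> ('a \<Rightarrow> 'b::real_normed_vector) \<Rightarrow> bool" where
  "Ck_on 0 S f \<longleftrightarrow> continuous_on S f"
| "Ck_on (Suc k) S f \<longleftrightarrow>
     (\<forall>p\<in>S. f differentiable (at p)) \<and> (\<forall>v. Ck_on k S (\<lambda>p. frechet_derivative f (at p) v))"

text \<open>Meant for open \<open>S\<close>: the derivatives are taken in the full space, not within \<open>S\<close>.\<close>

definition smooth_on :: "'a::real_normed_vector set \<Rightarrow> ('a \<Rightarrow> 'b::real_normed_vector) \<Rightarrow> bool" where
  "smooth_on S f \<longleftrightarrow> (\<forall>k. Ck_on k S f)"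

type_synonym 'm chart = "'m set \<times> ('m \<Rightarrow> real^2)"

text \<open>The surface is the whole type \<open>'m\<close>; a chart is a domain together with a
  coordinate map, whose values outside the domain are irrelevant.\<close>

definition smooth_atlas :: "'m::{t2_space,second_countable_topology} chart set \<Rightarrow> bool" where
  "smooth_atlas \<A> \<longleftrightarrow>
     (\<Union>(U, \<phi>)\<in>\<A>. U) = UNIV \<and>
     (\<forall>(U, \<phi>)\<in>\<A>. open U \<and> open (\<phi> ` U) \<and> homeomorphism U (\<phi> ` U) \<phi> (inv_into U \<phi>)) \<and>
     (\<forall>(U, \<phi>)\<in>\<A>. \<forall>(V, \<psi>)\<in>\<A>. smooth_on (\<phi> ` (U \<inter> V)) (\<psi> \<circ> inv_into U \<phi>))"

definition local_reps :: "'m chart set \<Rightarrow> ('m \<Rightarrow> 'b) \<Rightarrow> ((real^2) set \<times> (real^2 \<Rightarrow> 'b)) set" where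
  "local_reps \<A> x = (\<lambda>(U, \<phi>). (\<phi> ` U, x \<circ> inv_into U \<phi>)) ` \<A>"


section \<open>Riemannian geometry in local coordinates\<close>

text \<open>A metric on a coordinate domain is its Gram matrix \<open>g p $ i $ j\<close>.\<close>

definition pd :: "2 \<Rightarrow> (real^2 \<Rightarrow> 'b::real_normed_vector) \<Rightarrow> real^2 \<Rightarrow> 'b" where
  "pd i f p = frechet_derivative f (at p) (axis i 1)"

text \<open>\<open>christoffel g p i j $ k\<close> is $\hat\Gamma^k_{ij}$, that is,
  $\hat\nabla_{\partial_i}\partial_j = \sum_k \hat\Gamma^k_{ij}\partial_k$.\<close>

definition christoffel :: "(real^2 \<Rightarrow> real^2^2) \<Rightarrow> real^2 \<Rightarrow> 2 \<Rightarrow> 2 \<Rightarrow> real^2" where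
  "christoffel g p i j = (\<chi> k. (1/2) * (\<Sum>l\<in>UNIV. matrix_inv (g p) $ k $ l *
     (pd i (\<lambda>q. g q $ j $ l) p + pd j (\<lambda>q. g q $ i $ l) p - pd l (\<lambda>q. g q $ i $ j) p)))"

text \<open>\<open>curvature g p i j k $ l\<close> is the \<open>l\<close>-th component of $\hat R(\partial_i,\partial_j)\partial_k$.\<close>

definition curvature :: "(real^2 \<Rightarrow> real^2^2) \<Rightarrow> real^2 \<Rightarrow> 2 \<Rightarrow> 2 \<Rightarrow> 2 \<Rightarrow> real^2" where
  "curvature g p i j k = (\<chi> l.
     pd i (\<lambda>q. christoffel g q j k $ l) p - pd j (\<lambda>q. christoffel g q i k $ l) p +
     (\<Sum>m\<in>UNIV. christoffel g p j k $ m * christoffel g p i m $ l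
             - christoffel g p i k $ m * christoffel g p j m $ l))"

definition laplacian :: "(real^2 \<Rightarrow> real^2^2) \<Rightarrow> (real^2 \<Rightarrow> real) \<Rightarrow> real^2 \<Rightarrow> real" where
  "laplacian g h p = (\<Sum>i\<in>UNIV. \<Sum>j\<in>UNIV. matrix_inv (g p) $ i $ j *
     (pd i (pd j h) p - (\<Sum>k\<in>UNIV. christoffel g p i j $ k * pd k h p)))"

text \<open>\<open>covariant_deriv g X p i\<close> is $\hat\nabla_{\partial_i}X$.\<close>

definition covariant_deriv ::
  "(real^2 \<Rightarrow> real^2^2) \<Rightarrow> (real^2 \<Rightarrow> real^2) \<Rightarrow> real^2 \<Rightarrow> 2 \<Rightarrow> real^2" where
  "covariant_deriv g X p i = pd i X p + (\<Sum>j\<in>UNIV. X p $ j *\<^sub>R christoffel g p i j)"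

text \<open>Norm of an endomorphism field $N = \sum N_i{}^k\, dx^i\otimes\partial_k$ with \<open>N i $ k\<close> for
  $N_i{}^k$: $|N|^2 = g^{ij} g_{kl} N_i{}^k N_j{}^l$.\<close>

definition endo_norm :: "real^2^2 \<Rightarrow> (2 \<Rightarrow> real^2) \<Rightarrow> real" where
  "endo_norm g N = sqrt (\<Sum>i\<in>UNIV. \<Sum>j\<in>UNIV. \<Sum>k\<in>UNIV. \<Sum>l\<in>UNIV.
     matrix_inv g $ i $ j * g $ k $ l * N i $ k * N j $ l)"


section \<open>Calabi surfaces\<close>

definition Yfield :: "real^3" where
  "Yfield = vector [0, 0, 1]"

text \<open>The pair $(\nabla_{\partial_i}\partial_j,\, G(\partial_i,\partial_j))$ in the structure equation
  $D_Xx_*Z = x_*(\nabla_XZ) + G(X,Z)Y$ of a parametrized surface \<open>y\<close>. It is unique where \<open>y\<close> is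
  immersed and \<open>Yfield\<close> is transversal.\<close>

definition structure_coeffs :: "(real^2 \<Rightarrow> real^3) \<Rightarrow> real^2 \<Rightarrow> 2 \<Rightarrow> 2 \<Rightarrow> (real^2) \<times> real" where
  "structure_coeffs y p i j = (THE (\<Gamma>, g).
     pd i (pd j y) p = frechet_derivative y (at p) \<Gamma> + g *\<^sub>R Yfield)"

definition induced_conn :: "(real^2 \<Rightarrow> real^3) \<Rightarrow> real^2 \<Rightarrow> 2 \<Rightarrow> 2 \<Rightarrow> real^2" where
  "induced_conn y p i j = fst (structure_coeffs y p i j)"

definition calabi_metric :: "(real^2 \<Rightarrow> real^3) \<Rightarrow> real^2 \<Rightarrow> real^2^2" where
  "calabi_metric y p = (\<chi> i j. snd (structure_coeffs y p i j))"

text \<open>Positivity of the Calabi metric expresses local strong convexity together with the choice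
  of orientation.\<close>

definition calabi_patch :: "(real^2) set \<Rightarrow> (real^2 \<Rightarrow> real^3) \<Rightarrow> bool" where
  "calabi_patch \<Omega> y \<longleftrightarrow> smooth_on \<Omega> y \<and>
     (\<forall>p\<in>\<Omega>. inj (frechet_derivative y (at p)) \<and>
            Yfield \<notin> range (frechet_derivative y (at p)) \<and>
            (\<forall>v. v \<noteq> 0 \<longrightarrow> v \<bullet> (calabi_metric y p *v v) > 0))"

definition calabi_surface ::
  "'m::{t2_space,second_countable_topology} chart set \<Rightarrow> ('m \<Rightarrow> real^3) \<Rightarrow> bool" where
  "calabi_surface \<A> x \<longleftrightarrow> smooth_atlas \<A> \<and> connected (UNIV :: 'm set) \<and>
     (\<forall>(\<Omega>, y)\<in>local_reps \<A> x. calabi_patch \<Omega> y)"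

definition fubini_pick :: "(real^2 \<Rightarrow> real^3) \<Rightarrow> real^2 \<Rightarrow> 2 \<Rightarrow> 2 \<Rightarrow> real^2" where
  "fubini_pick y p i j = induced_conn y p i j - christoffel (calabi_metric y) p i j"

definition tchebychev :: "(real^2 \<Rightarrow> real^3) \<Rightarrow> real^2 \<Rightarrow> real^2" where
  "tchebychev y p = (1/2) *\<^sub>R
     (\<Sum>i\<in>UNIV. \<Sum>j\<in>UNIV. matrix_inv (calabi_metric y p) $ i $ j *\<^sub>R fubini_pick y p i j)"

definition flat_calabi :: "'m chart set \<Rightarrow> ('m \<Rightarrow> real^3) \<Rightarrow> bool" where
  "flat_calabi \<A> x \<longleftrightarrow>
     (\<forall>(\<Omega>, y)\<in>local_reps \<A> x. \<forall>p\<in>\<Omega>. \<forall>i j k. curvature (calabi_metric y) p i j k = 0)"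

definition graph_param :: "(real^2 \<Rightarrow> real) \<Rightarrow> real^2 \<Rightarrow> real^3" where
  "graph_param f a = vector [a$1, a$2, f a]"

definition hessian :: "(real^2 \<Rightarrow> real) \<Rightarrow> real^2 \<Rightarrow> real^2^2" where
  "hessian f a = (\<chi> i j. pd i (pd j f) a)"

text \<open>The condition is imposed on every piece of the surface that is a graph. On a Calabi surface
  each point has a neighbourhood whose image is one.\<close>

definition calabi_affine_maximal ::
  "'m::{t2_space,second_countable_topology} chart set \<Rightarrow> ('m \<Rightarrow> real^3) \<Rightarrow> bool" where
  "calabi_affine_maximal \<A> x \<longleftrightarrow> calabi_surface \<A> x \<and>
     (\<forall>U V f. open U \<and> open V \<and> smooth_on V f \<and> x ` U = graph_param f ` V \<longrightarrow>
        (\<forall>a\<in>V. laplacian (calabi_metric (graph_param f)) (\<lambda>b. ln (det (hessian f b))) a = 0))"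

definition calabi_transformation :: "(real^3 \<Rightarrow> real^3) \<Rightarrow> bool" where
  "calabi_transformation F \<longleftrightarrow> (\<exists>(P::real^2^2) (q::real^2) (b::real^3). invertible P \<and>
     F = (\<lambda>X. (vector [vector [P$1$1, P$1$2, 0],
                       vector [P$2$1, P$2$2, 0],
                       vector [q$1,   q$2,   1]] :: real^3^3) *v X + b))"

definition calabi_equivalent :: "(real^3) set \<Rightarrow> (real^3) set \<Rightarrow> bool" where
  "calabi_equivalent S S' \<longleftrightarrow> (\<exists>F. calabi_transformation F \<and> F ` S = S')"

text \<open>The interval integrals are oriented, so negative upper limits are covered.\<close>

definition model_surface :: "real \<Rightarrow> real \<Rightarrow> real \<Rightarrow> real^2 \<Rightarrow> real^3" where
  "model_surface c1 c2 c3 u = vector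
     [LBINT t=0..u$1. exp (c1/2 * t^2 + c2 * t),
      LBINT t=0..u$2. exp (- c1/2 * t^2 + c3 * t),
      (LBINT t=0..u$1. exp (c1/2 * t^2 + c2 * t) *
         (LBINT s=0..t. exp (- c1/2 * s^2 - c2 * s))) +
      (LBINT t=0..u$2. exp (- c1/2 * t^2 + c3 * t) *
         (LBINT s=0..t. exp (c1/2 * s^2 - c3 * s)))]"

end

(* On a flat surface the total symmetry of the Fubini-Pick tensor makes N = nabla-hat T self-adjoint, and
   affine maximality makes it trace-free, so N^2 = n^2 with n = c / sqrt 2.  Its unit eigenfields E1, E2
   then turn out to be parallel, hence commute, and u = N^(-1) T are flat coordinates, so that no
   separate construction of flat coordinates is required.  In this frame the cubic form has four
   components p, q, r, s with p + r = 2 n u1, q + s = - 2 n u2.  By Codazzi they are harmonic, so the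
   Laplacian of the Gauss relation p r + q s = q^2 + r^2 is a sum of squares of first derivatives.
   This forces q and r to be constant, and then to vanish.  What is left is the linear system
   y_11 = c1 u1 y_1 + Y, y_12 = 0, y_22 = - c1 u2 y_2 + Y with c1 = 2 n = sqrt 2 c, whose solutions are
   the affine images of the model with c2 = c3 = 0; nonzero c2, c3 only move the base point of u.

   Globally, an affine map that carries an open piece of this model into the model is one of the
   reflections u -> (+-u1, +-u2), so connectedness makes one transformation serve the whole surface. *)
theory Submission
  imports Defs
begin

section \<open>Partial derivatives\<close>

text \<open>Affine maximality is a condition on graphs in their own coordinates, whereas flatness
  and the norm of N are given in arbitrary charts. The projection \<open>horiz y\<close> along
  \<open>Yfield\<close> connects the two: its smooth local inverse produces a graph function f, and
  metric, connection and T are transported along it. There the induced connection is trivial and T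
  is -1/4 times the gradient of ln det (f_ij), so N is -1/4 times a covariant Hessian; its symmetry
  and its trace come from the same formula.

  The opposite signs of the eigenvalues n and -n are used repeatedly. They keep the rotation terms
  of the frame from cancelling, they cancel the terms linear in n when the Gauss relation is
  differentiated twice, and for constant q and r one derivative of that relation leaves 2 n r = 0
  and -2 n q = 0. The exponentials exp(c1 t^2/2) and exp(-c1 t^2/2) of the model are the inverse
  integrating factors of the equations for y_11 and y_22. Their exponents have opposite signs, which
  is also why an affine map between pieces of the model cannot interchange u1 and u2.\<close>

lemma frechet_eq_pd:
  fixes f :: "real^2 \<Rightarrow> 'b::real_normed_vector"
  assumes "f differentiable (at p)"
  shows "frechet_derivative f (at p) v = v$1 *\<^sub>R pd 1 f p + v$2 *\<^sub>R pd 2 f p"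
proof -
  interpret bounded_linear "frechet_derivative f (at p)"
    using assms frechet_derivative_works has_derivative_bounded_linear by blast
  have "v = v$1 *\<^sub>R axis 1 1 + v$2 *\<^sub>R axis 2 1"
    by (simp add: vec_eq_iff forall_2 axis_def)
  then show ?thesis
    unfolding pd_def by (metis add scaleR)
qed

lemma has_derivative_pd:
  fixes f :: "real^2 \<Rightarrow> 'b::real_normed_vector"
  assumes "f differentiable (at p)"
  shows "(f has_derivative (\<lambda>v. v$1 *\<^sub>R pd 1 f p + v$2 *\<^sub>R pd 2 f p)) (at p)"
proof -
  have "frechet_derivative f (at p) = (\<lambda>v. v$1 *\<^sub>R pd 1 f p + v$2 *\<^sub>R pd 2 f p)"
    using frechet_eq_pd[OF assms] by blast
  then show ?thesis using assms frechet_derivative_works by metis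
qed

lemma pd_eqI: "(f has_derivative F) (at p) \<Longrightarrow> pd i f p = F (axis i 1)"
  unfolding pd_def using frechet_derivative_at by metis

text \<open>Locality holds even where no derivative exists: \<open>frechet_derivative\<close> is a
  choice among the \<open>F\<close> with \<open>has_derivative\<close>, and these are the same for
  both functions.\<close>

lemma pd_cong:
  assumes "open S" "p \<in> S" "\<And>q. q \<in> S \<Longrightarrow> f q = g q"
  shows "pd i f p = pd i g p"
proof -
  have "(f has_derivative F) (at p) \<longleftrightarrow> (g has_derivative F) (at p)" for F
    using has_derivative_transform_within_open[OF _ assms(1,2)] assms(3) by metis
  then show ?thesis
    unfolding pd_def frechet_derivative_def by presburger
qed

lemma pd_const [simp]: "pd i (\<lambda>q. c) p = 0"
  by (simp add: pd_def)

lemma pd_add: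
  assumes "f differentiable (at p)" "g differentiable (at p)"
  shows "pd i (\<lambda>q. f q + g q) p = pd i f p + pd i g p"
  using pd_eqI[OF has_derivative_add[OF assms[unfolded frechet_derivative_works]]]
  by (simp add: pd_def)

lemma pd_diff:
  assumes "f differentiable (at p)" "g differentiable (at p)"
  shows "pd i (\<lambda>q. f q - g q) p = pd i f p - pd i g p"
  using pd_eqI[OF has_derivative_diff[OF assms[unfolded frechet_derivative_works]]]
  by (simp add: pd_def)

lemma pd_uminus:
  assumes "f differentiable (at p)"
  shows "pd i (\<lambda>q. - f q) p = - pd i f p"
  using pd_eqI[OF has_derivative_minus[OF assms[unfolded frechet_derivative_works]]]
  by (simp add: pd_def)

lemma pd_scaleR:
  fixes f :: "real^2 \<Rightarrow> real" and g :: "real^2 \<Rightarrow> 'b::real_normed_vector"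
  assumes "f differentiable (at p)" "g differentiable (at p)"
  shows "pd i (\<lambda>q. f q *\<^sub>R g q) p = f p *\<^sub>R pd i g p + pd i f p *\<^sub>R g p"
proof -
  have "((\<lambda>q. f q *\<^sub>R g q) has_derivative
    (\<lambda>h. f p *\<^sub>R frechet_derivative g (at p) h + frechet_derivative f (at p) h *\<^sub>R g p)) (at p)"
    using assms unfolding frechet_derivative_works by (rule has_derivative_scaleR)
  from pd_eqI[OF this] show ?thesis by (simp add: pd_def)
qed

lemma pd_mult:
  fixes f g :: "real^2 \<Rightarrow> real"
  assumes "f differentiable (at p)" "g differentiable (at p)"
  shows "pd i (\<lambda>q. f q * g q) p = pd i f p * g p + f p * pd i g p"
  using pd_scaleR[OF assms] by (simp add: algebra_simps)

lemma pd_compose_real: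
  fixes f :: "real^2 \<Rightarrow> real"
  assumes "f differentiable (at p)" "(\<phi> has_real_derivative D) (at (f p))"
  shows "pd i (\<lambda>q. \<phi> (f q)) p = D * pd i f p" "(\<lambda>q. \<phi> (f q)) differentiable (at p)"
proof -
  have "((\<lambda>q. \<phi> (f q)) has_derivative (\<lambda>h. D * frechet_derivative f (at p) h)) (at p)"
    using diff_chain_at[OF assms(1)[unfolded frechet_derivative_works], of \<phi> "(*) D"]
      assms(2)[unfolded has_field_derivative_def] by (simp add: o_def)
  then show "pd i (\<lambda>q. \<phi> (f q)) p = D * pd i f p" "(\<lambda>q. \<phi> (f q)) differentiable (at p)"
    using pd_eqI by (auto simp: pd_def differentiable_def)
qed

lemma differentiable_nth:
  fixes f :: "real^2 \<Rightarrow> real^'n"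
  assumes "f differentiable (at p)"
  shows "(\<lambda>q. f q $ k) differentiable (at p)"
  using bounded_linear.has_derivative[OF bounded_linear_vec_nth assms[unfolded frechet_derivative_works]]
  by (rule differentiableI)

lemma pd_nth:
  fixes f :: "real^2 \<Rightarrow> real^'n"
  assumes "f differentiable (at p)"
  shows "pd i (\<lambda>q. f q $ k) p = pd i f p $ k"
proof -
  have "((\<lambda>q. f q $ k) has_derivative (\<lambda>h. frechet_derivative f (at p) h $ k)) (at p)"
    using assms unfolding frechet_derivative_works
    by (rule bounded_linear.has_derivative[OF bounded_linear_vec_nth])
  from pd_eqI[OF this] show ?thesis by (simp add: pd_def)
qed

lemma differentiable_vec:
  fixes f :: "real^2 \<Rightarrow> real^'n"
  assumes "\<And>k. (\<lambda>q. f q $ k) differentiable (at p)"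
  shows "f differentiable (at p)"
proof -
  have "(f has_derivative (\<lambda>h. \<chi> k. frechet_derivative (\<lambda>q. f q $ k) (at p) h)) (at p)"
  proof (subst has_derivative_componentwise_within, intro ballI)
    fix b :: "real^'n" assume "b \<in> Basis"
    then obtain k where b: "b = axis k 1" unfolding Basis_vec_def by auto
    show "((\<lambda>x. f x \<bullet> b) has_derivative
        (\<lambda>x. (\<chi> k. frechet_derivative (\<lambda>q. f q $ k) (at p) x) \<bullet> b)) (at p)"
      using assms[of k, unfolded frechet_derivative_works] by (simp add: b inner_axis)
  qed
  then show ?thesis by (rule differentiableI)
qed

lemma pd_comp2:
  fixes f :: "real^2 \<Rightarrow> real^2" and g :: "real^2 \<Rightarrow> 'b::real_normed_vector"
  assumes "f differentiable (at p)" "g differentiable (at (f p))"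
  shows "(\<lambda>q. g (f q)) differentiable (at p)"
    "pd i (\<lambda>q. g (f q)) p = pd i f p $ 1 *\<^sub>R pd 1 g (f p) + pd i f p $ 2 *\<^sub>R pd 2 g (f p)"
proof -
  have *: "((\<lambda>q. g (f q)) has_derivative
     (\<lambda>h. frechet_derivative g (at (f p)) (frechet_derivative f (at p) h))) (at p)"
    using diff_chain_at[OF assms(1)[unfolded frechet_derivative_works]
       assms(2)[unfolded frechet_derivative_works]] by (simp add: o_def)
  then show "(\<lambda>q. g (f q)) differentiable (at p)" by (auto simp: differentiable_def)
  show "pd i (\<lambda>q. g (f q)) p = pd i f p $ 1 *\<^sub>R pd 1 g (f p) + pd i f p $ 2 *\<^sub>R pd 2 g (f p)"
    unfolding pd_eqI[OF *] frechet_eq_pd[OF assms(2)] by (simp add: pd_def)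
qed

section \<open>Smoothness classes\<close>

lemma Ck_cong:
  fixes f g :: "real^2 \<Rightarrow> 'b::real_normed_vector"
  assumes "open S" "\<And>q. q \<in> S \<Longrightarrow> f q = g q" "Ck_on k S f"
  shows "Ck_on k S g"
  using assms(2,3)
proof (induction k arbitrary: f g)
  case 0
  then show ?case using continuous_on_eq by (metis Ck_on.simps(1))
next
  case (Suc k)
  have eq: "(f has_derivative F) (at p) \<longleftrightarrow> (g has_derivative F) (at p)" if "p \<in> S" for F p
    using has_derivative_transform_within_open[OF _ assms(1) that] Suc.prems(1) by metis
  then have fe: "frechet_derivative f (at p) = frechet_derivative g (at p)" if "p \<in> S" for p
    using that unfolding frechet_derivative_def by presburger
  have "Ck_on k S (\<lambda>p. frechet_derivative g (at p) v)" for v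
  proof (rule Suc.IH)
    show "Ck_on k S (\<lambda>p. frechet_derivative f (at p) v)" using Suc.prems(2) by simp
  qed (simp add: fe)
  moreover have "g differentiable (at p)" if "p \<in> S" for p
  proof -
    have "f differentiable (at p)" using Suc.prems(2) that by simp
    then obtain F where "(f has_derivative F) (at p)" by (auto simp: differentiable_def)
    then have "(g has_derivative F) (at p)" by (simp only: eq[OF that, of F])
    then show ?thesis by (rule differentiableI)
  qed
  ultimately show ?case by simp
qed

lemma Ck_subset: "Ck_on k S f \<Longrightarrow> R \<subseteq> S \<Longrightarrow> Ck_on k R f"
  by (induction k arbitrary: f) (auto intro: continuous_on_subset)

lemma Ck_SucD:
  fixes f :: "real^2 \<Rightarrow> 'b::real_normed_vector"
  shows "Ck_on (Suc k) S f \<Longrightarrow> Ck_on k S f"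
proof (induction k arbitrary: f)
  case 0
  then show ?case
    by (simp add: continuous_at_imp_continuous_on differentiable_imp_continuous_within)
qed auto

lemma Ck_const [simp]: "Ck_on k S (\<lambda>q::real^2. c)"
  by (induction k arbitrary: c) auto

lemma Ck_add:
  fixes f g :: "real^2 \<Rightarrow> 'b::real_normed_vector"
  assumes "open S"
  shows "Ck_on k S f \<Longrightarrow> Ck_on k S g \<Longrightarrow> Ck_on k S (\<lambda>q. f q + g q)"
proof (induction k arbitrary: f g)
  case 0
  then show ?case by (auto intro: continuous_intros)
next
  case (Suc k)
  have d: "((\<lambda>q. f q + g q) has_derivative
      (\<lambda>h. frechet_derivative f (at p) h + frechet_derivative g (at p) h)) (at p)" if "p \<in> S" for p
    using Suc.prems that frechet_derivative_works by (intro has_derivative_add) auto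
  have "Ck_on k S (\<lambda>p. frechet_derivative (\<lambda>q. f q + g q) (at p) v)" for v
  proof (rule Ck_cong[OF assms _ Suc.IH[of "\<lambda>p. frechet_derivative f (at p) v"
          "\<lambda>p. frechet_derivative g (at p) v"]])
    show "frechet_derivative f (at q) v + frechet_derivative g (at q) v =
        frechet_derivative (\<lambda>q. f q + g q) (at q) v" if "q \<in> S" for q
      using frechet_derivative_at[OF d[OF that]] by metis
  qed (use Suc.prems in auto)
  then show ?case using Suc.prems by auto
qed

lemma Ck_linear:
  fixes f :: "real^2 \<Rightarrow> 'b::real_normed_vector" and L :: "'b \<Rightarrow> 'c::real_normed_vector"
  assumes "open S" "bounded_linear L"
  shows "Ck_on k S f \<Longrightarrow> Ck_on k S (\<lambda>q. L (f q))"
proof (induction k arbitrary: f)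
  case 0
  then show ?case using assms(2)
    by (simp add: bounded_linear.continuous_on)
next
  case (Suc k)
  have d: "((\<lambda>q. L (f q)) has_derivative (\<lambda>h. L (frechet_derivative f (at p) h))) (at p)"
    if "p \<in> S" for p
    using Suc.prems that frechet_derivative_works
    by (intro bounded_linear.has_derivative[OF assms(2)]) auto
  have "Ck_on k S (\<lambda>p. frechet_derivative (\<lambda>q. L (f q)) (at p) v)" for v
  proof (rule Ck_cong[OF assms(1) _ Suc.IH[of "\<lambda>p. frechet_derivative f (at p) v"]])
    show "L (frechet_derivative f (at q) v) = frechet_derivative (\<lambda>q. L (f q)) (at q) v" if "q \<in> S" for q
      using frechet_derivative_at[OF d[OF that]] by metis
  qed (use Suc.prems in auto)
  then show ?case using differentiableI[OF d] by simp
qed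

text \<open>The recursion of \<open>Ck_on\<close> ranges over all directions \<open>v\<close>;
  linearity of the derivative leaves only the two coordinate ones, so later closure proofs
  differentiate with \<open>pd\<close> alone.\<close>

lemma Ck_Suc_iff:
  fixes f :: "real^2 \<Rightarrow> 'b::real_normed_vector"
  assumes "open S"
  shows "Ck_on (Suc k) S f \<longleftrightarrow>
    (\<forall>p\<in>S. f differentiable (at p)) \<and> Ck_on k S (pd 1 f) \<and> Ck_on k S (pd 2 f)"
proof
  assume "Ck_on (Suc k) S f"
  then show "(\<forall>p\<in>S. f differentiable (at p)) \<and> Ck_on k S (pd 1 f) \<and> Ck_on k S (pd 2 f)"
    by (auto simp: pd_def[abs_def])
next
  assume R: "(\<forall>p\<in>S. f differentiable (at p)) \<and> Ck_on k S (pd 1 f) \<and> Ck_on k S (pd 2 f)"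
  have "Ck_on k S (\<lambda>p. frechet_derivative f (at p) v)" for v
  proof (rule Ck_cong[OF assms, of "\<lambda>p. v$1 *\<^sub>R pd 1 f p + v$2 *\<^sub>R pd 2 f p"])
    show "Ck_on k S (\<lambda>p. v$1 *\<^sub>R pd 1 f p + v$2 *\<^sub>R pd 2 f p)"
      using R by (intro Ck_add Ck_linear[OF _ bounded_linear_scaleR_right] assms) auto
  qed (use R frechet_eq_pd in metis)
  then show "Ck_on (Suc k) S f" using R by simp
qed

lemma Ck_scaleR:
  fixes f :: "real^2 \<Rightarrow> real" and g :: "real^2 \<Rightarrow> 'b::real_normed_vector"
  assumes "open S"
  shows "Ck_on k S f \<Longrightarrow> Ck_on k S g \<Longrightarrow> Ck_on k S (\<lambda>q. f q *\<^sub>R g q)"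
proof (induction k arbitrary: f g)
  case 0
  then show ?case by (auto intro: continuous_intros)
next
  case (Suc k)
  have d: "f differentiable (at p)" "g differentiable (at p)" if "p \<in> S" for p
    using Suc.prems that by auto
  have "Ck_on k S (pd i (\<lambda>q. f q *\<^sub>R g q))" for i
  proof (rule Ck_cong[OF assms, of "\<lambda>p. f p *\<^sub>R pd i g p + pd i f p *\<^sub>R g p"])
    show "Ck_on k S (\<lambda>p. f p *\<^sub>R pd i g p + pd i f p *\<^sub>R g p)"
      using Suc.prems Ck_SucD[OF Suc.prems(1)] Ck_SucD[OF Suc.prems(2)]
      by (intro Ck_add assms Suc.IH) (auto simp: pd_def[abs_def])
  qed (simp add: pd_scaleR d)
  then show ?case unfolding Ck_Suc_iff[OF assms] using d by simp
qed

lemma Ck_vec: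
  fixes f :: "real^2 \<Rightarrow> real^'n"
  assumes "open S" "\<And>k. Ck_on m S (\<lambda>q. f q $ k)"
  shows "Ck_on m S f"
  using assms(2)
proof (induction m arbitrary: f)
  case 0
  have "continuous_on S (\<lambda>q. \<chi> k. f q $ k)"
    using 0 by (intro continuous_on_vec_lambda) auto
  then show ?case by simp
next
  case (Suc m)
  have d: "f differentiable (at p)" if "p \<in> S" for p
    using Suc.prems that by (intro differentiable_vec) auto
  have "Ck_on m S (pd i f)" for i
  proof (rule Suc.IH)
    show "Ck_on m S (\<lambda>q. pd i f q $ k)" for k
      by (rule Ck_cong[OF assms(1), of "pd i (\<lambda>q. f q $ k)"])
        (use pd_nth[OF d] Suc.prems in \<open>simp_all add: Ck_Suc_iff[OF assms(1)] pd_def[abs_def]\<close>)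
  qed
  then show ?case using d unfolding Ck_Suc_iff[OF assms(1)] by simp
qed

text \<open>Only \<open>g\<close> is generalized in the induction: the chain rule composes the
  partials of \<open>g\<close> with the same inner map \<open>f\<close>, and multiplies them by
  components of \<open>pd i f\<close>.\<close>

lemma Ck_comp:
  fixes f :: "real^2 \<Rightarrow> real^2" and g :: "real^2 \<Rightarrow> 'b::real_normed_vector"
  assumes "open S" "open R" "f ` S \<subseteq> R"
  shows "Ck_on k S f \<Longrightarrow> Ck_on k R g \<Longrightarrow> Ck_on k S (\<lambda>q. g (f q))"
proof (induction k arbitrary: g)
  case 0
  then show ?case using assms(3) continuous_on_compose2 by (metis Ck_on.simps(1))
next
  case (Suc k)
  have d: "f differentiable (at p)" "g differentiable (at (f p))" if "p \<in> S" for p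
    using Suc.prems that assms(3) by auto
  have "Ck_on k S (pd i (\<lambda>q. g (f q)))" for i
  proof (rule Ck_cong[OF assms(1)])
    show "Ck_on k S (\<lambda>p. pd i f p $ 1 *\<^sub>R pd 1 g (f p) + pd i f p $ 2 *\<^sub>R pd 2 g (f p))"
      using Suc.prems Ck_SucD[OF Suc.prems(1)]
      by (intro Ck_add Ck_scaleR assms Suc.IH Ck_linear[OF _ bounded_linear_vec_nth])
        (auto simp: pd_def[abs_def])
  qed (simp add: pd_comp2 d)
  then show ?case unfolding Ck_Suc_iff[OF assms(1)] using pd_comp2(1)[OF d] by simp
qed

lemma smooth_onI: "(\<And>k. Ck_on k S f) \<Longrightarrow> smooth_on S f"
  by (simp add: smooth_on_def)

lemma smooth_on_differentiable: "smooth_on S f \<Longrightarrow> p \<in> S \<Longrightarrow> f differentiable (at p)"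
  unfolding smooth_on_def using Ck_on.simps(2) by blast

lemma smooth_on_continuous_on: "smooth_on S f \<Longrightarrow> continuous_on S f"
  unfolding smooth_on_def using Ck_on.simps(1) by blast

lemma smooth_on_subset: "smooth_on S f \<Longrightarrow> R \<subseteq> S \<Longrightarrow> smooth_on R f"
  unfolding smooth_on_def using Ck_subset by blast

lemma smooth_on_pd: "smooth_on S f \<Longrightarrow> smooth_on S (pd i f)"
  unfolding smooth_on_def pd_def[abs_def] using Ck_on.simps(2) by blast

lemma smooth_on_cong:
  fixes f g :: "real^2 \<Rightarrow> 'b::real_normed_vector"
  shows "open S \<Longrightarrow> (\<And>q. q \<in> S \<Longrightarrow> f q = g q) \<Longrightarrow> smooth_on S f \<Longrightarrow> smooth_on S g"
  unfolding smooth_on_def using Ck_cong by metis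

lemma smooth_on_const [simp]: "smooth_on S (\<lambda>q::real^2. c)"
  by (simp add: smooth_on_def)

lemma smooth_on_add:
  fixes f g :: "real^2 \<Rightarrow> 'b::real_normed_vector"
  shows "open S \<Longrightarrow> smooth_on S f \<Longrightarrow> smooth_on S g \<Longrightarrow> smooth_on S (\<lambda>q. f q + g q)"
  by (simp add: smooth_on_def Ck_add)

lemma smooth_on_linear:
  fixes f :: "real^2 \<Rightarrow> 'b::real_normed_vector"
  shows "open S \<Longrightarrow> bounded_linear L \<Longrightarrow> smooth_on S f \<Longrightarrow> smooth_on S (\<lambda>q. L (f q))"
  by (simp add: smooth_on_def Ck_linear)

lemma smooth_on_uminus:
  fixes f :: "real^2 \<Rightarrow> 'b::real_normed_vector"
  shows "open S \<Longrightarrow> smooth_on S f \<Longrightarrow> smooth_on S (\<lambda>q. - f q)"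
  by (rule smooth_on_linear[OF _ bounded_linear_minus[OF bounded_linear_ident]])

lemma smooth_on_diff:
  fixes f g :: "real^2 \<Rightarrow> 'b::real_normed_vector"
  shows "open S \<Longrightarrow> smooth_on S f \<Longrightarrow> smooth_on S g \<Longrightarrow> smooth_on S (\<lambda>q. f q - g q)"
  using smooth_on_add[of S f "\<lambda>q. - g q"] smooth_on_uminus[of S g] by simp

lemma smooth_on_scaleR:
  fixes g :: "real^2 \<Rightarrow> 'b::real_normed_vector"
  shows "open S \<Longrightarrow> smooth_on S f \<Longrightarrow> smooth_on S g \<Longrightarrow> smooth_on S (\<lambda>q. f q *\<^sub>R g q)"
  by (simp add: smooth_on_def Ck_scaleR)

lemma smooth_on_mult:
  fixes f g :: "real^2 \<Rightarrow> real"
  shows "open S \<Longrightarrow> smooth_on S f \<Longrightarrow> smooth_on S g \<Longrightarrow> smooth_on S (\<lambda>q. f q * g q)"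
  using smooth_on_scaleR[of S f g] by simp

lemma smooth_on_sum:
  fixes f :: "'i \<Rightarrow> real^2 \<Rightarrow> 'b::real_normed_vector"
  assumes "open S" "\<And>i. i \<in> I \<Longrightarrow> smooth_on S (f i)"
  shows "smooth_on S (\<lambda>q. \<Sum>i\<in>I. f i q)"
  using assms(2) by (induction I rule: infinite_finite_induct) (auto intro: smooth_on_add assms(1))

lemma smooth_on_nth:
  fixes f :: "real^2 \<Rightarrow> real^'n"
  shows "open S \<Longrightarrow> smooth_on S f \<Longrightarrow> smooth_on S (\<lambda>q. f q $ k)"
  by (rule smooth_on_linear[OF _ bounded_linear_vec_nth])

lemma smooth_on_vec:
  fixes f :: "real^2 \<Rightarrow> real^'n"
  shows "open S \<Longrightarrow> (\<And>k. smooth_on S (\<lambda>q. f q $ k)) \<Longrightarrow> smooth_on S f"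
  by (simp add: smooth_on_def Ck_vec)

lemma smooth_on_comp:
  fixes f :: "real^2 \<Rightarrow> real^2" and g :: "real^2 \<Rightarrow> 'b::real_normed_vector"
  shows "open S \<Longrightarrow> open R \<Longrightarrow> f ` S \<subseteq> R \<Longrightarrow> smooth_on S f \<Longrightarrow> smooth_on R g
     \<Longrightarrow> smooth_on S (\<lambda>q. g (f q))"
  by (simp add: smooth_on_def Ck_comp)

text \<open>The derivative of 1/f is a polynomial in 1/f times a derivative of \<open>f\<close>, so
  class k of 1/f yields class k+1.\<close>

lemma smooth_on_inverse:
  fixes f :: "real^2 \<Rightarrow> real"
  assumes "open S" "smooth_on S f" "\<And>q. q \<in> S \<Longrightarrow> f q \<noteq> 0"
  shows "smooth_on S (\<lambda>q. inverse (f q))"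
proof (rule smooth_onI)
  fix k
  show "Ck_on k S (\<lambda>q. inverse (f q))"
  proof (induction k)
    case 0
    then show ?case using smooth_on_continuous_on[OF assms(2)] assms(3)
      by (auto intro!: continuous_intros)
  next
    case (Suc k)
    have d: "f differentiable (at p)" if "p \<in> S" for p
      using assms(2) that smooth_on_differentiable by blast
    have r: "(inverse has_real_derivative - (inverse (f p) * inverse (f p))) (at (f p))" if "p \<in> S" for p
      using DERIV_inverse[OF assms(3)[OF that]] by (simp add: power2_eq_square)
    have "Ck_on k S (pd i (\<lambda>q. inverse (f q)))" for i
    proof (rule Ck_cong[OF assms(1)])
      show "Ck_on k S (\<lambda>p. (-1) *\<^sub>R ((inverse (f p) *\<^sub>R inverse (f p)) *\<^sub>R pd i f p))"
        using smooth_on_pd[OF assms(2), of i]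
        by (intro Ck_scaleR Suc assms(1) Ck_const) (simp add: smooth_on_def)
    qed (simp add: pd_compose_real(1)[OF d r])
    then show ?case using pd_compose_real(2)[OF d r] unfolding Ck_Suc_iff[OF assms(1)] by simp
  qed
qed

lemma smooth_on_divide:
  fixes f g :: "real^2 \<Rightarrow> real"
  assumes "open S" "smooth_on S f" "smooth_on S g" "\<And>q. q \<in> S \<Longrightarrow> g q \<noteq> 0"
  shows "smooth_on S (\<lambda>q. f q / g q)"
  unfolding divide_inverse using assms by (intro smooth_on_mult smooth_on_inverse)

lemma smooth_on_sqrt:
  fixes f :: "real^2 \<Rightarrow> real"
  assumes "open S" "smooth_on S f" "\<And>q. q \<in> S \<Longrightarrow> f q > 0"
  shows "smooth_on S (\<lambda>q. sqrt (f q))"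
proof -
  text \<open>The class is closed under \<open>1 / sqrt f\<close>, whose derivative is a polynomial in itself.\<close>
  have "smooth_on S (\<lambda>q. inverse (sqrt (f q)))"
  proof (rule smooth_onI)
    fix k
    show "Ck_on k S (\<lambda>q. inverse (sqrt (f q)))"
    proof (induction k)
      case 0
      have "sqrt (f q) \<noteq> 0" if "q \<in> S" for q using assms(3)[OF that] by simp
      then show ?case using smooth_on_continuous_on[OF assms(2)]
        by (auto intro!: continuous_intros)
    next
      case (Suc k)
      have d: "f differentiable (at p)" if "p \<in> S" for p
        using assms(2) that smooth_on_differentiable by blast
      have r: "((\<lambda>s. inverse (sqrt s)) has_real_derivative
           - 1/2 * (inverse (sqrt (f p)) * (inverse (sqrt (f p)) * inverse (sqrt (f p))))) (at (f p))"
        if "p \<in> S" for p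
        using assms(3)[OF that] by (auto intro!: derivative_eq_intros simp: field_simps)
      have "Ck_on k S (pd i (\<lambda>q. inverse (sqrt (f q))))" for i
      proof (rule Ck_cong[OF assms(1)])
        show "Ck_on k S (\<lambda>p. ((-1/2) *\<^sub>R (inverse (sqrt (f p)) *\<^sub>R (inverse (sqrt (f p)) *\<^sub>R
            inverse (sqrt (f p))))) *\<^sub>R pd i f p)"
          using smooth_on_pd[OF assms(2), of i]
          by (intro Ck_scaleR Suc assms(1) Ck_const) (simp add: smooth_on_def)
      qed (simp add: pd_compose_real(1)[OF d r])
      then show ?case using pd_compose_real(2)[OF d r] unfolding Ck_Suc_iff[OF assms(1)] by simp
    qed
  qed
  then have "smooth_on S (\<lambda>q. f q * inverse (sqrt (f q)))"
    by (intro smooth_on_mult assms)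
  then show ?thesis
  proof (rule smooth_on_cong[OF assms(1), rotated])
    show "f q * inverse (sqrt (f q)) = sqrt (f q)" if "q \<in> S" for q
      using assms(3)[OF that] by (metis divide_inverse order_less_imp_le real_div_sqrt)
  qed
qed

section \<open>Symmetry of second derivatives\<close>

lemma pd_line_deriv:
  fixes f :: "real^2 \<Rightarrow> real"
  assumes "f differentiable (at (a + t *\<^sub>R axis i 1))"
  shows "((\<lambda>s. f (a + s *\<^sub>R axis i 1)) has_real_derivative pd i f (a + t *\<^sub>R axis i 1)) (at t)"
proof -
  have l: "((\<lambda>s. a + s *\<^sub>R axis i 1) has_derivative (\<lambda>s. s *\<^sub>R (axis i 1 :: real^2))) (at t)"
    by (auto intro!: derivative_eq_intros)
  interpret bounded_linear "frechet_derivative f (at (a + t *\<^sub>R axis i 1))"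
    using assms frechet_derivative_works has_derivative_bounded_linear by blast
  show ?thesis
    using diff_chain_at[OF l assms[unfolded frechet_derivative_works]]
    by (simp add: has_field_derivative_def o_def scaleR pd_def mult_commute_abs)
qed

text \<open>Two applications of the mean value theorem, first in direction \<open>i\<close> to a
  difference of values of \<open>f\<close>, then in direction \<open>j\<close> to
  \<open>pd i f\<close>. The left side is symmetric in \<open>i\<close> and \<open>j\<close>, which
  \<open>pd_commute_real\<close> exploits.\<close>

lemma second_difference:
  fixes f :: "real^2 \<Rightarrow> real"
  assumes "smooth_on S f" "h > 0"
    and sub: "\<And>s t. 0 \<le> s \<Longrightarrow> s \<le> h \<Longrightarrow> 0 \<le> t \<Longrightarrow> t \<le> h \<Longrightarrow> p + s *\<^sub>R axis i 1 + t *\<^sub>R axis j 1 \<in> S"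
  obtains s t where "0 < s" "s < h" "0 < t" "t < h"
    "f (p + h *\<^sub>R axis i 1 + h *\<^sub>R axis j 1) - f (p + h *\<^sub>R axis i 1) - f (p + h *\<^sub>R axis j 1) + f p
      = h * h * pd j (pd i f) (p + s *\<^sub>R axis i 1 + t *\<^sub>R axis j 1)"
proof -
  let ?F = "\<lambda>s. f ((p + h *\<^sub>R axis j 1) + s *\<^sub>R axis i 1) - f (p + s *\<^sub>R axis i 1)"
  have "(?F has_real_derivative
     (pd i f ((p + h *\<^sub>R axis j 1) + s *\<^sub>R axis i 1) - pd i f (p + s *\<^sub>R axis i 1))) (at s)"
    if "0 \<le> s" "s \<le> h" for s
    using sub[of s h] sub[of s 0] that assms(2)
    by (intro DERIV_diff pd_line_deriv smooth_on_differentiable[OF assms(1)])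
      (simp_all add: add_ac)
  from MVT2[OF assms(2) this] obtain s where s: "0 < s" "s < h" "?F h - ?F 0 =
      h * (pd i f ((p + h *\<^sub>R axis j 1) + s *\<^sub>R axis i 1) - pd i f (p + s *\<^sub>R axis i 1))"
    by auto
  let ?G = "\<lambda>t. pd i f ((p + s *\<^sub>R axis i 1) + t *\<^sub>R axis j 1)"
  have "(?G has_real_derivative pd j (pd i f) ((p + s *\<^sub>R axis i 1) + t *\<^sub>R axis j 1)) (at t)"
    if "0 \<le> t" "t \<le> h" for t
    using sub[of s t] s that
    by (intro pd_line_deriv smooth_on_differentiable[OF smooth_on_pd[OF assms(1)]]) simp
  from MVT2[OF assms(2) this] obtain t where t: "0 < t" "t < h" "?G h - ?G 0 =
      h * pd j (pd i f) ((p + s *\<^sub>R axis i 1) + t *\<^sub>R axis j 1)"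
    by auto
  show thesis
    using that[OF s(1,2) t(1,2)] s(3) t(3) by (simp add: add_ac)
qed

lemma pd_commute_real:
  fixes f :: "real^2 \<Rightarrow> real"
  assumes "open S" "smooth_on S f" "p \<in> S"
  shows "pd i (pd j f) p = pd j (pd i f) p"
proof (rule ccontr)
  assume ne: "pd i (pd j f) p \<noteq> pd j (pd i f) p"
  define e where "e = \<bar>pd i (pd j f) p - pd j (pd i f) p\<bar> / 2"
  have e: "e > 0" using ne by (simp add: e_def)
  have "isCont (pd i (pd j f)) p" "isCont (pd j (pd i f)) p"
    using smooth_on_continuous_on[OF smooth_on_pd[OF smooth_on_pd[OF assms(2)]]] assms(1,3)
      continuous_on_eq_continuous_at by blast+
  then obtain d1 d2 where d: "d1 > 0" "d2 > 0"
    "\<And>q. dist q p < d1 \<Longrightarrow> \<bar>pd i (pd j f) q - pd i (pd j f) p\<bar> < e"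
    "\<And>q. dist q p < d2 \<Longrightarrow> \<bar>pd j (pd i f) q - pd j (pd i f) p\<bar> < e"
    using e unfolding continuous_at_eps_delta dist_real_def by metis
  obtain d3 where d3: "d3 > 0" "ball p d3 \<subseteq> S"
    using assms openE by blast
  \<comment> \<open>The shifted points lie within 2 h of \<open>p\<close>; a quarter of the smallest
    radius keeps them inside all three balls.\<close>
  define h where "h = min d1 (min d2 d3) / 4"
  have h: "h > 0" "2 * h < d1" "2 * h < d2" "2 * h < d3"
    using d d3 by (auto simp: h_def min_def)
  have dist: "dist (p + s *\<^sub>R axis k 1 + t *\<^sub>R axis l 1) p \<le> 2 * h"
    if "0 \<le> s" "s \<le> h" "0 \<le> t" "t \<le> h" for s t k l
  proof -
    have "norm (s *\<^sub>R axis k 1 + t *\<^sub>R axis l 1 :: real^2) \<le> \<bar>s\<bar> + \<bar>t\<bar>"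
      by (rule order_trans[OF norm_triangle_ineq]) (simp add: norm_axis_1)
    then show ?thesis using that by (simp add: dist_norm add.assoc)
  qed
  have sub: "p + s *\<^sub>R axis k 1 + t *\<^sub>R axis l 1 \<in> S"
    if "0 \<le> s" "s \<le> h" "0 \<le> t" "t \<le> h" for s t k l
    using dist[OF that, of k l] d3(2) h(4) by (auto simp: dist_commute)
  obtain s t where st: "0 < s" "s < h" "0 < t" "t < h"
    "f (p + h *\<^sub>R axis i 1 + h *\<^sub>R axis j 1) - f (p + h *\<^sub>R axis i 1) - f (p + h *\<^sub>R axis j 1) + f p
      = h * h * pd j (pd i f) (p + s *\<^sub>R axis i 1 + t *\<^sub>R axis j 1)"
    by (rule second_difference[OF assms(2) h(1), of p i j]) (rule sub, assumption+)
  obtain s' t' where st': "0 < s'" "s' < h" "0 < t'" "t' < h"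
    "f (p + h *\<^sub>R axis j 1 + h *\<^sub>R axis i 1) - f (p + h *\<^sub>R axis j 1) - f (p + h *\<^sub>R axis i 1) + f p
      = h * h * pd i (pd j f) (p + s' *\<^sub>R axis j 1 + t' *\<^sub>R axis i 1)"
    by (rule second_difference[OF assms(2) h(1), of p j i]) (rule sub, assumption+)
  have "h * h * pd j (pd i f) (p + s *\<^sub>R axis i 1 + t *\<^sub>R axis j 1)
      = h * h * pd i (pd j f) (p + s' *\<^sub>R axis j 1 + t' *\<^sub>R axis i 1)"
    using st(5) st'(5) unfolding add.assoc add.commute[of "h *\<^sub>R axis j 1"] by linarith
  then have "pd j (pd i f) (p + s *\<^sub>R axis i 1 + t *\<^sub>R axis j 1)
      = pd i (pd j f) (p + s' *\<^sub>R axis j 1 + t' *\<^sub>R axis i 1)"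
    using h(1) by simp
  moreover have "\<bar>pd j (pd i f) (p + s *\<^sub>R axis i 1 + t *\<^sub>R axis j 1) - pd j (pd i f) p\<bar> < e"
    using dist[of s t i j] st h by (intro d) simp
  moreover have "\<bar>pd i (pd j f) (p + s' *\<^sub>R axis j 1 + t' *\<^sub>R axis i 1) - pd i (pd j f) p\<bar> < e"
    using dist[of s' t' j i] st' h by (intro d) simp
  ultimately have "\<bar>pd i (pd j f) p - pd j (pd i f) p\<bar> < 2 * e" by argo
  then show False by (simp add: e_def)
qed

lemma pd_commute:
  fixes f :: "real^2 \<Rightarrow> real^'n"
  assumes "open S" "smooth_on S f" "p \<in> S"
  shows "pd i (pd j f) p = pd j (pd i f) p"
proof (subst vec_eq_iff, intro allI)
  fix k
  have *: "pd a (pd b f) p $ k = pd a (pd b (\<lambda>q. f q $ k)) p" for a b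
  proof -
    have "pd a (pd b f) p $ k = pd a (\<lambda>q. pd b f q $ k) p"
      using pd_nth[OF smooth_on_differentiable[OF smooth_on_pd[OF assms(2)] assms(3)]] by simp
    also have "\<dots> = pd a (pd b (\<lambda>q. f q $ k)) p"
      using smooth_on_differentiable[OF assms(2)]
      by (intro pd_cong[OF assms(1,3)]) (simp add: pd_nth)
    finally show ?thesis .
  qed
  show "pd i (pd j f) p $ k = pd j (pd i f) p $ k"
    unfolding * by (rule pd_commute_real[OF assms(1) smooth_on_nth[OF assms(1,2)] assms(3)])
qed

section \<open>The smooth inverse function theorem in the plane\<close>

definition jac :: "(real^2 \<Rightarrow> real^2) \<Rightarrow> real^2 \<Rightarrow> real" where
  "jac w p = pd 1 w p $ 1 * pd 2 w p $ 2 - pd 2 w p $ 1 * pd 1 w p $ 2"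

text \<open>Cramer's rule. The explicit inverse is what shows later that the partials of a local
  inverse are smooth expressions.\<close>

lemma frechet_bij:
  assumes "w differentiable (at p)" "jac w p \<noteq> 0"
  shows "inv (frechet_derivative w (at p)) v =
     vector [(pd 2 w p $ 2 * v $ 1 - pd 2 w p $ 1 * v $ 2) / jac w p,
             (pd 1 w p $ 1 * v $ 2 - pd 1 w p $ 2 * v $ 1) / jac w p]" (is "_ = ?I v")
    and "bij (frechet_derivative w (at p))"
proof -
  let ?D = "frechet_derivative w (at p)"
  have 1: "?D (?I v) = v" for v
    using assms(2) unfolding frechet_eq_pd[OF assms(1)]
    by (simp add: vec_eq_iff forall_2 field_simps) (simp add: jac_def algebra_simps)
  have 2: "?I (?D v) = v" for v
    using assms(2) unfolding frechet_eq_pd[OF assms(1)]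
    by (simp add: vec_eq_iff forall_2 divide_simps) (simp add: jac_def algebra_simps)
  show "bij ?D"
    by (rule bij_betw_byWitness[of UNIV ?I]) (simp_all only: 1 2 subset_UNIV simp_thms ball_UNIV)
  then have "?I v = inv ?D v"
    by (simp only: bij_inv_eq_iff 1)
  then show "inv ?D v = ?I v" ..
qed

text \<open>The classical theorem yields a differentiable local inverse; smoothness is a bootstrap,
  because the partials of \<open>v\<close> are Cramer expressions in the derivatives of
  \<open>w\<close>, evaluated at \<open>v\<close>.\<close>

theorem smooth_inverse_function:
  fixes w :: "real^2 \<Rightarrow> real^2"
  assumes "open \<Omega>" "smooth_on \<Omega> w" "p0 \<in> \<Omega>" and jac: "\<And>p. p \<in> \<Omega> \<Longrightarrow> jac w p \<noteq> 0"
  obtains B v where "open B" "p0 \<in> B" "B \<subseteq> \<Omega>" "open (w ` B)" "smooth_on (w ` B) v"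
    "\<And>p. p \<in> B \<Longrightarrow> v (w p) = p"
proof -
  define W where "W p = Blinfun (frechet_derivative w (at p))" for p
  have d: "w differentiable (at p)" if "p \<in> \<Omega>" for p
    using smooth_on_differentiable[OF assms(2) that] .
  then have bl: "bounded_linear (frechet_derivative w (at p))" if "p \<in> \<Omega>" for p
    using that frechet_derivative_works has_derivative_bounded_linear by blast
  then have W: "blinfun_apply (W p) = frechet_derivative w (at p)" if "p \<in> \<Omega>" for p
    unfolding W_def using that by (simp add: bounded_linear_Blinfun_apply)
  have b0: "bij (frechet_derivative w (at p0))"
    by (rule frechet_bij(2)[OF d jac]) (rule assms(3))+
  have binv: "bounded_linear (inv (frechet_derivative w (at p0)))"
    using linear_conv_bounded_linear
      linear_injective_isomorphism bl[OF assms(3)] b0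
    by (metis bij_def inj_linear_imp_inv_linear bounded_linear.linear)
  have inv0: "Blinfun (inv (frechet_derivative w (at p0))) o\<^sub>L W p0 = id_blinfun"
    by (rule blinfun_eqI)
      (simp add: W assms(3) bounded_linear_Blinfun_apply[OF binv] inv_f_f bij_is_inj[OF b0])
  have cont: "continuous_on \<Omega> W"
  proof (rule continuous_on_blinfun_componentwise)
    fix b :: "real^2" assume "b \<in> Basis"
    have "smooth_on \<Omega> (\<lambda>p. frechet_derivative w (at p) b)"
      using assms(2) unfolding smooth_on_def using Ck_on.simps(2) by blast
    then have "continuous_on \<Omega> (\<lambda>p. frechet_derivative w (at p) b)"
      by (rule smooth_on_continuous_on)
    then show "continuous_on \<Omega> (\<lambda>p. blinfun_apply (W p) b)"
      by (rule continuous_on_eq) (simp add: W)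
  qed
  have der: "(w has_derivative blinfun_apply (W p)) (at p)" if "p \<in> \<Omega>" for p
    using d[OF that] frechet_derivative_works W[OF that] by metis
  obtain B V v v' where B: "open B" "B \<subseteq> \<Omega>" "p0 \<in> B" "open V" "homeomorphism B V w v"
    and v': "\<And>y. y \<in> V \<Longrightarrow> (v has_derivative (v' y)) (at y)"
    "\<And>y. y \<in> V \<Longrightarrow> v' y = inv (blinfun_apply (W (v y)))"
    using inverse_function_theorem[OF assms(1) der cont assms(3) inv0] by metis
  have V: "V = w ` B" "v ` V = B" and vw: "\<And>p. p \<in> B \<Longrightarrow> v (w p) = p"
    using B(5) by (auto simp: homeomorphism_def)
  \<comment> \<open>\<open>\<psi> i\<close> is column \<open>i\<close> of the inverse Jacobian
    matrix, hence \<open>pd i v\<close> is \<open>\<psi> i\<close> composed with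
    \<open>v\<close>.\<close>
  define \<psi> where "\<psi> i p = (vector [(pd 2 w p $ 2 * (axis i 1 :: real^2) $ 1 - pd 2 w p $ 1 * (axis i 1 :: real^2) $ 2) / jac w p,
             (pd 1 w p $ 1 * (axis i 1 :: real^2) $ 2 - pd 1 w p $ 2 * (axis i 1 :: real^2) $ 1) / jac w p] :: real^2)" for i p
  have sj: "smooth_on \<Omega> (jac w)"
    unfolding jac_def[abs_def]
    by (intro smooth_on_diff smooth_on_mult smooth_on_nth smooth_on_pd assms)
  have s\<psi>: "smooth_on \<Omega> (\<psi> i)" for i
  proof (rule smooth_on_vec[OF assms(1)])
    have "smooth_on \<Omega> (\<lambda>q. \<psi> i q $ 1)" "smooth_on \<Omega> (\<lambda>q. \<psi> i q $ 2)"
      unfolding \<psi>_def vector_2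
      by (intro smooth_on_divide smooth_on_diff smooth_on_mult smooth_on_nth smooth_on_pd
          smooth_on_const sj jac assms; assumption)+
    then show "smooth_on \<Omega> (\<lambda>q. \<psi> i q $ k)" for k
      using exhaust_2[of k] by auto
  qed
  have pdv: "pd i v q = \<psi> i (v q)" if "q \<in> V" for i q
  proof -
    have vq: "v q \<in> \<Omega>" using V that B(2) by auto
    show ?thesis
      unfolding pd_eqI[OF v'(1)[OF that]] v'(2)[OF that] W[OF vq]
        frechet_bij(1)[OF d[OF vq] jac[OF vq]] \<psi>_def ..
  qed
  have dv: "v differentiable (at q)" if "q \<in> V" for q
    using differentiableI[OF v'(1)[OF that]] .
  \<comment> \<open>If \<open>v\<close> is of class k, then so is \<open>\<psi> i\<close> composed
    with \<open>v\<close>, which is \<open>pd i v\<close>; thus \<open>v\<close> gains one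
    order.\<close>
  have "Ck_on k V v" for k
  proof (induction k)
    case 0
    then show ?case using B(5) by (simp add: homeomorphism_def)
  next
    case (Suc k)
    have "Ck_on k V (\<lambda>q. \<psi> i (v q))" for i
      using s\<psi>[of i] V B(2) by (intro Ck_comp[OF B(4) assms(1) _ Suc]) (auto simp: smooth_on_def)
    then have "Ck_on k V (pd i v)" for i
      by (rule Ck_cong[OF B(4), rotated]) (simp add: pdv)
    then show ?case unfolding Ck_Suc_iff[OF B(4)] using dv by simp
  qed
  then have "smooth_on V v" by (simp add: smooth_on_def)
  then show thesis
    using that[of B v] B V vw by auto
qed

section \<open>Riemannian metrics in the plane\<close>

lemmas smooth_intros = smooth_on_add smooth_on_diff smooth_on_uminus smooth_on_mult smooth_on_scaleR
  smooth_on_sum smooth_on_nth smooth_on_pd smooth_on_const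

lemma matrix_inv_works:
  assumes "invertible A"
  shows "A ** matrix_inv A = mat 1" "matrix_inv A ** A = mat 1"
  using someI_ex[OF assms[unfolded invertible_def]] by (simp_all add: matrix_inv_def)

lemma matrix_inv_2x2:
  fixes A :: "real^2^2"
  assumes "det A \<noteq> 0"
  shows "matrix_inv A = vector [vector [A$2$2 / det A, - A$1$2 / det A],
                                vector [- A$2$1 / det A, A$1$1 / det A]]" (is "_ = ?B")
proof -
  have AB: "A ** ?B = mat 1"
    using assms
    by (simp add: vec_eq_iff forall_2 matrix_matrix_mult_def sum_2 mat_def divide_simps)
       (simp add: det_2 algebra_simps)
  have inv: "invertible A" using assms invertible_det_nz by blast
  have "matrix_inv A = matrix_inv A ** (A ** ?B)" unfolding AB by simp
  also have "\<dots> = ?B"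
    by (simp add: matrix_mul_assoc matrix_inv_works[OF inv])
  finally show ?thesis .
qed

definition gip :: "real^2^2 \<Rightarrow> real^2 \<Rightarrow> real^2 \<Rightarrow> real" where
  "gip G X Z = X \<bullet> (G *v Z)"

lemma gip_sum: "gip G X Z = (\<Sum>i\<in>UNIV. \<Sum>j\<in>UNIV. G $ i $ j * X $ i * Z $ j)"
  by (simp add: gip_def inner_vec_def matrix_vector_mult_def sum_distrib_left mult_ac)

lemma gip_linear:
  "gip G (X + X') Z = gip G X Z + gip G X' Z" "gip G X (Z + Z') = gip G X Z + gip G X Z'"
  "gip G (X - X') Z = gip G X Z - gip G X' Z" "gip G X (Z - Z') = gip G X Z - gip G X Z'"
  "gip G (a *\<^sub>R X) Z = a * gip G X Z" "gip G X (a *\<^sub>R Z) = a * gip G X Z"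
  "gip G (- X) Z = - gip G X Z" "gip G X (- Z) = - gip G X Z"
  "gip G 0 Z = 0" "gip G X 0 = 0"
  by (simp_all add: gip_sum sum_2 algebra_simps)

text \<open>Instantiated twice: with the Calabi metric in a chart, and with the Hessian of a graph
  function in graph coordinates.\<close>

locale plane_metric =
  fixes \<Omega> :: "(real^2) set" and g :: "real^2 \<Rightarrow> real^2^2"
  assumes open_dom: "open \<Omega>"
    and smooth_metric: "smooth_on \<Omega> (\<lambda>q. g q $ i $ j)"
    and metric_sym: "q \<in> \<Omega> \<Longrightarrow> g q $ i $ j = g q $ j $ i"
    and metric_pos: "q \<in> \<Omega> \<Longrightarrow> v \<noteq> 0 \<Longrightarrow> gip (g q) v v > 0"
begin

lemma det_metric_pos: "q \<in> \<Omega> \<Longrightarrow> det (g q) > 0"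
proof -
  assume q: "q \<in> \<Omega>"
  have 1: "g q $ 1 $ 1 > 0"
    using metric_pos[OF q, of "vector [1, 0]"] by (simp add: gip_sum sum_2 vec_eq_iff forall_2)
  \<comment> \<open>\<open>?v\<close> is \<open>g\<close>-orthogonal to the first coordinate vector,
    and its squared length is g11 times the determinant.\<close>
  let ?v = "vector [- g q $ 1 $ 2, g q $ 1 $ 1] :: real^2"
  have "?v \<noteq> 0" using 1 by (auto simp: vec_eq_iff forall_2)
  from metric_pos[OF q this] have "g q $ 1 $ 1 * det (g q) > 0"
    using metric_sym[OF q, of 2 1] by (simp add: gip_sum sum_2 det_2 algebra_simps)
  then show ?thesis using 1 by (simp add: zero_less_mult_iff)
qed

lemma gip_commute: "q \<in> \<Omega> \<Longrightarrow> gip (g q) X Z = gip (g q) Z X"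
  using metric_sym[of q 1 2] by (simp add: gip_sum sum_2 algebra_simps)

lemma invertible_metric: "q \<in> \<Omega> \<Longrightarrow> invertible (g q)"
  using det_metric_pos invertible_det_nz by (metis less_irrefl)

lemma gip_eqI:
  assumes "q \<in> \<Omega>" "\<And>Z. gip (g q) X Z = gip (g q) X' Z"
  shows "X = X'"
proof (rule ccontr)
  assume "X \<noteq> X'"
  then have "gip (g q) (X - X') (X - X') > 0" using metric_pos assms(1) by simp
  then show False using assms(2)[of "X - X'"] by (simp add: gip_linear)
qed

lemma smooth_inv_metric: "smooth_on \<Omega> (\<lambda>q. matrix_inv (g q) $ i $ j)"
proof -
  have d: "smooth_on \<Omega> (\<lambda>q. det (g q))"
    unfolding det_2 by (intro smooth_intros smooth_metric open_dom)
  have nz: "det (g q) \<noteq> 0" if "q \<in> \<Omega>" for q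
    using det_metric_pos[OF that] by simp
  have *: "smooth_on \<Omega> (\<lambda>q. matrix_inv (g q) $ i $ j)"
    if "\<And>q. q \<in> \<Omega> \<Longrightarrow> matrix_inv (g q) $ i $ j = h q / det (g q)" "smooth_on \<Omega> h" for h i j
    by (rule smooth_on_cong[OF open_dom _ smooth_on_divide[OF open_dom that(2) d nz]])
      (simp_all add: that(1))
  have "smooth_on \<Omega> (\<lambda>q. matrix_inv (g q) $ 1 $ 1)"
    by (rule *[of _ _ "\<lambda>q. g q $ 2 $ 2"]) (simp_all add: matrix_inv_2x2 nz smooth_metric)
  moreover have "smooth_on \<Omega> (\<lambda>q. matrix_inv (g q) $ 2 $ 2)"
    by (rule *[of _ _ "\<lambda>q. g q $ 1 $ 1"]) (simp_all add: matrix_inv_2x2 nz smooth_metric)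
  moreover have "smooth_on \<Omega> (\<lambda>q. matrix_inv (g q) $ 1 $ 2)"
    by (rule *[of _ _ "\<lambda>q. - g q $ 1 $ 2"])
      (simp_all add: matrix_inv_2x2 nz smooth_metric smooth_on_uminus open_dom)
  moreover have "smooth_on \<Omega> (\<lambda>q. matrix_inv (g q) $ 2 $ 1)"
    by (rule *[of _ _ "\<lambda>q. - g q $ 2 $ 1"])
      (simp_all add: matrix_inv_2x2 nz smooth_metric smooth_on_uminus open_dom)
  ultimately show ?thesis
    using exhaust_2[of i] exhaust_2[of j] by fastforce
qed

lemma smooth_christoffel: "smooth_on \<Omega> (\<lambda>q. christoffel g q i j $ k)"
  unfolding christoffel_def vec_lambda_beta
  by (intro smooth_intros smooth_inv_metric smooth_metric open_dom)

lemma smooth_christoffel_vec: "smooth_on \<Omega> (\<lambda>q. christoffel g q i j)"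
  using smooth_on_vec[OF open_dom smooth_christoffel] .

lemma pd_metric_sym: "q \<in> \<Omega> \<Longrightarrow> pd l (\<lambda>q. g q $ i $ j) q = pd l (\<lambda>q. g q $ j $ i) q"
  using metric_sym by (intro pd_cong[OF open_dom])

lemma christoffel_sym: "q \<in> \<Omega> \<Longrightarrow> christoffel g q i j = christoffel g q j i"
  using pd_metric_sym[of q _ i j] by (simp add: christoffel_def add.commute)

text \<open>Koszul's formula: lowering the index cancels the inverse metric in
  \<open>christoffel\<close>.\<close>

lemma metric_christoffel:
  assumes "q \<in> \<Omega>"
  shows "(\<Sum>k\<in>UNIV. g q $ l $ k * christoffel g q i j $ k) =
    (1/2) * (pd i (\<lambda>q. g q $ j $ l) q + pd j (\<lambda>q. g q $ i $ l) q - pd l (\<lambda>q. g q $ i $ j) q)"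
proof -
  define S where "S = (\<chi> l. pd i (\<lambda>q. g q $ j $ l) q + pd j (\<lambda>q. g q $ i $ l) q - pd l (\<lambda>q. g q $ i $ j) q)"
  have c: "christoffel g q i j = (1/2) *\<^sub>R (matrix_inv (g q) *v S)"
    by (simp add: christoffel_def S_def matrix_vector_mult_def vec_eq_iff)
  have "g q *v christoffel g q i j = (1/2) *\<^sub>R (g q *v (matrix_inv (g q) *v S))"
    unfolding c by (simp add: matrix_vector_mult_scaleR)
  also have "\<dots> = (1/2) *\<^sub>R S"
    by (simp add: matrix_vector_mul_assoc matrix_inv_works[OF invertible_metric[OF assms]])
  finally have "(g q *v christoffel g q i j) $ l = (1/2) * S $ l" by simp
  then show ?thesis by (simp add: matrix_vector_mult_def S_def)
qed

text \<open>When the two Koszul formulas are added, the derivatives of the other metric entries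
  cancel in pairs. This is metric compatibility for coordinate fields.\<close>

lemma pd_metric:
  assumes "q \<in> \<Omega>"
  shows "pd i (\<lambda>q. g q $ a $ b) q =
     (\<Sum>k\<in>UNIV. g q $ b $ k * christoffel g q i a $ k) + (\<Sum>k\<in>UNIV. g q $ a $ k * christoffel g q i b $ k)"
  unfolding metric_christoffel[OF assms]
  using pd_metric_sym[OF assms, of i a b] pd_metric_sym[OF assms, of b i a] pd_metric_sym[OF assms, of a i b]
  by (simp add: field_simps)

lemma metric_compat:
  assumes q: "q \<in> \<Omega>" and X: "X differentiable (at q)" and Z: "Z differentiable (at q)"
  shows "pd i (\<lambda>q. gip (g q) (X q) (Z q)) q =
     gip (g q) (covariant_deriv g X q i) (Z q) + gip (g q) (X q) (covariant_deriv g Z q i)"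
    and "(\<lambda>q. gip (g q) (X q) (Z q)) differentiable (at q)"
proof -
  note d = differentiable_nth[OF X] differentiable_nth[OF Z]
    smooth_on_differentiable[OF smooth_metric q]
  show "(\<lambda>q. gip (g q) (X q) (Z q)) differentiable (at q)"
    unfolding gip_sum sum_2 by (intro derivative_intros d)
  have "pd i (\<lambda>q. gip (g q) (X q) (Z q)) q =
    (\<Sum>a\<in>UNIV. \<Sum>b\<in>UNIV. pd i (\<lambda>q. g q $ a $ b) q * X q $ a * Z q $ b
      + g q $ a $ b * pd i X q $ a * Z q $ b + g q $ a $ b * X q $ a * pd i Z q $ b)"
    unfolding gip_sum sum_2
    by (simp add: pd_add pd_mult pd_nth X Z d derivative_intros algebra_simps)
  also have "\<dots> = gip (g q) (covariant_deriv g X q i) (Z q) + gip (g q) (X q) (covariant_deriv g Z q i)"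
    unfolding pd_metric[OF q] gip_sum sum_2 covariant_deriv_def
    using metric_sym[OF q, of 1 2] by (simp add: algebra_simps)
  finally show "pd i (\<lambda>q. gip (g q) (X q) (Z q)) q =
     gip (g q) (covariant_deriv g X q i) (Z q) + gip (g q) (X q) (covariant_deriv g Z q i)" .
qed

lemma smooth_gip:
  "smooth_on \<Omega> X \<Longrightarrow> smooth_on \<Omega> Z \<Longrightarrow> smooth_on \<Omega> (\<lambda>q. gip (g q) (X q) (Z q))"
  unfolding gip_sum by (intro smooth_intros smooth_metric open_dom)

lemma smooth_covariant_deriv:
  "smooth_on \<Omega> X \<Longrightarrow> smooth_on \<Omega> (\<lambda>q. covariant_deriv g X q i)"
  unfolding covariant_deriv_def by (intro smooth_intros smooth_christoffel_vec open_dom)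

text \<open>Coordinate fields commute, so the commutator of the two covariant derivatives is the
  curvature operator applied to \<open>X\<close>; the second derivatives of \<open>X\<close> cancel
  by symmetry.\<close>

lemma ricci_identity:
  assumes q: "q \<in> \<Omega>" and X: "smooth_on \<Omega> X" and flat: "\<And>k. curvature g q i j k = 0"
  shows "covariant_deriv g (\<lambda>q. covariant_deriv g X q j) q i =
         covariant_deriv g (\<lambda>q. covariant_deriv g X q i) q j"
proof -
  note d = smooth_on_differentiable[OF X q] smooth_on_differentiable[OF smooth_on_pd[OF X] q]
    smooth_on_differentiable[OF smooth_christoffel q] smooth_on_differentiable[OF smooth_christoffel_vec q]
    differentiable_nth[OF smooth_on_differentiable[OF X q]]
    differentiable_nth[OF smooth_on_differentiable[OF smooth_on_pd[OF X] q]]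
  have pdc: "pd a (\<lambda>q. covariant_deriv g X q b) q $ l = pd a (pd b X) q $ l +
      (\<Sum>m\<in>UNIV. X q $ m * pd a (\<lambda>q. christoffel g q b m $ l) q + pd a X q $ m * christoffel g q b m $ l)" for a b l
    unfolding covariant_deriv_def sum_2
    by (simp add: pd_add pd_scaleR pd_nth d derivative_intros)
  have "curvature g q i j k $ l = 0" for k l using flat by simp
  then have fl: "pd i (\<lambda>q. christoffel g q j k $ l) q = pd j (\<lambda>q. christoffel g q i k $ l) q -
    (\<Sum>m\<in>UNIV. christoffel g q j k $ m * christoffel g q i m $ l
             - christoffel g q i k $ m * christoffel g q j m $ l)" for k l
    by (simp add: curvature_def algebra_simps)
  show ?thesis
  proof (subst vec_eq_iff, rule allI)
    fix l
    have e: "covariant_deriv g Z q b $ l = pd b Z q $ l + (\<Sum>m\<in>UNIV. Z q $ m * christoffel g q b m $ l)" for Z b l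
      by (simp add: covariant_deriv_def)
    show "covariant_deriv g (\<lambda>q. covariant_deriv g X q j) q i $ l =
         covariant_deriv g (\<lambda>q. covariant_deriv g X q i) q j $ l"
      unfolding e pdc fl sum_2 unfolding pd_commute[OF open_dom X q, of i j]
      by (simp add: algebra_simps)
  qed
qed

end

section \<open>The structure equations of a Calabi patch\<close>

lemma smooth_vec3: 
  fixes y :: "real^2 \<Rightarrow> real^3"
  assumes "open S" "smooth_on S (\<lambda>q. y q $ 1)" "smooth_on S (\<lambda>q. y q $ 2)" "smooth_on S (\<lambda>q. y q $ 3)"
  shows "smooth_on S y"
proof (rule smooth_on_vec[OF assms(1)])
  show "smooth_on S (\<lambda>q. y q $ k)" for k
    using exhaust_3[of k] assms by auto
qed

lemma smooth_vec2: 
  fixes y :: "real^2 \<Rightarrow> real^2"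
  assumes "open S" "smooth_on S (\<lambda>q. y q $ 1)" "smooth_on S (\<lambda>q. y q $ 2)"
  shows "smooth_on S y"
proof (rule smooth_on_vec[OF assms(1)])
  show "smooth_on S (\<lambda>q. y q $ k)" for k
    using exhaust_2[of k] assms by auto
qed

text \<open>Projection along \<open>Yfield\<close>. Transversality gives it an invertible
  differential on a Calabi patch (\<open>jac_horiz\<close>), and its values are the graph
  coordinates.\<close>

definition horiz :: "(real^2 \<Rightarrow> real^3) \<Rightarrow> real^2 \<Rightarrow> real^2" where
  "horiz y q = vector [y q $ 1, y q $ 2]"

lemma horiz_nth [simp]: "horiz y q $ 1 = y q $ 1" "horiz y q $ 2 = y q $ 2"
  by (simp_all add: horiz_def)

lemma smooth_horiz: "open S \<Longrightarrow> smooth_on S y \<Longrightarrow> smooth_on S (horiz y)"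
  by (rule smooth_vec2) (simp_all add: smooth_on_nth)

lemma pd_horiz:
  assumes "y differentiable (at p)"
  shows "pd i (horiz y) p $ 1 = pd i y p $ 1" "pd i (horiz y) p $ 2 = pd i y p $ 2"
proof -
  have d: "horiz y differentiable (at p)"
  proof (rule differentiable_vec)
    show "(\<lambda>q. horiz y q $ k) differentiable at p" for k
      using exhaust_2[of k] differentiable_nth[OF assms] by auto
  qed
  show "pd i (horiz y) p $ 1 = pd i y p $ 1" "pd i (horiz y) p $ 2 = pd i y p $ 2"
    using pd_nth[OF d, of i 1] pd_nth[OF d, of i 2] pd_nth[OF assms, of i 1] pd_nth[OF assms, of i 2]
    by simp_all
qed

lemma pd2_horiz:
  assumes "open S" "smooth_on S y" "p \<in> S"
  shows "pd i (pd j (horiz y)) p $ 1 = pd i (pd j y) p $ 1"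
    "pd i (pd j (horiz y)) p $ 2 = pd i (pd j y) p $ 2"
proof -
  have "pd i (pd j (horiz y)) p = pd i (horiz (pd j y)) p"
    using pd_horiz[OF smooth_on_differentiable[OF assms(2)]]
    by (intro pd_cong[OF assms(1,3)]) (simp add: vec_eq_iff forall_2)
  then show "pd i (pd j (horiz y)) p $ 1 = pd i (pd j y) p $ 1"
    "pd i (pd j (horiz y)) p $ 2 = pd i (pd j y) p $ 2"
    using pd_horiz[OF smooth_on_differentiable[OF smooth_on_pd[OF assms(2)] assms(3)]] by simp_all
qed

lemma Yfield_nth [simp]: "Yfield $ 1 = 0" "Yfield $ 2 = 0" "Yfield $ 3 = 1"
  by (simp_all add: Yfield_def)

text \<open>Uniqueness for the definite description: \<open>Yfield\<close> is vertical, so the first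
  two coordinates of the difference of two solutions form a homogeneous linear system with
  determinant \<open>jac (horiz y) p\<close>, and the third coordinate then fixes
  \<open>g\<close>.\<close>

lemma structure_coeffs_eqI:
  assumes "y differentiable (at p)" "jac (horiz y) p \<noteq> 0"
    and "pd i (pd j y) p = frechet_derivative y (at p) \<Gamma> + g *\<^sub>R Yfield"
  shows "structure_coeffs y p i j = (\<Gamma>, g)"
  unfolding structure_coeffs_def
proof (rule the_equality)
  show "case (\<Gamma>, g) of (\<Gamma>, g) \<Rightarrow> pd i (pd j y) p = frechet_derivative y (at p) \<Gamma> + g *\<^sub>R Yfield"
    using assms(3) by simp
next
  fix z :: "(real^2) \<times> real"
  assume "case z of (\<Gamma>', g') \<Rightarrow> pd i (pd j y) p = frechet_derivative y (at p) \<Gamma>' + g' *\<^sub>R Yfield"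
  then obtain \<Gamma>' g' where z: "z = (\<Gamma>', g')"
    and eq: "frechet_derivative y (at p) \<Gamma> + g *\<^sub>R Yfield = frechet_derivative y (at p) \<Gamma>' + g' *\<^sub>R Yfield"
    using assms(3) by (cases z) auto
  define v where "v = \<Gamma> - \<Gamma>'"
  have c: "v $ 1 * pd 1 y p $ k + v $ 2 * pd 2 y p $ k = (g' - g) * Yfield $ k" for k
    using arg_cong[OF eq, of "\<lambda>u. u $ k"]
    unfolding frechet_eq_pd[OF assms(1)] by (simp add: v_def algebra_simps)
  let ?a = "pd 1 y p $ 1" and ?b = "pd 2 y p $ 1" and ?c = "pd 1 y p $ 2" and ?d = "pd 2 y p $ 2"
  have J: "?a * ?d - ?b * ?c \<noteq> 0" using assms(2) by (simp add: jac_def pd_horiz[OF assms(1)])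
  have e: "v$1 * ?a + v$2 * ?b = 0" "v$1 * ?c + v$2 * ?d = 0" using c[of 1] c[of 2] by simp_all
  have "v$1 * (?a * ?d - ?b * ?c) = (v$1 * ?a + v$2 * ?b) * ?d - (v$1 * ?c + v$2 * ?d) * ?b"
    "v$2 * (?a * ?d - ?b * ?c) = (v$1 * ?c + v$2 * ?d) * ?a - (v$1 * ?a + v$2 * ?b) * ?c"
    by (simp_all add: algebra_simps)
  then have v0: "v $ 1 = 0" "v $ 2 = 0" using J unfolding e by auto
  then have "\<Gamma> = \<Gamma>'" by (simp add: v_def vec_eq_iff forall_2)
  moreover have "g' = g" using c[of 3] v0 by simp
  ultimately show "z = (\<Gamma>, g)" using z by simp
qed

locale calabi_chart =
  fixes \<Omega> :: "(real^2) set" and y :: "real^2 \<Rightarrow> real^3"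
  assumes open_chart: "open \<Omega>" and patch: "calabi_patch \<Omega> y"
begin

lemma smooth_y: "smooth_on \<Omega> y"
  using patch by (simp add: calabi_patch_def)

lemma diff_y: "p \<in> \<Omega> \<Longrightarrow> y differentiable (at p)"
  using smooth_on_differentiable[OF smooth_y] .

lemma jac_horiz: assumes p: "p \<in> \<Omega>" shows "jac (horiz y) p \<noteq> 0"
proof
  assume J: "jac (horiz y) p = 0"
  let ?D = "frechet_derivative y (at p)"
  have inj: "inj ?D" and tr: "Yfield \<notin> range ?D" using patch p by (auto simp: calabi_patch_def)
  have D: "?D v $ k = v $ 1 * pd 1 y p $ k + v $ 2 * pd 2 y p $ k" for v k
    unfolding frechet_eq_pd[OF diff_y[OF p]] by simp
  interpret bounded_linear ?D
    using diff_y[OF p] frechet_derivative_works has_derivative_bounded_linear by blast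
  \<comment> \<open>A nonzero tangent vector with vertical image could be rescaled so as to map to
    \<open>Yfield\<close>, against transversality.\<close>
  have zero: "v = 0" if "?D v $ 1 = 0" "?D v $ 2 = 0" for v
  proof (rule ccontr)
    assume "v \<noteq> 0"
    then have "?D v \<noteq> 0" using inj zero by (metis injD)
    then have nz: "?D v $ 3 \<noteq> 0" using that by (auto simp: vec_eq_iff forall_3)
    have "?D ((1 / ?D v $ 3) *\<^sub>R v) = Yfield"
      unfolding scaleR using that nz by (simp add: vec_eq_iff forall_3)
    then show False using tr by (metis rangeI)
  qed
  let ?a = "pd 1 y p $ 1" and ?b = "pd 2 y p $ 1" and ?c = "pd 1 y p $ 2" and ?d = "pd 2 y p $ 2"
  have J': "?a * ?d = ?b * ?c" using J by (simp add: jac_def pd_horiz[OF diff_y[OF p]])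
  \<comment> \<open>With determinant zero both vectors have vertical image, so all four entries
    vanish; but then the first coordinate vector has vertical image as well.\<close>
  have "vector [?b, - ?a] = (0 :: real^2)" "vector [?d, - ?c] = (0 :: real^2)"
    by (rule zero; use J' in \<open>simp add: D algebra_simps\<close>)+
  then have "?a = 0" "?b = 0" "?c = 0" "?d = 0" by (auto simp: vec_eq_iff forall_2)
  then have "vector [1, 0] = (0 :: real^2)" by (intro zero) (simp_all add: D)
  then show False by (auto simp: vec_eq_iff forall_2)
qed

text \<open>Cramer's rule for the horizontal part of the structure equation; \<open>cmet\<close> is
  what remains of the vertical part. These formulas replace the definite description and make
  smoothness visible.\<close>

definition conn :: "2 \<Rightarrow> 2 \<Rightarrow> real^2 \<Rightarrow> real^2" where
  "conn i j q = vector
     [(pd i (pd j y) q $ 1 * pd 2 y q $ 2 - pd i (pd j y) q $ 2 * pd 2 y q $ 1) / jac (horiz y) q,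
      (pd i (pd j y) q $ 2 * pd 1 y q $ 1 - pd i (pd j y) q $ 1 * pd 1 y q $ 2) / jac (horiz y) q]"

definition cmet :: "2 \<Rightarrow> 2 \<Rightarrow> real^2 \<Rightarrow> real" where
  "cmet i j q = pd i (pd j y) q $ 3 - conn i j q $ 1 * pd 1 y q $ 3 - conn i j q $ 2 * pd 2 y q $ 3"

lemma conn_cmet:
  assumes p: "p \<in> \<Omega>"
  shows "pd i (pd j y) p = frechet_derivative y (at p) (conn i j p) + cmet i j p *\<^sub>R Yfield"
  using jac_horiz[OF p]
  unfolding frechet_eq_pd[OF diff_y[OF p]] vec_eq_iff forall_3
  by (simp add: cmet_def conn_def divide_simps)
    (simp add: jac_def pd_horiz[OF diff_y[OF p]] algebra_simps)

lemma structure_coeffs_eq: "p \<in> \<Omega> \<Longrightarrow> structure_coeffs y p i j = (conn i j p, cmet i j p)"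
  by (rule structure_coeffs_eqI[OF diff_y jac_horiz conn_cmet])

lemma induced_conn_eq: "p \<in> \<Omega> \<Longrightarrow> induced_conn y p i j = conn i j p"
  and calabi_metric_eq: "p \<in> \<Omega> \<Longrightarrow> calabi_metric y p $ i $ j = cmet i j p"
  by (simp_all add: induced_conn_def calabi_metric_def structure_coeffs_eq)

lemma structure_equation:
  assumes "p \<in> \<Omega>"
  shows "pd i (pd j y) p $ k = induced_conn y p i j $ 1 * pd 1 y p $ k + induced_conn y p i j $ 2 * pd 2 y p $ k
     + calabi_metric y p $ i $ j * Yfield $ k"
  using conn_cmet[OF assms, of i j] unfolding frechet_eq_pd[OF diff_y[OF assms]]
  by (simp add: induced_conn_eq[OF assms] calabi_metric_eq[OF assms])

lemma smooth_jac: "smooth_on \<Omega> (jac (horiz y))"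
  unfolding jac_def[abs_def] by (intro smooth_intros smooth_horiz smooth_y open_chart)

lemma smooth_conn: "smooth_on \<Omega> (conn i j)"
  by (rule smooth_vec2[OF open_chart])
    (simp_all only: conn_def vector_2,
      (intro smooth_on_divide smooth_intros smooth_y smooth_jac open_chart jac_horiz; assumption)+)

lemma smooth_induced_conn: "smooth_on \<Omega> (\<lambda>q. induced_conn y q i j)"
  by (rule smooth_on_cong[OF open_chart _ smooth_conn]) (simp add: induced_conn_eq)

lemma smooth_cmet: "smooth_on \<Omega> (cmet i j)"
  unfolding cmet_def[abs_def] by (intro smooth_intros smooth_y smooth_conn open_chart)

sublocale plane_metric \<Omega> "calabi_metric y"
proof
  show "smooth_on \<Omega> (\<lambda>q. calabi_metric y q $ i $ j)" for i j
    by (rule smooth_on_cong[OF open_chart _ smooth_cmet]) (simp add: calabi_metric_eq)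
  show "calabi_metric y q $ i $ j = calabi_metric y q $ j $ i" if "q \<in> \<Omega>" for i j q
    using pd_commute[OF open_chart smooth_y that, of i j] that
    by (simp add: calabi_metric_eq cmet_def conn_def)
  show "gip (calabi_metric y q) v v > 0" if "q \<in> \<Omega>" "v \<noteq> 0" for q v
    using patch that by (simp add: calabi_patch_def gip_def)
qed (rule open_chart)

lemma smooth_fubini_pick: "smooth_on \<Omega> (\<lambda>q. fubini_pick y q i j)"
  unfolding fubini_pick_def by (intro smooth_intros smooth_induced_conn smooth_christoffel_vec open_chart)

lemma smooth_tchebychev: "smooth_on \<Omega> (tchebychev y)"
  unfolding tchebychev_def[abs_def]
  by (intro smooth_intros smooth_fubini_pick smooth_inv_metric open_chart)

end

section \<open>Graphs over plane domains and their Calabi metric\<close>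

lemma graph_param_nth [simp]: "graph_param f a $ 1 = a $ 1" "graph_param f a $ 2 = a $ 2"
    "graph_param f a $ 3 = f a"
  by (simp_all add: graph_param_def)

lemma pd_coord: "pd i (\<lambda>a. a $ k) p = (axis i 1 :: real^2) $ k"
  by (rule pd_eqI) (auto intro!: derivative_eq_intros bounded_linear.has_derivative[OF bounded_linear_vec_nth])

lemma smooth_coord: "smooth_on S (\<lambda>a::real^2. a $ k)"
proof (rule smooth_onI)
  fix m show "Ck_on m S (\<lambda>a::real^2. a $ k)"
  proof (cases m)
    case 0 then show ?thesis by (auto intro!: continuous_intros)
  next
    case (Suc n)
    have 1: "((\<lambda>a. a $ k) has_derivative (\<lambda>v. v $ k)) (at p)" for p :: "real^2"
      by (intro bounded_linear.has_derivative[OF bounded_linear_vec_nth] derivative_intros)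
    show ?thesis
      using differentiableI[OF 1] frechet_derivative_at[OF 1, symmetric] Suc by auto
  qed
qed

lemma smooth_graph_param: "open V \<Longrightarrow> smooth_on V f \<Longrightarrow> smooth_on V (graph_param f)"
  by (rule smooth_vec3) (simp_all add: smooth_coord)

text \<open>The second partials of a graph parametrization are vertical, so the connection part is
  zero and the metric coefficient carries everything. Affine maximality thereby becomes a statement
  about the Hessian metric.\<close>

lemma calabi_metric_graph_param:
  assumes V: "open V" and f: "smooth_on V f" and a: "a \<in> V"
  shows "calabi_metric (graph_param f) a = hessian f a"
proof -
  note s = smooth_graph_param[OF V f]
  note d = smooth_on_differentiable[OF s]
  have pd1: "pd i (graph_param f) q = vector [(axis i 1 :: real^2) $ 1, (axis i 1 :: real^2) $ 2, pd i f q]"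
    if "q \<in> V" for i q
    unfolding vec_eq_iff forall_3 pd_nth[OF d[OF that], symmetric]
    by (simp add: pd_coord)
  have dd: "pd j (graph_param f) differentiable (at a)" for j
    using smooth_on_differentiable[OF smooth_on_pd[OF s] a] .
  have pd2: "pd i (pd j (graph_param f)) a = vector [0, 0, pd i (pd j f) a]" for i j
    unfolding vec_eq_iff forall_3 pd_nth[OF dd, symmetric]
  proof (intro conjI)
    show "pd i (\<lambda>q. pd j (graph_param f) q $ 1) a = (vector [0, 0, pd i (pd j f) a] :: real^3) $ 1"
      using pd_cong[OF V a, of "\<lambda>q. pd j (graph_param f) q $ 1" "\<lambda>q. (axis j 1 :: real^2) $ 1" i] by (simp add: pd1)
    show "pd i (\<lambda>q. pd j (graph_param f) q $ 2) a = (vector [0, 0, pd i (pd j f) a] :: real^3) $ 2"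
      using pd_cong[OF V a, of "\<lambda>q. pd j (graph_param f) q $ 2" "\<lambda>q. (axis j 1 :: real^2) $ 2" i] by (simp add: pd1)
    show "pd i (\<lambda>q. pd j (graph_param f) q $ 3) a = (vector [0, 0, pd i (pd j f) a] :: real^3) $ 3"
      using pd_cong[OF V a, of "\<lambda>q. pd j (graph_param f) q $ 3" "pd j f" i] by (simp add: pd1)
  qed
  have J: "jac (horiz (graph_param f)) a \<noteq> 0"
    by (simp add: jac_def pd_horiz[OF d[OF a]] pd1[OF a] axis_def)
  have "structure_coeffs (graph_param f) a i j = (0, pd i (pd j f) a)" for i j
  proof (rule structure_coeffs_eqI[OF d[OF a] J])
    show "pd i (pd j (graph_param f)) a = frechet_derivative (graph_param f) (at a) 0 + pd i (pd j f) a *\<^sub>R Yfield"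
      unfolding pd2 frechet_eq_pd[OF d[OF a]] by (simp add: vec_eq_iff forall_3)
  qed
  then show ?thesis
    by (simp add: calabi_metric_def hessian_def)
qed

lemma laplacian_cong:
  assumes "open V" "a \<in> V" "\<And>q. q \<in> V \<Longrightarrow> G q = G' q"
  shows "laplacian G h a = laplacian G' h a"
proof -
  have "pd i (\<lambda>q. G q $ j $ k) a = pd i (\<lambda>q. G' q $ j $ k) a" for i j k
    using assms(3) by (intro pd_cong[OF assms(1,2)]) simp
  then show ?thesis
    using assms(3)[OF assms(2)] by (simp add: laplacian_def christoffel_def)
qed

section \<open>Comparison with the graph coordinates\<close>

lemma gip_axis: "gip G X (axis j 1) = (\<Sum>i\<in>UNIV. G $ i $ j * X $ i)"
  using exhaust_2[of j] by (auto simp: gip_sum sum_2 axis_def)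

lemma gip_expand: "gip G X Z = Z $ 1 * gip G X (axis 1 1) + Z $ 2 * gip G X (axis 2 1)"
  unfolding gip_axis by (simp add: gip_sum sum_2 algebra_simps)

text \<open>\<open>w\<close>, that is \<open>horiz y\<close>, acts as the change of coordinates from
  the chart on \<open>\<Omega>\<close> to the graph coordinates on \<open>V\<close>, and
  \<open>push\<close> is its differential.\<close>

locale calabi_graph = calabi_chart +
  fixes V :: "(real^2) set" and f :: "real^2 \<Rightarrow> real"
  assumes open_V: "open V" and horiz_image: "horiz y ` \<Omega> = V" and smooth_f: "smooth_on V f"
    and height: "q \<in> \<Omega> \<Longrightarrow> y q $ 3 = f (horiz y q)"
begin

abbreviation "w \<equiv> horiz y"
abbreviation "F \<equiv> hessian f"
abbreviation "\<Phi> \<equiv> christoffel (hessian f)"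

definition push :: "real^2 \<Rightarrow> real^2 \<Rightarrow> real^2" where
  "push p X = X $ 1 *\<^sub>R pd 1 w p + X $ 2 *\<^sub>R pd 2 w p"

lemma wV: "q \<in> \<Omega> \<Longrightarrow> w q \<in> V"
  using horiz_image by auto

lemma smooth_w: "smooth_on \<Omega> w"
  by (rule smooth_horiz[OF open_chart smooth_y])

lemma diff_w: "p \<in> \<Omega> \<Longrightarrow> w differentiable (at p)" "p \<in> \<Omega> \<Longrightarrow> pd i w differentiable (at p)"
  by (rule smooth_on_differentiable[OF smooth_w], assumption)
    (rule smooth_on_differentiable[OF smooth_on_pd[OF smooth_w]])

lemma pd_w_sym: "p \<in> \<Omega> \<Longrightarrow> pd i (pd j w) p = pd j (pd i w) p"
  by (rule pd_commute[OF open_chart smooth_w])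

lemma smooth_hessian: "smooth_on V (\<lambda>q. F q $ i $ j)"
  unfolding hessian_def by (simp add: smooth_on_pd smooth_f)

lemma hessian_sym: "a \<in> V \<Longrightarrow> F a $ i $ j = F a $ j $ i"
  by (simp add: hessian_def pd_commute_real[OF open_V smooth_f])

text \<open>\<open>Yfield\<close> has no horizontal part. The horizontal half of the structure
  equation therefore says that the induced connection is pulled back from the trivial connection of
  the graph coordinates.\<close>

lemma pd2_w:
  assumes "p \<in> \<Omega>"
  shows "pd i (pd j w) p = push p (induced_conn y p i j)"
  unfolding vec_eq_iff forall_2 push_def pd2_horiz[OF open_chart smooth_y assms]
    structure_equation[OF assms]
  by (simp add: pd_horiz[OF diff_y[OF assms]])

lemma push_linear:
  "push p (X + Z) = push p X + push p Z" "push p (X - Z) = push p X - push p Z"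
  "push p (a *\<^sub>R X) = a *\<^sub>R push p X" "push p 0 = 0"
  by (simp_all add: push_def algebra_simps)

lemma push_axis: "push p (axis i 1) = pd i w p"
  using exhaust_2[of i] by (auto simp: push_def axis_def)

lemma push_sum: "push p (\<Sum>i\<in>UNIV. X (i::2)) = (\<Sum>i\<in>UNIV. push p (X i))"
  by (simp add: sum_2 push_linear)

lemma push_bij:
  assumes "p \<in> \<Omega>"
  obtains X where "Z = push p X"
proof -
  have J: "jac w p \<noteq> 0" by (rule jac_horiz[OF assms])
  have D: "frechet_derivative w (at p) X = push p X" for X
    by (simp add: push_def frechet_eq_pd[OF diff_w(1)[OF assms]])
  show thesis
    using bij_is_surj[OF frechet_bij(2)[OF diff_w(1)[OF assms] J]] D that by (metis surjD)
qed

lemma pd_comp_w: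
  fixes h :: "real^2 \<Rightarrow> 'b::real_normed_vector"
  assumes "smooth_on V h" "p \<in> \<Omega>"
  shows "(\<lambda>q. h (w q)) differentiable (at p)"
    "pd i (\<lambda>q. h (w q)) p = (\<Sum>a\<in>UNIV. pd i w p $ a *\<^sub>R pd a h (w p))"
  using pd_comp2[OF diff_w(1)[OF assms(2)] smooth_on_differentiable[OF assms(1) wV[OF assms(2)]]]
  by (simp_all add: sum_2)

text \<open>Differentiate y3 = f(w) twice: by \<open>pd2_w\<close> the terms with first derivatives
  of \<open>f\<close> belong to the tangential part, so the Hessian term is the coefficient of
  \<open>Yfield\<close>.\<close>

lemma metric_pullback:
  assumes p: "p \<in> \<Omega>"
  shows "calabi_metric y p $ i $ j = gip (F (w p)) (pd i w p) (pd j w p)"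
proof -
  have h1: "pd j (\<lambda>q. f (w q)) q = pd j w q $ 1 * pd 1 f (w q) + pd j w q $ 2 * pd 2 f (w q)"
    if "q \<in> \<Omega>" for j q
    using pd_comp_w(2)[OF smooth_f that] by (simp add: sum_2)
  have y3: "pd j y q $ 3 = pd j w q $ 1 * pd 1 f (w q) + pd j w q $ 2 * pd 2 f (w q)"
    if "q \<in> \<Omega>" for j q
  proof -
    have "pd j y q $ 3 = pd j (\<lambda>q. y q $ 3) q" by (rule pd_nth[OF diff_y[OF that], symmetric])
    also have "\<dots> = pd j (\<lambda>q. f (w q)) q"
      by (rule pd_cong[OF open_chart that]) (rule height)
    finally show ?thesis by (simp only: h1[OF that])
  qed
  note d = pd_comp_w(1)[OF smooth_on_pd[OF smooth_f] p] differentiable_nth[OF diff_w(2)[OF p]]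
  have "pd i (pd j y) p $ 3 = pd i (\<lambda>q. pd j y q $ 3) p"
    using pd_nth[OF smooth_on_differentiable[OF smooth_on_pd[OF smooth_y] p]] by simp
  also have "\<dots> = pd i (\<lambda>q. pd j w q $ 1 * pd 1 f (w q) + pd j w q $ 2 * pd 2 f (w q)) p"
    by (rule pd_cong[OF open_chart p]) (rule y3)
  also have "\<dots> = pd i (pd j w) p $ 1 * pd 1 f (w p) + pd i (pd j w) p $ 2 * pd 2 f (w p)
     + gip (F (w p)) (pd i w p) (pd j w p)"
    by (simp add: pd_add pd_mult d pd_nth[OF diff_w(2)[OF p]] pd_comp_w(2)[OF smooth_on_pd[OF smooth_f] p]
        gip_sum sum_2 hessian_def algebra_simps)
  finally show ?thesis
    unfolding structure_equation[OF p] y3[OF p] pd2_w[OF p] push_def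
    by (simp add: algebra_simps)
qed

lemma gip_pullback:
  assumes p: "p \<in> \<Omega>"
  shows "gip (calabi_metric y p) X Z = gip (F (w p)) (push p X) (push p Z)"
  unfolding gip_sum[of "calabi_metric y p"] metric_pullback[OF p] push_def sum_2
  by (simp add: gip_linear algebra_simps)

sublocale G: plane_metric V "hessian f"
proof
  show "gip (F a) v v > 0" if a: "a \<in> V" and v: "v \<noteq> 0" for a v
  proof -
    obtain p where p: "p \<in> \<Omega>" "a = w p" using a horiz_image by auto
    obtain X where X: "v = push p X" using push_bij[OF p(1)] by metis
    have "X \<noteq> 0" using v X by (auto simp: push_def)
    then show ?thesis using metric_pos[OF p(1), of X] gip_pullback[OF p(1), of X X] X p(2) by simp
  qed
qed (auto simp: open_V smooth_hessian hessian_sym)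

section \<open>The Levi-Civita connection of a Hessian metric and its pullback\<close>

abbreviation third :: "2 \<Rightarrow> 2 \<Rightarrow> 2 \<Rightarrow> real^2 \<Rightarrow> real" where
  "third b c l a \<equiv> pd b (\<lambda>q. F q $ c $ l) a"

lemma third_sym:
  assumes "a \<in> V"
  shows "third b c l a = third c b l a" "third b c l a = third b l c a"
proof -
  show "third b c l a = third c b l a"
    using pd_commute_real[OF open_V smooth_on_pd[OF smooth_f] assms] by (simp add: hessian_def)
  show "third b c l a = third b l c a"
    by (rule pd_cong[OF open_V assms]) (rule hessian_sym)
qed

text \<open>Sorts the indices, so that simplification recognizes equal third derivatives.\<close>

lemma third_canon:
  assumes "a \<in> V"
  shows "third 1 2 1 a = third 1 1 2 a" "third 2 1 1 a = third 1 1 2 a"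
    "third 2 1 2 a = third 1 2 2 a" "third 2 2 1 a = third 1 2 2 a"
  using third_sym[OF assms] by metis+

text \<open>All three terms of Koszul's formula are the same third derivative of \<open>f\<close>,
  two of them with a plus and one with a minus sign.\<close>

lemma gip_\<Phi>:
  assumes "a \<in> V"
  shows "gip (F a) (\<Phi> a b c) (axis l 1) = (1/2) * third b c l a"
proof -
  have "gip (F a) (\<Phi> a b c) (axis l 1) = (\<Sum>k\<in>UNIV. F a $ l $ k * \<Phi> a b c $ k)"
    unfolding gip_axis using hessian_sym[OF assms] by simp
  also have "\<dots> = (1/2) * third b c l a"
    unfolding G.metric_christoffel[OF assms]
    using third_sym(1)[OF assms, of c b l] third_sym(1)[OF assms, of l b c]
      third_sym(2)[OF assms, of b l c] by simp
  finally show ?thesis .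
qed

lemma pd_pullback:
  assumes p: "p \<in> \<Omega>"
  shows "pd l (\<lambda>q. calabi_metric y q $ i $ j) p =
     (\<Sum>a\<in>UNIV. \<Sum>b\<in>UNIV. \<Sum>c\<in>UNIV. third c a b (w p) * pd l w p $ c * pd i w p $ a * pd j w p $ b)
     + gip (F (w p)) (pd l (pd i w) p) (pd j w p) + gip (F (w p)) (pd i w p) (pd l (pd j w) p)"
proof -
  note d = pd_comp_w(1)[OF smooth_hessian p] differentiable_nth[OF diff_w(2)[OF p]]
  have "pd l (\<lambda>q. calabi_metric y q $ i $ j) p = pd l (\<lambda>q. gip (F (w q)) (pd i w q) (pd j w q)) p"
    by (rule pd_cong[OF open_chart p]) (rule metric_pullback)
  also have "\<dots> = (\<Sum>a\<in>UNIV. \<Sum>b\<in>UNIV. \<Sum>c\<in>UNIV. third c a b (w p) * pd l w p $ c * pd i w p $ a * pd j w p $ b)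
     + gip (F (w p)) (pd l (pd i w) p) (pd j w p) + gip (F (w p)) (pd i w p) (pd l (pd j w) p)"
    unfolding gip_sum sum_2
    by (simp add: pd_add pd_mult d pd_nth[OF diff_w(2)[OF p]] pd_comp_w(2)[OF smooth_hessian p]
        derivative_intros sum_2 algebra_simps)
  finally show ?thesis .
qed

text \<open>The transformation law of Christoffel symbols. Both sides are paired with the basis
  \<open>pd l w p\<close>: the left by Koszul's formula in the chart and the product rule
  \<open>pd_pullback\<close>, the right by \<open>gip_\<Phi>\<close>.\<close>

lemma push_christoffel:
  assumes p: "p \<in> \<Omega>"
  shows "push p (christoffel (calabi_metric y) p i j) = pd i (pd j w) p +
    (\<Sum>b\<in>UNIV. \<Sum>c\<in>UNIV. (pd i w p $ b * pd j w p $ c) *\<^sub>R \<Phi> (w p) b c)" (is "_ = ?R")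
proof -
  have R: "gip (F (w p)) ?R (axis m 1) = gip (F (w p)) (pd i (pd j w) p) (axis m 1) +
     (\<Sum>b\<in>UNIV. \<Sum>c\<in>UNIV. pd i w p $ b * pd j w p $ c * ((1/2) * third b c m (w p)))" for m
    by (simp add: gip_linear sum_2 gip_\<Phi>[OF wV[OF p]])
  have Rl: "gip (F (w p)) ?R (pd l w p) = gip (F (w p)) (pd i (pd j w) p) (pd l w p) +
     (1/2) * (\<Sum>a\<in>UNIV. \<Sum>b\<in>UNIV. \<Sum>c\<in>UNIV. third c a b (w p) * pd i w p $ c * pd j w p $ a * pd l w p $ b)" for l
    unfolding gip_expand[of _ _ "pd l w p"] R
    by (simp add: sum_2 algebra_simps third_canon[OF wV[OF p]])
  have L: "gip (F (w p)) (push p (christoffel (calabi_metric y) p i j)) (pd l w p) =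
     (1/2) * (pd i (\<lambda>q. calabi_metric y q $ j $ l) p + pd j (\<lambda>q. calabi_metric y q $ i $ l) p
        - pd l (\<lambda>q. calabi_metric y q $ i $ j) p)" for l
  proof -
    have "gip (F (w p)) (push p (christoffel (calabi_metric y) p i j)) (pd l w p)
      = gip (calabi_metric y p) (christoffel (calabi_metric y) p i j) (axis l 1)"
      unfolding gip_pullback[OF p] push_axis ..
    also have "\<dots> = (\<Sum>k\<in>UNIV. calabi_metric y p $ l $ k * christoffel (calabi_metric y) p i j $ k)"
      unfolding gip_axis using metric_sym[OF p] by simp
    finally show ?thesis unfolding metric_christoffel[OF p] .
  qed
  have eq: "gip (F (w p)) (push p (christoffel (calabi_metric y) p i j)) (pd l w p) = gip (F (w p)) ?R (pd l w p)" for l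
    unfolding L Rl pd_pullback[OF p] pd_w_sym[OF p, of j i] pd_w_sym[OF p, of l i] pd_w_sym[OF p, of l j]
      G.gip_commute[OF wV[OF p], of "pd j w p"] G.gip_commute[OF wV[OF p], of "pd i w p"]
      G.gip_commute[OF wV[OF p], of "pd l w p"]
    by (simp add: sum_2 third_canon[OF wV[OF p]] algebra_simps)
  show ?thesis
  proof (rule G.gip_eqI[OF wV[OF p]])
    fix Z
    obtain X where "Z = push p X" using push_bij[OF p] by metis
    then show "gip (F (w p)) (push p (christoffel (calabi_metric y) p i j)) Z = gip (F (w p)) ?R Z"
      by (simp add: push_def[of p X] gip_linear(2,6) eq)
  qed
qed

text \<open>With W the Jacobian matrix of \<open>w\<close>, inverting g = W^T F W gives F^(-1) = W
  g^(-1) W^T.\<close>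

lemma push_inv_metric:
  assumes p: "p \<in> \<Omega>"
  shows "(\<Sum>i\<in>UNIV. \<Sum>j\<in>UNIV. matrix_inv (calabi_metric y p) $ i $ j * (pd i w p $ b * pd j w p $ c))
    = matrix_inv (F (w p)) $ b $ c"
proof -
  define W where "W = (\<chi> a i. pd i w p $ a)"
  let ?g = "calabi_metric y p" and ?F = "F (w p)"
  have "det W = jac w p" by (simp add: W_def det_2 jac_def)
  then have invW: "invertible W" using jac_horiz[OF p] invertible_det_nz by metis
  have g: "?g = transpose W ** ?F ** W"
    by (simp add: vec_eq_iff matrix_matrix_mult_def transpose_def metric_pullback[OF p] gip_sum sum_2 W_def
        algebra_simps)
  have i: "(matrix_inv ?g ** transpose W) ** ?F ** W = mat 1"
    using matrix_inv_works(2)[OF invertible_metric[OF p]] g by (simp add: matrix_mul_assoc)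
  have "(W ** matrix_inv ?g ** transpose W) ** ?F
     = (W ** (matrix_inv ?g ** transpose W) ** ?F) ** (W ** matrix_inv W)"
    by (simp add: matrix_inv_works(1)[OF invW] matrix_mul_assoc)
  also have "\<dots> = W ** ((matrix_inv ?g ** transpose W) ** ?F ** W) ** matrix_inv W"
    by (simp only: matrix_mul_assoc)
  also have "\<dots> = mat 1" unfolding i by (simp add: matrix_inv_works(1)[OF invW])
  finally have "(W ** matrix_inv ?g ** transpose W) ** ?F ** matrix_inv ?F = matrix_inv ?F" by simp
  then have "W ** matrix_inv ?g ** transpose W = matrix_inv ?F"
    by (simp add: matrix_mul_assoc[symmetric] matrix_inv_works(1)[OF G.invertible_metric[OF wV[OF p]]])
  then have "(W ** matrix_inv ?g ** transpose W) $ b $ c = matrix_inv ?F $ b $ c" by simp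
  then show ?thesis
    by (simp add: matrix_matrix_mult_def transpose_def W_def sum_2 algebra_simps)
qed

text \<open>The Tchebychev field in graph coordinates: the induced connection is trivial there, so
  the Fubini-Pick tensor is minus the Levi-Civita connection.\<close>

definition \<tau> :: "real^2 \<Rightarrow> real^2" where
  "\<tau> a = (-1/2) *\<^sub>R (\<Sum>b\<in>UNIV. \<Sum>c\<in>UNIV. matrix_inv (F a) $ b $ c *\<^sub>R \<Phi> a b c)"

lemma smooth_\<tau>: "smooth_on V \<tau>"
  unfolding \<tau>_def[abs_def]
  by (intro smooth_intros G.smooth_inv_metric G.smooth_christoffel_vec open_V)

lemma push_tchebychev:
  assumes p: "p \<in> \<Omega>"
  shows "push p (tchebychev y p) = \<tau> (w p)"
proof -
  have fp: "push p (fubini_pick y p i j) =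
     - (\<Sum>b\<in>UNIV. \<Sum>c\<in>UNIV. (pd i w p $ b * pd j w p $ c) *\<^sub>R \<Phi> (w p) b c)" for i j
    by (simp add: fubini_pick_def push_linear push_christoffel[OF p] pd2_w[OF p])
  have "push p (tchebychev y p) = (1/2) *\<^sub>R (\<Sum>i\<in>UNIV. \<Sum>j\<in>UNIV. matrix_inv (calabi_metric y p) $ i $ j *\<^sub>R
     - (\<Sum>b\<in>UNIV. \<Sum>c\<in>UNIV. (pd i w p $ b * pd j w p $ c) *\<^sub>R \<Phi> (w p) b c))"
    unfolding tchebychev_def push_linear push_sum fp ..
  also have "\<dots> = (-1/2) *\<^sub>R (\<Sum>b\<in>UNIV. \<Sum>c\<in>UNIV. (\<Sum>i\<in>UNIV. \<Sum>j\<in>UNIV.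
      matrix_inv (calabi_metric y p) $ i $ j * (pd i w p $ b * pd j w p $ c)) *\<^sub>R \<Phi> (w p) b c)"
    by (simp add: sum_2 algebra_simps vec_eq_iff)
  finally show ?thesis unfolding push_inv_metric[OF p] \<tau>_def .
qed

text \<open>Naturality, obtained by differentiating \<open>push_tchebychev\<close>: the second
  partials of \<open>w\<close> that arise cancel against the inhomogeneous term of
  \<open>push_christoffel\<close>.\<close>

lemma push_covariant_deriv:
  assumes p: "p \<in> \<Omega>"
  shows "push p (covariant_deriv (calabi_metric y) (tchebychev y) p i) =
     (\<Sum>b\<in>UNIV. pd i w p $ b *\<^sub>R covariant_deriv F \<tau> (w p) b)"
proof -
  let ?T = "tchebychev y"
  note dT = smooth_on_differentiable[OF smooth_tchebychev p]
  have "pd i (\<lambda>q. push q (?T q)) p = pd i (\<lambda>q. \<tau> (w q)) p"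
    by (rule pd_cong[OF open_chart p]) (rule push_tchebychev)
  also have "\<dots> = (\<Sum>b\<in>UNIV. pd i w p $ b *\<^sub>R pd b \<tau> (w p))"
    by (rule pd_comp_w(2)[OF smooth_\<tau> p])
  also have "pd i (\<lambda>q. push q (?T q)) p = push p (pd i ?T p)
     + (\<Sum>k\<in>UNIV. ?T p $ k *\<^sub>R pd i (pd k w) p)"
    unfolding push_def sum_2
    by (simp add: pd_add pd_scaleR pd_nth[OF dT] differentiable_nth[OF dT] diff_w[OF p] derivative_intros)
  finally have 1: "push p (pd i ?T p) = (\<Sum>b\<in>UNIV. pd i w p $ b *\<^sub>R pd b \<tau> (w p))
      - (\<Sum>k\<in>UNIV. ?T p $ k *\<^sub>R pd i (pd k w) p)"
    by (simp only: eq_diff_eq)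
  have 2: "\<tau> (w p) $ c = ?T p $ 1 * pd 1 w p $ c + ?T p $ 2 * pd 2 w p $ c" for c
    unfolding push_tchebychev[OF p, symmetric] push_def by simp
  show ?thesis
    unfolding covariant_deriv_def push_linear push_sum 1 push_christoffel[OF p] 2
    by (simp add: sum_2 algebra_simps)
qed

section \<open>The Tchebychev field as a gradient of the logarithmic Hessian determinant\<close>

definition ldet :: "real^2 \<Rightarrow> real" where "ldet b = ln (det (F b))"

lemma smooth_det: "smooth_on V (\<lambda>q. det (F q))"
  unfolding det_2 by (intro smooth_intros smooth_hessian open_V)

text \<open>Jacobi's formula for the derivative of ln det, written out for a two by two
  matrix.\<close>

lemma pd_ldet:
  assumes a: "a \<in> V"
  shows "pd c ldet a = (\<Sum>b\<in>UNIV. \<Sum>d\<in>UNIV. matrix_inv (F a) $ b $ d * third c b d a)"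
proof -
  note d = smooth_on_differentiable[OF smooth_hessian a]
  have D: "det (F a) > 0" by (rule G.det_metric_pos[OF a])
  have "pd c ldet a = inverse (det (F a)) * pd c (\<lambda>q. det (F q)) a"
    unfolding ldet_def[abs_def]
    by (rule pd_compose_real(1)[OF smooth_on_differentiable[OF smooth_det a]])
      (use D in \<open>auto intro!: derivative_eq_intros simp: divide_inverse\<close>)
  also have "pd c (\<lambda>q. det (F q)) a = third c 1 1 a * F a $ 2 $ 2 + F a $ 1 $ 1 * third c 2 2 a
     - third c 1 2 a * F a $ 2 $ 1 - F a $ 1 $ 2 * third c 2 1 a"
    unfolding det_2 by (simp add: pd_diff pd_mult d derivative_intros)
  finally have "pd c ldet a = inverse (det (F a)) * (third c 1 1 a * F a $ 2 $ 2 + F a $ 1 $ 1 * third c 2 2 a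
     - third c 1 2 a * F a $ 2 $ 1 - F a $ 1 $ 2 * third c 2 1 a)" .
  then show ?thesis
    using D third_sym(2)[OF a, of c 2 1]
    by (simp add: sum_2 matrix_inv_2x2 divide_inverse algebra_simps)
qed

text \<open>Total symmetry of third derivatives moves the free index to the front, where the trace
  becomes Jacobi's formula. Thus \<open>\<tau>\<close> is -1/4 times the gradient of
  \<open>ldet\<close>.\<close>

lemma gip_\<tau>:
  assumes a: "a \<in> V"
  shows "gip (F a) (\<tau> a) (axis c 1) = (-1/4) * pd c ldet a"
proof -
  have "gip (F a) (\<tau> a) (axis c 1) =
      (-1/2) * (\<Sum>b\<in>UNIV. \<Sum>d\<in>UNIV. matrix_inv (F a) $ b $ d * ((1/2) * third b d c a))"
    by (simp add: \<tau>_def gip_linear sum_2 gip_\<Phi>[OF a])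
  also have "\<dots> = (-1/4) * (\<Sum>b\<in>UNIV. \<Sum>d\<in>UNIV. matrix_inv (F a) $ b $ d * third c b d a)"
    using third_sym[OF a] by (simp add: sum_2 algebra_simps)
  finally show ?thesis unfolding pd_ldet[OF a] .
qed

lemma smooth_pd_ldet: "smooth_on V (pd c ldet)"
proof (rule smooth_on_cong[OF open_V])
  show "smooth_on V (\<lambda>a. \<Sum>b\<in>UNIV. \<Sum>d\<in>UNIV. matrix_inv (F a) $ b $ d * third c b d a)"
    by (intro smooth_intros smooth_hessian G.smooth_inv_metric open_V)
qed (simp add: pd_ldet)

definition S :: "2 \<Rightarrow> 2 \<Rightarrow> real^2 \<Rightarrow> real" where
  "S b c a = gip (F a) (covariant_deriv F \<tau> a b) (axis c 1)"

text \<open>Differentiating \<open>gip_\<tau>\<close> and moving the derivative of the coordinate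
  field to the other side exhibits \<open>S\<close> as -1/4 times the covariant Hessian of
  \<open>ldet\<close>. Symmetry and trace of N are read off from this.\<close>

lemma S_eq:
  assumes a: "a \<in> V"
  shows "S b c a = (-1/4) * (pd b (pd c ldet) a - (\<Sum>d\<in>UNIV. \<Phi> a b c $ d * pd d ldet a))"
proof -
  have cd: "covariant_deriv F (\<lambda>_. axis c 1) a b = \<Phi> a b c"
    using exhaust_2[of c] by (auto simp: covariant_deriv_def sum_2 axis_def)
  have "pd b (\<lambda>q. gip (F q) (\<tau> q) (axis c 1)) a = S b c a + gip (F a) (\<tau> a) (\<Phi> a b c)"
    using G.metric_compat(1)[OF a smooth_on_differentiable[OF smooth_\<tau> a], of "\<lambda>_. axis c 1" b] cd
    by (simp add: S_def)
  moreover have "pd b (\<lambda>q. gip (F q) (\<tau> q) (axis c 1)) a = pd b (\<lambda>q. (-1/4) *\<^sub>R pd c ldet q) a"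
    by (rule pd_cong[OF open_V a]) (simp add: gip_\<tau>)
  moreover have "pd b (\<lambda>q. (-1/4) *\<^sub>R pd c ldet q) a = (-1/4) * pd b (pd c ldet) a"
    by (subst pd_scaleR) (simp_all add: smooth_on_differentiable[OF smooth_pd_ldet a])
  moreover have "gip (F a) (\<tau> a) (\<Phi> a b c) = (-1/4) * (\<Sum>d\<in>UNIV. \<Phi> a b c $ d * pd d ldet a)"
    by (simp add: gip_expand[of _ _ "\<Phi> a b c"] gip_\<tau>[OF a] sum_2 algebra_simps)
  ultimately show ?thesis by (simp add: algebra_simps)
qed

lemma S_sym: "a \<in> V \<Longrightarrow> S b c a = S c b a"
proof -
  assume a: "a \<in> V"
  have "pd b (pd c ldet) a = pd c (pd b ldet) a"
  proof -
    have "smooth_on V ldet"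
    proof (rule smooth_onI)
      fix k show "Ck_on k V ldet"
      proof (cases k)
        case 0
        have "det (F q) > 0" if "q \<in> V" for q by (rule G.det_metric_pos[OF that])
        then show ?thesis using 0 smooth_on_continuous_on[OF smooth_det]
          by (force simp: ldet_def[abs_def] intro!: continuous_intros)
      next
        case (Suc m)
        have "ldet differentiable (at q)" if "q \<in> V" for q
          unfolding ldet_def[abs_def]
          by (rule pd_compose_real(2)[OF smooth_on_differentiable[OF smooth_det that] DERIV_ln])
            (rule G.det_metric_pos[OF that])
        then show ?thesis
          unfolding Suc Ck_Suc_iff[OF open_V] using smooth_pd_ldet by (simp add: smooth_on_def)
      qed
    qed
    then show ?thesis by (rule pd_commute_real[OF open_V _ a])
  qed
  then show ?thesis unfolding S_eq[OF a] G.christoffel_sym[OF a, of b c] by simp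
qed

lemma S_contract:
  assumes "a \<in> V"
  shows "(\<Sum>b\<in>UNIV. \<Sum>c\<in>UNIV. matrix_inv (F a) $ b $ c * S b c a) = (-1/4) * laplacian F ldet a"
  by (simp add: S_eq[OF assms] laplacian_def sum_2 algebra_simps)

lemma gip_covariant_tchebychev:
  assumes p: "p \<in> \<Omega>"
  shows "gip (calabi_metric y p) (covariant_deriv (calabi_metric y) (tchebychev y) p i) (axis j 1)
    = (\<Sum>b\<in>UNIV. \<Sum>c\<in>UNIV. pd i w p $ b * pd j w p $ c * S b c (w p))"
  unfolding gip_pullback[OF p] push_covariant_deriv[OF p] push_axis
  by (simp add: gip_expand[of _ _ "pd j w p"] gip_linear S_def sum_2 algebra_simps)

lemma covariant_tchebychev_sym:
  assumes p: "p \<in> \<Omega>"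
  shows "gip (calabi_metric y p) (covariant_deriv (calabi_metric y) (tchebychev y) p i) (axis j 1)
    = gip (calabi_metric y p) (covariant_deriv (calabi_metric y) (tchebychev y) p j) (axis i 1)"
  unfolding gip_covariant_tchebychev[OF p] sum_2 S_sym[OF wV[OF p], of 2 1]
  by (simp add: algebra_simps)

text \<open>The trace is a contraction with the inverse metric, which \<open>push_inv_metric\<close>
  carries to graph coordinates. The Laplacian that appears is the one annihilated by affine
  maximality.\<close>

lemma trace_covariant_tchebychev:
  assumes p: "p \<in> \<Omega>"
  shows "covariant_deriv (calabi_metric y) (tchebychev y) p 1 $ 1 +
     covariant_deriv (calabi_metric y) (tchebychev y) p 2 $ 2 = (-1/4) * laplacian F ldet (w p)"
proof -
  let ?g = "calabi_metric y p" and ?N = "covariant_deriv (calabi_metric y) (tchebychev y) p"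
  have N: "?N i $ k = (\<Sum>j\<in>UNIV. matrix_inv ?g $ k $ j * gip ?g (?N i) (axis j 1))" for i k
  proof -
    have "?N i = matrix_inv ?g *v (?g *v ?N i)"
      by (simp add: matrix_vector_mul_assoc matrix_inv_works[OF invertible_metric[OF p]])
    then have "?N i $ k = (matrix_inv ?g *v (?g *v ?N i)) $ k" by simp
    then show ?thesis
      unfolding gip_axis using metric_sym[OF p] by (simp add: matrix_vector_mult_def)
  qed
  have "?N 1 $ 1 + ?N 2 $ 2 = (\<Sum>i\<in>UNIV. \<Sum>j\<in>UNIV. matrix_inv ?g $ i $ j * gip ?g (?N i) (axis j 1))"
    unfolding N[of 1 1] N[of 2 2] by (simp add: sum_2)
  also have "\<dots> = (\<Sum>b\<in>UNIV. \<Sum>c\<in>UNIV. (\<Sum>i\<in>UNIV. \<Sum>j\<in>UNIV.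
      matrix_inv ?g $ i $ j * (pd i w p $ b * pd j w p $ c)) * S b c (w p))"
    unfolding gip_covariant_tchebychev[OF p] by (simp add: sum_2 algebra_simps)
  finally show ?thesis
    unfolding push_inv_metric[OF p] S_contract[OF wV[OF p]] .
qed

end

section \<open>The eigenframe of the covariant derivative of the Tchebychev field\<close>

lemma (in calabi_chart) tangent_normal_independent:
  assumes p: "p \<in> \<Omega>" and eq: "\<And>k. a * pd 1 y p $ k + b * pd 2 y p $ k + \<gamma> * Yfield $ k = 0"
  shows "a = 0" "b = 0" "\<gamma> = 0"
proof -
  let ?a = "pd 1 y p $ 1" and ?b = "pd 2 y p $ 1" and ?c = "pd 1 y p $ 2" and ?d = "pd 2 y p $ 2"
  have J: "?a * ?d - ?b * ?c \<noteq> 0" using jac_horiz[OF p] by (simp add: jac_def pd_horiz[OF diff_y[OF p]])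
  have e: "a * ?a + b * ?b = 0" "a * ?c + b * ?d = 0" using eq[of 1] eq[of 2] by simp_all
  have "a * (?a * ?d - ?b * ?c) = (a * ?a + b * ?b) * ?d - (a * ?c + b * ?d) * ?b"
    "b * (?a * ?d - ?b * ?c) = (a * ?c + b * ?d) * ?a - (a * ?a + b * ?b) * ?c"
    by (simp_all add: algebra_simps)
  then show "a = 0" "b = 0" using J unfolding e by auto
  then show "\<gamma> = 0" using eq[of 3] by simp
qed

text \<open>\<open>N_sym\<close> and \<open>N_trace\<close> are the two facts supplied by the graph
  comparison; with them as assumptions, the local analysis proceeds in an arbitrary chart without
  reference to graphs.\<close>

locale flat_chart = calabi_chart +
  fixes c :: real
  assumes flat: "p \<in> \<Omega> \<Longrightarrow> curvature (calabi_metric y) p i j k = 0"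
    and c_pos: "c > 0"
    and norm_c: "p \<in> \<Omega> \<Longrightarrow>
      endo_norm (calabi_metric y p) (covariant_deriv (calabi_metric y) (tchebychev y) p) = c"
    and N_sym: "p \<in> \<Omega> \<Longrightarrow>
      gip (calabi_metric y p) (covariant_deriv (calabi_metric y) (tchebychev y) p i) (axis j 1)
      = gip (calabi_metric y p) (covariant_deriv (calabi_metric y) (tchebychev y) p j) (axis i 1)"
    and N_trace: "p \<in> \<Omega> \<Longrightarrow> covariant_deriv (calabi_metric y) (tchebychev y) p 1 $ 1 +
      covariant_deriv (calabi_metric y) (tchebychev y) p 2 $ 2 = 0"
begin

abbreviation "g \<equiv> calabi_metric y"
abbreviation "T \<equiv> tchebychev y"
abbreviation "N p i \<equiv> covariant_deriv g T p i"

definition n :: real where "n = c / sqrt 2"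

lemma n_pos: "n > 0"
  using c_pos by (simp add: n_def)

definition Nm :: "real^2 \<Rightarrow> real^2 \<Rightarrow> real^2" where
  "Nm p X = X $ 1 *\<^sub>R N p 1 + X $ 2 *\<^sub>R N p 2"

lemma Nm_axis: "Nm p (axis i 1) = N p i"
  using exhaust_2[of i] by (auto simp: Nm_def axis_def)

lemma Nm_selfadjoint:
  assumes "p \<in> \<Omega>" shows "gip (g p) (Nm p X) Z = gip (g p) X (Nm p Z)"
  unfolding gip_commute[OF assms, of X] gip_expand[of _ _ Z] gip_expand[of _ _ X]
  unfolding Nm_def gip_linear N_sym[OF assms, of 2 1] by (simp add: algebra_simps)

text \<open>For a trace-free self-adjoint N the squared norm c^2 = 2 n^2 is the trace of N^2, which
  is twice the left side.\<close>

lemma N_square_entries: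
  assumes p: "p \<in> \<Omega>"
  shows "(N p 1 $ 1)\<^sup>2 + N p 1 $ 2 * N p 2 $ 1 = n\<^sup>2"
proof -
  define a b d A B D where v: "a = N p 1 $ 1" "b = N p 1 $ 2" "d = N p 2 $ 1"
    "A = g p $ 1 $ 1" "B = g p $ 1 $ 2" "D = g p $ 2 $ 2"
  have N22: "N p 2 $ 2 = - a" using N_trace[OF p] by (simp add: v)
  have g21: "g p $ 2 $ 1 = B" using metric_sym[OF p, of 2 1] by (simp add: v)
  have det: "det (g p) = A * D - B\<^sup>2" using g21 by (simp add: det_2 v power2_eq_square)
  have pos: "A * D - B\<^sup>2 > 0" using det_metric_pos[OF p] by (simp add: det)
  have lin: "2 * B * a + D * b - A * d = 0"
    using N_sym[OF p, of 1 2] N22 g21 by (simp add: gip_axis sum_2 v)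
  have "c\<^sup>2 = (\<Sum>i\<in>UNIV. \<Sum>j\<in>UNIV. \<Sum>k\<in>UNIV. \<Sum>l\<in>UNIV.
     matrix_inv (g p) $ i $ j * g p $ k $ l * N p i $ k * N p j $ l)" (is "_ = ?s")
  proof -
    have "sqrt ?s = c" using norm_c[OF p] by (simp add: endo_norm_def)
    moreover have "c\<^sup>2 = s" if "sqrt s = c" for s
      using that c_pos by (metis less_eq_real_def real_sqrt_gt_0_iff real_sqrt_pow2)
    ultimately show ?thesis by (simp only:)
  qed
  also have "\<dots> = (D * (A * a\<^sup>2 + 2 * B * a * b + D * b\<^sup>2) - 2 * B * (A * a * d + B * (b * d - a\<^sup>2) - D * a * b)
      + A * (A * d\<^sup>2 - 2 * B * a * d + D * a\<^sup>2)) / (A * D - B\<^sup>2)"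
    using pos det by (simp add: sum_2 matrix_inv_2x2 N22 g21 v(1-3)[symmetric] v(4-6)[symmetric] det divide_simps)
      (simp add: algebra_simps power2_eq_square)
  \<comment> \<open>The numerator splits into the square of the self-adjointness defect, zero by
    \<open>lin\<close>, and a multiple of a^2 + b d.\<close>
  also have "\<dots> = ((2 * B * a + D * b - A * d)\<^sup>2 + 2 * (a\<^sup>2 + b * d) * (A * D - B\<^sup>2)) / (A * D - B\<^sup>2)"
    by (simp add: algebra_simps power2_eq_square)
  also have "\<dots> = 2 * (a\<^sup>2 + b * d)"
    using pos unfolding lin by simp
  finally show ?thesis by (simp add: v n_def power_divide)
qed

text \<open>Cayley-Hamilton: a trace-free N satisfies N^2 = - det N, and - det N is the left side of
  \<open>N_square_entries\<close>.\<close>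

lemma Nm_Nm:
  assumes p: "p \<in> \<Omega>" shows "Nm p (Nm p X) = n\<^sup>2 *\<^sub>R X"
proof -
  have "N p 2 $ 2 = - N p 1 $ 1" using N_trace[OF p] by simp
  then show ?thesis
    unfolding N_square_entries[OF p, symmetric]
    by (simp add: Nm_def vec_eq_iff forall_2 algebra_simps power2_eq_square)
qed

lemma smooth_N: "smooth_on \<Omega> (\<lambda>p. N p i)"
  by (rule smooth_covariant_deriv[OF smooth_tchebychev])

lemma smooth_Nm_const: "smooth_on \<Omega> (\<lambda>p. Nm p v)"
  unfolding Nm_def by (intro smooth_intros smooth_N open_chart)

text \<open>Since (N - s)(N + s) = 0, the image of N + s consists of eigenvectors for
  \<open>s\<close>. Some coordinate vector is not killed by N + s, for otherwise N = -s would have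
  trace -2 s. Normalizing its image gives a smooth field.\<close>

lemma unit_eigenfield:
  assumes p0: "p0 \<in> \<Omega>" and s: "\<bar>s\<bar> = n"
  obtains B E where "open B" "p0 \<in> B" "B \<subseteq> \<Omega>" "smooth_on B E"
    "\<And>p. p \<in> B \<Longrightarrow> gip (g p) (E p) (E p) = 1" "\<And>p. p \<in> B \<Longrightarrow> Nm p (E p) = s *\<^sub>R E p"
proof -
  have s2: "s\<^sup>2 = n\<^sup>2" using s n_pos by (metis power2_abs)
  have "\<exists>i. Nm p0 (axis i 1) + s *\<^sub>R axis i 1 \<noteq> 0"
  proof (rule ccontr)
    assume "\<not> ?thesis"
    then have "N p0 i = - (s *\<^sub>R axis i 1)" for i
      unfolding Nm_axis by (metis eq_neg_iff_add_eq_0)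
    then have "N p0 1 $ 1 + N p0 2 $ 2 = - 2 * s" by (simp add: axis_def)
    then show False using N_trace[OF p0] s n_pos by simp
  qed
  then obtain i where i: "Nm p0 (axis i 1) + s *\<^sub>R axis i 1 \<noteq> 0" by blast
  define X where "X p = Nm p (axis i 1) + s *\<^sub>R axis i 1" for p
  have sX: "smooth_on \<Omega> X"
    unfolding X_def[abs_def] by (intro smooth_intros smooth_Nm_const open_chart)
  let ?r = "\<lambda>p. gip (g p) (X p) (X p)"
  have sr: "smooth_on \<Omega> ?r" by (rule smooth_gip[OF sX sX])
  define B where "B = ?r -` {0<..} \<inter> \<Omega>"
  have oB: "open B"
    unfolding B_def
    using continuous_on_open_vimage[OF open_chart, of ?r] smooth_on_continuous_on[OF sr] open_greaterThan
    by simp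
  have B: "B \<subseteq> \<Omega>" "p0 \<in> B" using p0 i metric_pos[OF p0, of "X p0"] by (auto simp: B_def X_def)
  define E where "E p = inverse (sqrt (?r p)) *\<^sub>R X p" for p
  have pos: "?r p > 0" if "p \<in> B" for p using that by (simp add: B_def)
  have sB: "smooth_on B X" "smooth_on B ?r"
    using smooth_on_subset[OF sX B(1)] smooth_on_subset[OF sr B(1)] by auto
  have "smooth_on B E"
    unfolding E_def[abs_def] using pos
    by (intro smooth_on_scaleR smooth_on_inverse smooth_on_sqrt oB sB) (auto simp: less_imp_neq[symmetric])
  moreover have "gip (g p) (E p) (E p) = 1" if "p \<in> B" for p
    using pos[OF that] by (simp add: E_def gip_linear field_simps)
  moreover have "Nm p (E p) = s *\<^sub>R E p" if "p \<in> B" for p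
  proof -
    have p: "p \<in> \<Omega>" using that B by auto
    have lin: "Nm p (U + U') = Nm p U + Nm p U'" "Nm p (a *\<^sub>R U) = a *\<^sub>R Nm p U" for U U' a
      by (simp_all add: Nm_def algebra_simps)
    have "Nm p (X p) = s *\<^sub>R X p"
      unfolding X_def lin Nm_Nm[OF p] s2[symmetric] by (simp add: algebra_simps power2_eq_square)
    then show ?thesis by (simp add: E_def lin)
  qed
  ultimately show thesis using that oB B by blast
qed

lemma eigenframe:
  assumes p0: "p0 \<in> \<Omega>"
  obtains B E1 E2 where "open B" "p0 \<in> B" "B \<subseteq> \<Omega>" "smooth_on B E1" "smooth_on B E2"
    "\<And>p. p \<in> B \<Longrightarrow> gip (g p) (E1 p) (E1 p) = 1" "\<And>p. p \<in> B \<Longrightarrow> gip (g p) (E2 p) (E2 p) = 1"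
    "\<And>p. p \<in> B \<Longrightarrow> gip (g p) (E1 p) (E2 p) = 0"
    "\<And>p. p \<in> B \<Longrightarrow> Nm p (E1 p) = n *\<^sub>R E1 p" "\<And>p. p \<in> B \<Longrightarrow> Nm p (E2 p) = (- n) *\<^sub>R E2 p"
proof -
  obtain B1 E1 where 1: "open B1" "p0 \<in> B1" "B1 \<subseteq> \<Omega>" "smooth_on B1 E1"
    "\<And>p. p \<in> B1 \<Longrightarrow> gip (g p) (E1 p) (E1 p) = 1" "\<And>p. p \<in> B1 \<Longrightarrow> Nm p (E1 p) = n *\<^sub>R E1 p"
    using unit_eigenfield[OF p0, of n] n_pos by auto
  obtain B2 E2 where 2: "open B2" "p0 \<in> B2" "B2 \<subseteq> \<Omega>" "smooth_on B2 E2"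
    "\<And>p. p \<in> B2 \<Longrightarrow> gip (g p) (E2 p) (E2 p) = 1" "\<And>p. p \<in> B2 \<Longrightarrow> Nm p (E2 p) = (- n) *\<^sub>R E2 p"
    using unit_eigenfield[OF p0, of "- n"] n_pos by auto
  have "gip (g p) (E1 p) (E2 p) = 0" if "p \<in> B1 \<inter> B2" for p
  proof -
    have "gip (g p) (Nm p (E1 p)) (E2 p) = gip (g p) (E1 p) (Nm p (E2 p))"
      using that 1(3) by (intro Nm_selfadjoint) auto
    then show ?thesis using 1(6) 2(6) that n_pos by (simp add: gip_linear)
  qed
  then show thesis
    using that[of "B1 \<inter> B2" E1 E2] 1 2 smooth_on_subset[OF 1(4)] smooth_on_subset[OF 2(4)] by auto
qed

end

locale flat_frame = flat_chart +
  fixes E1 E2 :: "real^2 \<Rightarrow> real^2"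
  assumes smooth_E1: "smooth_on \<Omega> E1" and smooth_E2: "smooth_on \<Omega> E2"
    and orthonormal: "p \<in> \<Omega> \<Longrightarrow> gip (calabi_metric y p) (E1 p) (E1 p) = 1"
      "p \<in> \<Omega> \<Longrightarrow> gip (calabi_metric y p) (E2 p) (E2 p) = 1"
      "p \<in> \<Omega> \<Longrightarrow> gip (calabi_metric y p) (E1 p) (E2 p) = 0"
    and eigen: "p \<in> \<Omega> \<Longrightarrow> Nm p (E1 p) = n *\<^sub>R E1 p" "p \<in> \<Omega> \<Longrightarrow> Nm p (E2 p) = (- n) *\<^sub>R E2 p"
begin

lemma diff_E: "p \<in> \<Omega> \<Longrightarrow> E1 differentiable (at p)" "p \<in> \<Omega> \<Longrightarrow> E2 differentiable (at p)"
  by (rule smooth_on_differentiable[OF smooth_E1], assumption)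
    (rule smooth_on_differentiable[OF smooth_E2])

lemma orthonormal': "p \<in> \<Omega> \<Longrightarrow> gip (g p) (E2 p) (E1 p) = 0"
  using gip_commute orthonormal(3) by simp

lemma frame_expand:
  assumes p: "p \<in> \<Omega>"
  shows "X = gip (g p) X (E1 p) *\<^sub>R E1 p + gip (g p) X (E2 p) *\<^sub>R E2 p"
    and inv_metric_frame: "matrix_inv (g p) $ i $ j = E1 p $ i * E1 p $ j + E2 p $ i * E2 p $ j"
proof -
  define C where "C = (vector [vector [E1 p $ 1, E2 p $ 1], vector [E1 p $ 2, E2 p $ 2]] :: real^2^2)"
  let ?M = "transpose C ** g p"
  have "?M ** C = mat 1"
    using orthonormal[OF p] orthonormal'[OF p]
    by (simp add: vec_eq_iff forall_2 matrix_matrix_mult_def transpose_def C_def sum_2 mat_def gip_sum algebra_simps)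
  \<comment> \<open>The columns of C are the frame and C^T g C = 1; the left inverse C^T g is also a
    right inverse, whence both the expansion and g^(-1) = C C^T.\<close>
  then have CM: "C ** ?M = mat 1" using matrix_left_right_inverse by blast
  have "X = C *v (?M *v X)" by (simp add: matrix_vector_mul_assoc CM)
  moreover have "(?M *v X) $ 1 = gip (g p) X (E1 p)" "(?M *v X) $ 2 = gip (g p) X (E2 p)"
    using metric_sym[OF p, of 1 2]
    by (simp_all add: matrix_vector_mult_def matrix_matrix_mult_def transpose_def C_def sum_2 gip_sum algebra_simps)
  ultimately have "X = gip (g p) X (E1 p) *\<^sub>R vector [C $ 1 $ 1, C $ 2 $ 1] + gip (g p) X (E2 p) *\<^sub>R vector [C $ 1 $ 2, C $ 2 $ 2]"
    by (simp add: vec_eq_iff forall_2 matrix_vector_mult_def sum_2 mult.commute)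
  then show "X = gip (g p) X (E1 p) *\<^sub>R E1 p + gip (g p) X (E2 p) *\<^sub>R E2 p"
    by (simp add: C_def vec_eq_iff forall_2)
  have "matrix_inv (g p) = (C ** ?M) ** matrix_inv (g p)" unfolding CM by simp
  also have "\<dots> = C ** transpose C"
    by (simp add: matrix_mul_assoc[symmetric] matrix_inv_works(1)[OF invertible_metric[OF p]])
  finally show "matrix_inv (g p) $ i $ j = E1 p $ i * E1 p $ j + E2 p $ i * E2 p $ j"
    using exhaust_2[of i] exhaust_2[of j]
    by (auto simp: matrix_matrix_mult_def transpose_def C_def sum_2)
qed

definition t1 :: "real^2 \<Rightarrow> real" where "t1 p = gip (g p) (T p) (E1 p)"
definition t2 :: "real^2 \<Rightarrow> real" where "t2 p = gip (g p) (T p) (E2 p)"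
text \<open>The connection form of the orthonormal frame, as \<open>cov_E\<close> shows.\<close>

definition \<omega> :: "2 \<Rightarrow> real^2 \<Rightarrow> real" where "\<omega> i p = gip (g p) (covariant_deriv g E1 p i) (E2 p)"

lemma smooth_t: "smooth_on \<Omega> t1" "smooth_on \<Omega> t2"
  unfolding t1_def[abs_def] t2_def[abs_def]
  by (rule smooth_gip[OF smooth_tchebychev smooth_E1], rule smooth_gip[OF smooth_tchebychev smooth_E2])

lemma smooth_\<omega>: "smooth_on \<Omega> (\<omega> i)"
  unfolding \<omega>_def[abs_def] by (rule smooth_gip[OF smooth_covariant_deriv[OF smooth_E1] smooth_E2])

lemma cov_E:
  assumes p: "p \<in> \<Omega>"
  shows "covariant_deriv g E1 p i = \<omega> i p *\<^sub>R E2 p" "covariant_deriv g E2 p i = (- \<omega> i p) *\<^sub>R E1 p"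
proof -
  have z: "pd i (\<lambda>q. gip (g q) (X q) (Z q)) p = 0"
    if "\<And>q. q \<in> \<Omega> \<Longrightarrow> gip (g q) (X q) (Z q) = k" for X Z k
    using pd_cong[OF open_chart p, of "\<lambda>q. gip (g q) (X q) (Z q)" "\<lambda>_. k" i] that by simp
  note mc = metric_compat(1)[OF p, of _ _ i]
  have 11: "gip (g p) (covariant_deriv g E1 p i) (E1 p) = 0"
    using z[OF orthonormal(1)] mc[OF diff_E(1)[OF p] diff_E(1)[OF p]] gip_commute[OF p, of "E1 p"] by simp
  have 22: "gip (g p) (covariant_deriv g E2 p i) (E2 p) = 0"
    using z[OF orthonormal(2)] mc[OF diff_E(2)[OF p] diff_E(2)[OF p]] gip_commute[OF p, of "E2 p"] by simp
  have 12: "gip (g p) (covariant_deriv g E2 p i) (E1 p) = - \<omega> i p"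
    using z[OF orthonormal(3)] mc[OF diff_E(1)[OF p] diff_E(2)[OF p]] gip_commute[OF p, of "E1 p"]
    by (simp add: \<omega>_def)
  show "covariant_deriv g E1 p i = \<omega> i p *\<^sub>R E2 p"
    by (subst frame_expand[OF p]) (simp add: 11 \<omega>_def)
  show "covariant_deriv g E2 p i = (- \<omega> i p) *\<^sub>R E1 p"
    by (subst frame_expand[OF p]) (simp add: 12 22)
qed

text \<open>\<open>\<theta>1\<close> and \<open>\<theta>2\<close> are the dual coframe evaluated on
  the coordinate fields.\<close>

abbreviation "\<theta>1 i p \<equiv> gip (g p) (axis i 1) (E1 p)"
abbreviation "\<theta>2 i p \<equiv> gip (g p) (axis i 1) (E2 p)"

text \<open>Self-adjointness moves N onto the frame vector, where it acts as n or -n; the remaining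
  terms come from the rotation of the frame.\<close>

lemma pd_t:
  assumes p: "p \<in> \<Omega>"
  shows "pd i t1 p = n * \<theta>1 i p + \<omega> i p * t2 p" "pd i t2 p = - n * \<theta>2 i p - \<omega> i p * t1 p"
proof -
  note dT = smooth_on_differentiable[OF smooth_tchebychev p]
  have "gip (g p) (N p i) (E1 p) = n * \<theta>1 i p" "gip (g p) (N p i) (E2 p) = - n * \<theta>2 i p"
    using Nm_selfadjoint[OF p, of "axis i 1"] eigen[OF p] by (simp_all add: Nm_axis gip_linear)
  then show "pd i t1 p = n * \<theta>1 i p + \<omega> i p * t2 p" "pd i t2 p = - n * \<theta>2 i p - \<omega> i p * t1 p"
    unfolding t1_def[abs_def] t2_def[abs_def]
      metric_compat(1)[OF p dT diff_E(1)[OF p]] metric_compat(1)[OF p dT diff_E(2)[OF p]] cov_E[OF p]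
    by (simp_all add: gip_linear)
qed

lemma smooth_\<theta>: "smooth_on \<Omega> (\<theta>1 i)" "smooth_on \<Omega> (\<theta>2 i)"
  by (rule smooth_gip[OF smooth_on_const smooth_E1], rule smooth_gip[OF smooth_on_const smooth_E2])

text \<open>Cartan's first structure equation: the Levi-Civita connection is torsion-free, and
  metric compatibility differentiates the coframe.\<close>

lemma d_\<theta>:
  assumes p: "p \<in> \<Omega>"
  shows "pd 2 (\<theta>1 1) p - pd 1 (\<theta>1 2) p = \<omega> 2 p * \<theta>2 1 p - \<omega> 1 p * \<theta>2 2 p"
    "pd 2 (\<theta>2 1) p - pd 1 (\<theta>2 2) p = \<omega> 1 p * \<theta>1 2 p - \<omega> 2 p * \<theta>1 1 p"
proof -
  have cd: "covariant_deriv g (\<lambda>_. axis i 1) p j = christoffel g p j i" for i j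
    using exhaust_2[of i] by (auto simp: covariant_deriv_def sum_2 axis_def)
  show "pd 2 (\<theta>1 1) p - pd 1 (\<theta>1 2) p = \<omega> 2 p * \<theta>2 1 p - \<omega> 1 p * \<theta>2 2 p"
    "pd 2 (\<theta>2 1) p - pd 1 (\<theta>2 2) p = \<omega> 1 p * \<theta>1 2 p - \<omega> 2 p * \<theta>1 1 p"
    using christoffel_sym[OF p, of 1 2]
    by (simp_all add: metric_compat(1)[OF p _ diff_E(1)[OF p]] metric_compat(1)[OF p _ diff_E(2)[OF p]]
        cd cov_E[OF p] gip_linear)
qed

text \<open>Cartan's second structure equation for zero curvature. The covariant derivatives of
  \<open>E1\<close> and \<open>E2\<close> are multiples of \<open>E2\<close> and \<open>E1\<close>,
  so their inner products drop out.\<close>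

lemma d_\<omega>:
  assumes p: "p \<in> \<Omega>"
  shows "pd 1 (\<omega> 2) p = pd 2 (\<omega> 1) p"
proof -
  have "pd i (\<omega> j) p = gip (g p) (covariant_deriv g (\<lambda>q. covariant_deriv g E1 q j) p i) (E2 p)" for i j
  proof -
    have "gip (g p) (covariant_deriv g E1 p j) (covariant_deriv g E2 p i) = 0"
      unfolding cov_E[OF p] gip_linear orthonormal'[OF p] by simp
    then show ?thesis
      unfolding \<omega>_def[abs_def]
        metric_compat(1)[OF p smooth_on_differentiable[OF smooth_covariant_deriv[OF smooth_E1] p] diff_E(2)[OF p]]
      by simp
  qed
  then show ?thesis using ricci_identity[OF p smooth_E1 flat[OF p], of 1 2] by simp
qed

text \<open>Since \<open>d (dt1) = d (dt2) = 0\<close>, the torsion of the frame and the rotation of \<open>T\<close> against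
  it add up instead of cancelling, because the eigenvalues of \<open>N\<close> have opposite signs.\<close>

lemma \<omega>_zero:
  assumes p: "p \<in> \<Omega>"
  shows "\<omega> i p = 0"
proof -
  note d = smooth_on_differentiable[OF smooth_t(1) p] smooth_on_differentiable[OF smooth_t(2) p]
    smooth_on_differentiable[OF smooth_\<omega> p] smooth_on_differentiable[OF smooth_\<theta>(1) p]
    smooth_on_differentiable[OF smooth_\<theta>(2) p]
  have a: "pd j (pd i t1) p = n * pd j (\<theta>1 i) p + pd j (\<omega> i) p * t2 p + \<omega> i p * pd j t2 p" for i j
  proof -
    have "pd j (pd i t1) p = pd j (\<lambda>q. n * \<theta>1 i q + \<omega> i q * t2 q) p"
      by (rule pd_cong[OF open_chart p]) (rule pd_t)
    then show ?thesis by (simp add: pd_add pd_mult d)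
  qed
  have b: "pd j (pd i t2) p = - n * pd j (\<theta>2 i) p - pd j (\<omega> i) p * t1 p - \<omega> i p * pd j t1 p" for i j
  proof -
    have "pd j (pd i t2) p = pd j (\<lambda>q. (- n) * \<theta>2 i q - \<omega> i q * t1 q) p"
      by (rule pd_cong[OF open_chart p]) (simp add: pd_t)
    then show ?thesis by (simp add: pd_diff pd_mult pd_uminus d)
  qed
  have c1: "pd 2 (pd 1 t1) p = pd 1 (pd 2 t1) p" "pd 2 (pd 1 t2) p = pd 1 (pd 2 t2) p"
    using pd_commute_real[OF open_chart _ p] smooth_t by blast+
  have e: "pd 2 (\<theta>1 1) p = pd 1 (\<theta>1 2) p + (\<omega> 2 p * \<theta>2 1 p - \<omega> 1 p * \<theta>2 2 p)"
    "pd 2 (\<theta>2 1) p = pd 1 (\<theta>2 2) p + (\<omega> 1 p * \<theta>1 2 p - \<omega> 2 p * \<theta>1 1 p)"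
    using d_\<theta>[OF p] by linarith+
  have "2 * n * (\<omega> 2 p * \<theta>2 1 p - \<omega> 1 p * \<theta>2 2 p) = 0"
    using c1(1) unfolding a d_\<omega>[OF p] pd_t[OF p] e by (simp add: algebra_simps)
  moreover have "2 * n * (\<omega> 2 p * \<theta>1 1 p - \<omega> 1 p * \<theta>1 2 p) = 0"
    using c1(2) unfolding b d_\<omega>[OF p] pd_t[OF p] e by (simp add: algebra_simps)
  \<comment> \<open>The wedge products of \<open>\<omega>\<close> with both coframe forms vanish:
    the vector formed here is orthogonal to the whole frame, hence zero.\<close>
  ultimately have "gip (g p) (\<omega> 2 p *\<^sub>R axis 1 1 - \<omega> 1 p *\<^sub>R axis 2 1) (E1 p) = 0"
    "gip (g p) (\<omega> 2 p *\<^sub>R axis 1 1 - \<omega> 1 p *\<^sub>R axis 2 1) (E2 p) = 0"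
    using n_pos by (simp_all add: gip_linear)
  then have "\<omega> 2 p *\<^sub>R axis 1 1 - \<omega> 1 p *\<^sub>R axis 2 1 = (0 :: real^2)"
    using frame_expand(1)[OF p] by (metis add_0 scale_zero_left)
  then have "\<omega> 2 p = 0" "\<omega> 1 p = 0" by (simp_all add: vec_eq_iff forall_2 axis_def)
  then show ?thesis using exhaust_2[of i] by auto
qed

end

section \<open>The cubic form in the parallel frame\<close>

definition dderiv :: "(real^2 \<Rightarrow> real^2) \<Rightarrow> (real^2 \<Rightarrow> real) \<Rightarrow> real^2 \<Rightarrow> real" where
  "dderiv X h p = X p $ 1 * pd 1 h p + X p $ 2 * pd 2 h p"

lemma smooth_dderiv: "open S \<Longrightarrow> smooth_on S X \<Longrightarrow> smooth_on S h \<Longrightarrow> smooth_on S (dderiv X h)"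
  unfolding dderiv_def[abs_def] by (intro smooth_intros)

lemma dderiv_cong:
  "open S \<Longrightarrow> p \<in> S \<Longrightarrow> (\<And>q. q \<in> S \<Longrightarrow> f q = h q) \<Longrightarrow> dderiv X f p = dderiv X h p"
  using pd_cong[of S p f h] by (simp add: dderiv_def)

lemma dderiv_const [simp]: "dderiv X (\<lambda>q. k) = (\<lambda>p. 0)"
  by (simp add: dderiv_def fun_eq_iff)

lemma dderiv_arith:
  assumes "f differentiable (at p)" "h differentiable (at p)"
  shows "dderiv X (\<lambda>q. f q + h q) p = dderiv X f p + dderiv X h p"
    "dderiv X (\<lambda>q. f q - h q) p = dderiv X f p - dderiv X h p"
    "dderiv X (\<lambda>q. f q * h q) p = dderiv X f p * h p + f p * dderiv X h p"
  by (simp_all add: dderiv_def pd_add pd_diff pd_mult assms algebra_simps)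

lemma dderiv_compose_real:
  assumes "f differentiable (at p)" "(\<phi> has_real_derivative D) (at (f p))"
  shows "dderiv X (\<lambda>q. \<phi> (f q)) p = D * dderiv X f p"
  by (simp add: dderiv_def pd_compose_real(1)[OF assms] algebra_simps)

context flat_frame
begin

abbreviation "D1 \<equiv> dderiv E1"
abbreviation "D2 \<equiv> dderiv E2"
abbreviation "\<Gamma> \<equiv> christoffel (calabi_metric y)"

lemma smooth_D: "smooth_on \<Omega> h \<Longrightarrow> smooth_on \<Omega> (D1 h)" "smooth_on \<Omega> h \<Longrightarrow> smooth_on \<Omega> (D2 h)"
  using smooth_dderiv[OF open_chart smooth_E1] smooth_dderiv[OF open_chart smooth_E2] by blast+

lemma pd_E:
  assumes "p \<in> \<Omega>"
  shows "pd i E1 p = - (\<Sum>j\<in>UNIV. E1 p $ j *\<^sub>R \<Gamma> p i j)" "pd i E2 p = - (\<Sum>j\<in>UNIV. E2 p $ j *\<^sub>R \<Gamma> p i j)"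
  using cov_E[OF assms, of i] by (simp_all add: \<omega>_zero[OF assms] covariant_deriv_def eq_neg_iff_add_eq_0)

text \<open>For a field \<open>Z\<close> that is parallel at \<open>p\<close> the derivative of
  \<open>Z\<close> only contributes Christoffel terms, so the iterated derivative is the covariant
  Hessian of \<open>h\<close>.\<close>

lemma second_dderiv:
  assumes X: "smooth_on \<Omega> X" and Z: "smooth_on \<Omega> Z" and h: "smooth_on \<Omega> h" and p: "p \<in> \<Omega>"
    and par: "\<And>i. pd i Z p = - (\<Sum>j\<in>UNIV. Z p $ j *\<^sub>R \<Gamma> p i j)"
  shows "dderiv X (dderiv Z h) p = (\<Sum>i\<in>UNIV. \<Sum>j\<in>UNIV. X p $ i * Z p $ j *
    (pd i (pd j h) p - \<Gamma> p i j $ 1 * pd 1 h p - \<Gamma> p i j $ 2 * pd 2 h p))"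
proof -
  note d = smooth_on_differentiable[OF Z p] smooth_on_differentiable[OF smooth_on_pd[OF h] p]
    differentiable_nth[OF smooth_on_differentiable[OF Z p]]
  have a: "pd i (dderiv Z h) p = (\<Sum>j\<in>UNIV. pd i Z p $ j * pd j h p + Z p $ j * pd i (pd j h) p)" for i
    unfolding dderiv_def[abs_def] sum_2
    by (simp add: pd_add pd_mult pd_nth d derivative_intros)
  show ?thesis
    unfolding dderiv_def[of X] a par by (simp add: sum_2 algebra_simps)
qed

text \<open>Symmetry of the covariant Hessian; in other words, the parallel fields \<open>E1\<close>
  and \<open>E2\<close> have zero bracket.\<close>

lemma D_commute:
  assumes h: "smooth_on \<Omega> h" and p: "p \<in> \<Omega>"
  shows "D2 (D1 h) p = D1 (D2 h) p"
  unfolding second_dderiv[OF smooth_E2 smooth_E1 h p pd_E(1)[OF p]]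
    second_dderiv[OF smooth_E1 smooth_E2 h p pd_E(2)[OF p]]
  using christoffel_sym[OF p, of 1 2] pd_commute_real[OF open_chart h p, of 1 2]
  by (simp add: sum_2 algebra_simps)

text \<open>\<open>pd_t\<close> with \<open>\<omega>\<close> = 0. It makes t1/n and -t2/n
  coordinates adapted to \<open>E1\<close> and \<open>E2\<close>.\<close>

lemma D_t:
  assumes "p \<in> \<Omega>"
  shows "D1 t1 p = n" "D2 t1 p = 0" "D1 t2 p = 0" "D2 t2 p = - n"
proof -
  have "gip (g p) X Z = X $ 1 * gip (g p) (axis 1 1) Z + X $ 2 * gip (g p) (axis 2 1) Z" for X Z
    using gip_expand[of "g p" Z X] gip_commute[OF assms] by simp
  note e = this[of "E1 p" "E1 p"] this[of "E1 p" "E2 p"] this[of "E2 p" "E1 p"] this[of "E2 p" "E2 p"]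
  have "D1 t1 p = n * gip (g p) (E1 p) (E1 p)" "D2 t1 p = n * gip (g p) (E2 p) (E1 p)"
    "D1 t2 p = - n * gip (g p) (E1 p) (E2 p)" "D2 t2 p = - n * gip (g p) (E2 p) (E2 p)"
    unfolding dderiv_def pd_t[OF assms] \<omega>_zero[OF assms] e by (simp_all add: algebra_simps)
  then show "D1 t1 p = n" "D2 t1 p = 0" "D1 t2 p = 0" "D2 t2 p = - n"
    using orthonormal[OF assms] orthonormal'[OF assms] by simp_all
qed

definition cub :: "(real^2 \<Rightarrow> real^2) \<Rightarrow> (real^2 \<Rightarrow> real^2) \<Rightarrow> (real^2 \<Rightarrow> real^2) \<Rightarrow> real^2 \<Rightarrow> real" where
  "cub X Z W p = gip (g p) (\<Sum>i\<in>UNIV. \<Sum>j\<in>UNIV. (X p $ i * Z p $ j) *\<^sub>R fubini_pick y p i j) (W p)"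

lemma smooth_cub:
  "smooth_on \<Omega> X \<Longrightarrow> smooth_on \<Omega> Z \<Longrightarrow> smooth_on \<Omega> W \<Longrightarrow> smooth_on \<Omega> (cub X Z W)"
  unfolding cub_def[abs_def]
  by (intro smooth_gip smooth_intros smooth_fubini_pick open_chart)

text \<open>Passing to the covariant Hessian subtracts the Levi-Civita connection from the induced
  one, so the tangential part of the structure equation becomes the Fubini-Pick tensor.\<close>

lemma second_dderiv_y:
  assumes X: "smooth_on \<Omega> X" and Z: "smooth_on \<Omega> Z" and p: "p \<in> \<Omega>"
    and par: "\<And>i. pd i Z p = - (\<Sum>j\<in>UNIV. Z p $ j *\<^sub>R \<Gamma> p i j)"
  shows "dderiv X (dderiv Z (\<lambda>q. y q $ k)) p = cub X Z E1 p * D1 (\<lambda>q. y q $ k) p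
     + cub X Z E2 p * D2 (\<lambda>q. y q $ k) p + gip (g p) (X p) (Z p) * Yfield $ k"
proof -
  have h: "smooth_on \<Omega> (\<lambda>q. y q $ k)" by (rule smooth_on_nth[OF open_chart smooth_y])
  have 1: "pd i (\<lambda>q. y q $ k) q = pd i y q $ k" if "q \<in> \<Omega>" for i q
    by (rule pd_nth[OF diff_y[OF that]])
  have 2: "pd i (pd j (\<lambda>q. y q $ k)) p = pd i (pd j y) p $ k" for i j
  proof -
    have "pd i (pd j (\<lambda>q. y q $ k)) p = pd i (\<lambda>q. pd j y q $ k) p"
      by (rule pd_cong[OF open_chart p]) (rule 1)
    then show ?thesis
      using pd_nth[OF smooth_on_differentiable[OF smooth_on_pd[OF smooth_y] p]] by simp
  qed
  define A where "A = (\<Sum>i\<in>UNIV. \<Sum>j\<in>UNIV. (X p $ i * Z p $ j) *\<^sub>R fubini_pick y p i j)"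
  have "dderiv X (dderiv Z (\<lambda>q. y q $ k)) p = A $ 1 * pd 1 y p $ k + A $ 2 * pd 2 y p $ k
      + gip (g p) (X p) (Z p) * Yfield $ k"
    unfolding second_dderiv[OF X Z h p par] 2 1[OF p] structure_equation[OF p] A_def
    by (simp add: sum_2 fubini_pick_def gip_sum algebra_simps)
  moreover have "A $ i = cub X Z E1 p * E1 p $ i + cub X Z E2 p * E2 p $ i" for i
    using arg_cong[OF frame_expand(1)[OF p, of A], of "\<lambda>v. v $ i"] by (simp add: cub_def A_def)
  ultimately show ?thesis
    unfolding dderiv_def[of E1] dderiv_def[of E2] 1[OF p] by (simp add: algebra_simps)
qed

lemma cub_trace:
  assumes p: "p \<in> \<Omega>"
  shows "cub E1 E1 W p + cub E2 E2 W p = 2 * gip (g p) (T p) (W p)"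
  unfolding cub_def tchebychev_def gip_linear inv_metric_frame[OF p]
  by (simp add: sum_2 gip_linear algebra_simps)

lemma frame_independent:
  assumes p: "p \<in> \<Omega>"
    and eq: "\<And>k. a * D1 (\<lambda>q. y q $ k) p + b * D2 (\<lambda>q. y q $ k) p + \<gamma> * Yfield $ k = 0"
  shows "a = 0" "b = 0" "\<gamma> = 0"
proof -
  let ?v = "a *\<^sub>R E1 p + b *\<^sub>R E2 p"
  have "?v $ 1 * pd 1 y p $ k + ?v $ 2 * pd 2 y p $ k + \<gamma> * Yfield $ k = 0" for k
    using eq[of k] unfolding dderiv_def pd_nth[OF diff_y[OF p]] by (simp add: algebra_simps)
  note z = tangent_normal_independent[OF p this]
  show "\<gamma> = 0" by (rule z(3))
  have v0: "?v = 0" using z(1,2) by (simp add: vec_eq_iff forall_2)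
  have "a = gip (g p) ?v (E1 p)" "b = gip (g p) ?v (E2 p)"
    using orthonormal[OF p] orthonormal'[OF p] by (simp_all add: gip_linear)
  then show "a = 0" "b = 0" unfolding v0 by (simp_all add: gip_linear)
qed

text \<open>Symmetry of \<open>cub\<close> in its last slot is not visible from the definition, so
  the mixed components \<open>Q'\<close> and \<open>R'\<close> are kept apart until
  \<open>compatibility\<close> identifies them with \<open>Q\<close> and \<open>R\<close>.\<close>

abbreviation "P \<equiv> cub E1 E1 E1"
abbreviation "Q \<equiv> cub E1 E1 E2"
abbreviation "Q' \<equiv> cub E1 E2 E1"
abbreviation "R' \<equiv> cub E1 E2 E2"
abbreviation "R \<equiv> cub E2 E2 E1"
abbreviation "S \<equiv> cub E2 E2 E2"

lemmas smooth_PQRS = smooth_cub[OF smooth_E1 smooth_E1 smooth_E1] smooth_cub[OF smooth_E1 smooth_E1 smooth_E2]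
  smooth_cub[OF smooth_E1 smooth_E2 smooth_E1] smooth_cub[OF smooth_E1 smooth_E2 smooth_E2]
  smooth_cub[OF smooth_E2 smooth_E2 smooth_E1] smooth_cub[OF smooth_E2 smooth_E2 smooth_E2]

lemma smooth_yk: "smooth_on \<Omega> (\<lambda>q. y q $ k)"
  by (rule smooth_on_nth[OF open_chart smooth_y])

lemma structure_y:
  assumes p: "p \<in> \<Omega>"
  shows "D1 (D1 (\<lambda>q. y q $ k)) p = P p * D1 (\<lambda>q. y q $ k) p + Q p * D2 (\<lambda>q. y q $ k) p + Yfield $ k"
    "D1 (D2 (\<lambda>q. y q $ k)) p = Q' p * D1 (\<lambda>q. y q $ k) p + R' p * D2 (\<lambda>q. y q $ k) p"
    "D2 (D2 (\<lambda>q. y q $ k)) p = R p * D1 (\<lambda>q. y q $ k) p + S p * D2 (\<lambda>q. y q $ k) p + Yfield $ k"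
  unfolding second_dderiv_y[OF smooth_E1 smooth_E1 p pd_E(1)[OF p]]
    second_dderiv_y[OF smooth_E1 smooth_E2 p pd_E(2)[OF p]]
    second_dderiv_y[OF smooth_E2 smooth_E2 p pd_E(2)[OF p]] orthonormal[OF p]
  by simp_all

text \<open>Mixed third derivatives of \<open>y\<close> agree. Comparing coefficients of
  \<open>Yfield\<close> gives the symmetry of the cubic form; comparing those of the two tangent
  vectors gives four equations that mix Gauss and Codazzi.\<close>

lemma compatibility:
  assumes p: "p \<in> \<Omega>"
  shows "Q' p = Q p" "R' p = R p"
    "D2 P p + P p * Q' p + Q p * R p = D1 Q' p + Q' p * P p + R' p * Q' p"
    "P p * R' p + D2 Q p + Q p * S p = Q' p * Q p + D1 R' p + R' p * R' p"
    "D1 R p + R p * P p + S p * Q' p = D2 Q' p + Q' p * Q' p + R' p * R p"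
    "R p * Q p + D1 S p + S p * R' p = Q' p * R' p + D2 R' p + R' p * S p"
proof -
  define u where "u k = D1 (\<lambda>q. y q $ k)" for k
  define v where "v k = D2 (\<lambda>q. y q $ k)" for k
  have su: "smooth_on \<Omega> (u k)" and sv: "smooth_on \<Omega> (v k)" for k
    unfolding u_def v_def by (rule smooth_D[OF smooth_yk])+
  note str = structure_y[folded u_def v_def]
  have str4: "D2 (u k) q = Q' q * u k q + R' q * v k q" if "q \<in> \<Omega>" for k q
    using D_commute[OF smooth_yk that, of k] str(2)[OF that, of k] by (simp add: u_def v_def)
  note d = smooth_PQRS[THEN smooth_on_differentiable, OF p] su[THEN smooth_on_differentiable, OF p]
    sv[THEN smooth_on_differentiable, OF p]
  have i: "D2 (D1 (u k)) p = D2 P p * u k p + P p * D2 (u k) p + D2 Q p * v k p + Q p * D2 (v k) p" for k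
  proof -
    have "D2 (D1 (u k)) p = D2 (\<lambda>q. P q * u k q + Q q * v k q + Yfield $ k) p"
      by (rule dderiv_cong[OF open_chart p]) (rule str(1))
    then show ?thesis by (simp add: dderiv_arith d derivative_intros)
  qed
  have ii: "D1 (D2 (u k)) p = D1 Q' p * u k p + Q' p * D1 (u k) p + D1 R' p * v k p + R' p * D1 (v k) p" for k
  proof -
    have "D1 (D2 (u k)) p = D1 (\<lambda>q. Q' q * u k q + R' q * v k q) p"
      by (rule dderiv_cong[OF open_chart p]) (rule str4)
    then show ?thesis by (simp add: dderiv_arith d derivative_intros)
  qed
  have iii: "D2 (D1 (v k)) p = D2 Q' p * u k p + Q' p * D2 (u k) p + D2 R' p * v k p + R' p * D2 (v k) p" for k
  proof -
    have "D2 (D1 (v k)) p = D2 (\<lambda>q. Q' q * u k q + R' q * v k q) p"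
      by (rule dderiv_cong[OF open_chart p]) (rule str(2))
    then show ?thesis by (simp add: dderiv_arith d derivative_intros)
  qed
  have iv: "D1 (D2 (v k)) p = D1 R p * u k p + R p * D1 (u k) p + D1 S p * v k p + S p * D1 (v k) p" for k
  proof -
    have "D1 (D2 (v k)) p = D1 (\<lambda>q. R q * u k q + S q * v k q + Yfield $ k) p"
      by (rule dderiv_cong[OF open_chart p]) (rule str(3))
    then show ?thesis by (simp add: dderiv_arith d derivative_intros)
  qed
  have "((D2 P p + P p * Q' p + Q p * R p) - (D1 Q' p + Q' p * P p + R' p * Q' p)) * u k p
     + ((P p * R' p + D2 Q p + Q p * S p) - (Q' p * Q p + D1 R' p + R' p * R' p)) * v k p
     + (Q p - Q' p) * Yfield $ k = 0" for k
    using D_commute[OF su p, of k] unfolding i ii str[OF p] str4[OF p] by (simp add: algebra_simps)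
  note A = frame_independent[OF p this[unfolded u_def v_def]]
  have "((D1 R p + R p * P p + S p * Q' p) - (D2 Q' p + Q' p * Q' p + R' p * R p)) * u k p
     + ((R p * Q p + D1 S p + S p * R' p) - (Q' p * R' p + D2 R' p + R' p * S p)) * v k p
     + (R p - R' p) * Yfield $ k = 0" for k
    using D_commute[OF sv p, of k] unfolding iii iv str[OF p] str4[OF p] by (simp add: algebra_simps)
  note B = frame_independent[OF p this[unfolded u_def v_def]]
  from A B show "Q' p = Q p" "R' p = R p"
    "D2 P p + P p * Q' p + Q p * R p = D1 Q' p + Q' p * P p + R' p * Q' p"
    "P p * R' p + D2 Q p + Q p * S p = Q' p * Q p + D1 R' p + R' p * R' p"
    "D1 R p + R p * P p + S p * Q' p = D2 Q' p + Q' p * Q' p + R' p * R p"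
    "R p * Q p + D1 S p + S p * R' p = Q' p * R' p + D2 R' p + R' p * S p"
    by linarith+
qed

text \<open>The two middle tangential equations contain D2 Q - D1 R with opposite signs: their
  difference is a Codazzi equation, their sum the Gauss relation.\<close>

lemma gauss_codazzi:
  assumes p: "p \<in> \<Omega>"
  shows "D2 P p = D1 Q p" "D1 R p = D2 Q p" "D1 S p = D2 R p"
    "P p * R p + Q p * S p = (Q p)\<^sup>2 + (R p)\<^sup>2"
proof -
  have eq: "D1 Q' p = D1 Q p" "D2 Q' p = D2 Q p" "D1 R' p = D1 R p" "D2 R' p = D2 R p"
    by (rule dderiv_cong[OF open_chart p]; rule compatibility; assumption)+
  note c = compatibility[OF p, unfolded eq compatibility(1,2)[OF p]]
  show "D2 P p = D1 Q p" using c(3) by (simp add: algebra_simps)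
  show "D1 S p = D2 R p" using c(6) by (simp add: algebra_simps)
  show "D1 R p = D2 Q p" using c(4,5) by (simp add: algebra_simps)
  show "P p * R p + Q p * S p = (Q p)\<^sup>2 + (R p)\<^sup>2" using c(4,5) by (simp add: algebra_simps power2_eq_square)
qed

section \<open>Harmonicity of the cubic form and its reduction to two components\<close>

definition lap :: "(real^2 \<Rightarrow> real) \<Rightarrow> real^2 \<Rightarrow> real" where
  "lap h p = D1 (D1 h) p + D2 (D2 h) p"

lemma lap_arith:
  assumes f: "smooth_on \<Omega> f" and h: "smooth_on \<Omega> h" and p: "p \<in> \<Omega>"
  shows "lap (\<lambda>q. f q + h q) p = lap f p + lap h p"
    "lap (\<lambda>q. f q - h q) p = lap f p - lap h p"
    "lap (\<lambda>q. f q * h q) p = lap f p * h p + f p * lap h p + 2 * (D1 f p * D1 h p + D2 f p * D2 h p)"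
proof -
  note d = smooth_on_differentiable[OF f] smooth_on_differentiable[OF h]
  note d' = d[OF p] smooth_on_differentiable[OF smooth_D(1)[OF f] p] smooth_on_differentiable[OF smooth_D(1)[OF h] p]
    smooth_on_differentiable[OF smooth_D(2)[OF f] p] smooth_on_differentiable[OF smooth_D(2)[OF h] p]
  have a: "dderiv X (dderiv X (\<lambda>q. f q + h q)) p = dderiv X (\<lambda>q. dderiv X f q + dderiv X h q) p"
    "dderiv X (dderiv X (\<lambda>q. f q - h q)) p = dderiv X (\<lambda>q. dderiv X f q - dderiv X h q) p"
    "dderiv X (dderiv X (\<lambda>q. f q * h q)) p = dderiv X (\<lambda>q. dderiv X f q * h q + f q * dderiv X h q) p" for X
    by (rule dderiv_cong[OF open_chart p]; rule dderiv_arith; rule d; assumption)+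
  show "lap (\<lambda>q. f q + h q) p = lap f p + lap h p"
    "lap (\<lambda>q. f q - h q) p = lap f p - lap h p"
    "lap (\<lambda>q. f q * h q) p = lap f p * h p + f p * lap h p + 2 * (D1 f p * D1 h p + D2 f p * D2 h p)"
    unfolding lap_def a by (simp_all add: dderiv_arith d' derivative_intros algebra_simps)
qed

lemma lap_cong: "p \<in> \<Omega> \<Longrightarrow> (\<And>q. q \<in> \<Omega> \<Longrightarrow> f q = h q) \<Longrightarrow> lap f p = lap h p"
proof -
  assume p: "p \<in> \<Omega>" and e: "\<And>q. q \<in> \<Omega> \<Longrightarrow> f q = h q"
  have "dderiv X (dderiv X f) p = dderiv X (dderiv X h) p" for X
    by (rule dderiv_cong[OF open_chart p]; rule dderiv_cong[OF open_chart]; (assumption | rule e))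
  then show ?thesis by (simp add: lap_def)
qed

lemma trace_relations:
  assumes p: "p \<in> \<Omega>"
  shows "P p + R p = 2 * t1 p" "Q p + S p = 2 * t2 p"
    "D1 R p = 2 * n - D1 P p" "D2 R p = - D2 P p" "D1 S p = - D1 Q p" "D2 S p = - 2 * n - D2 Q p"
proof -
  have 1: "P q + R q = 2 * t1 q" and 2: "Q q + S q = 2 * t2 q" if "q \<in> \<Omega>" for q
    using cub_trace[OF that, of E1] cub_trace[OF that, of E2] by (simp_all add: t1_def t2_def)
  note d = smooth_PQRS[THEN smooth_on_differentiable, OF p] smooth_t[THEN smooth_on_differentiable, OF p]
  have "dderiv X (\<lambda>q. P q + R q) p = dderiv X (\<lambda>q. 2 * t1 q) p"
    "dderiv X (\<lambda>q. Q q + S q) p = dderiv X (\<lambda>q. 2 * t2 q) p" for X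
    by (rule dderiv_cong[OF open_chart p], rule 1, assumption, rule dderiv_cong[OF open_chart p], rule 2)
  then have "dderiv X P p + dderiv X R p = 2 * dderiv X t1 p"
    "dderiv X Q p + dderiv X S p = 2 * dderiv X t2 p" for X
    by (simp_all add: dderiv_arith d)
  from this[of E1] this[of E2] show "D1 R p = 2 * n - D1 P p" "D2 R p = - D2 P p"
    "D1 S p = - D1 Q p" "D2 S p = - 2 * n - D2 Q p"
    unfolding D_t[OF p] by simp_all
  show "P p + R p = 2 * t1 p" "Q p + S p = 2 * t2 p" by (rule 1[OF p], rule 2[OF p])
qed

text \<open>By Codazzi and the trace relations, \<open>Q\<close> and \<open>P\<close> satisfy the
  Cauchy-Riemann equations up to the constant 2 n; the derivatives of \<open>R\<close> and
  \<open>S\<close> are those of \<open>P\<close> and \<open>Q\<close> up to sign and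
  constants.\<close>

lemma lap_PQRS:
  assumes p: "p \<in> \<Omega>"
  shows "lap P p = 0" "lap Q p = 0" "lap R p = 0" "lap S p = 0"
proof -
  note sm = smooth_PQRS
  note d = sm[THEN smooth_D(1), THEN smooth_on_differentiable, OF p] sm[THEN smooth_D(2), THEN smooth_on_differentiable, OF p]
  have r1: "D2 P q = D1 Q q" "D1 P q = 2 * n - D2 Q q" "D2 Q q = 2 * n - D1 P q" "D1 Q q = D2 P q"
    "D1 R q = D2 Q q" "D2 R q = 0 - D1 Q q" "D1 S q = 0 - D1 Q q" "D2 S q = - 2 * n - D2 Q q" if "q \<in> \<Omega>" for q
    using gauss_codazzi[OF that] trace_relations[OF that] by simp_all
  have "D1 (D1 P) p = D1 (\<lambda>q. 2 * n - D2 Q q) p" "D2 (D2 P) p = D2 (D1 Q) p"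
    "D2 (D2 Q) p = D2 (\<lambda>q. 2 * n - D1 P q) p" "D1 (D1 Q) p = D1 (D2 P) p"
    "D1 (D1 R) p = D1 (D2 Q) p" "D2 (D2 R) p = D2 (\<lambda>q. 0 - D1 Q q) p"
    "D1 (D1 S) p = D1 (\<lambda>q. 0 - D1 Q q) p" "D2 (D2 S) p = D2 (\<lambda>q. - 2 * n - D2 Q q) p"
    by (rule dderiv_cong[OF open_chart p]; rule r1; assumption)+
  note eqs = this[unfolded dderiv_arith(2)[OF differentiable_const d(1)] dderiv_arith(2)[OF differentiable_const d(2)]
     dderiv_arith(2)[OF differentiable_const d(8)] dderiv_const]
  show "lap P p = 0" "lap Q p = 0"
    using eqs D_commute[OF sm(1) p] D_commute[OF sm(2) p] by (simp_all add: lap_def)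
  then show "lap R p = 0" "lap S p = 0"
    using eqs D_commute[OF sm(1) p] D_commute[OF sm(2) p] by (simp_all add: lap_def)
qed

text \<open>The quadratic relation of Gauss has vanishing Laplacian; since its entries are harmonic, this
  is a sum of squares of first derivatives.\<close>

lemma constant_QR:
  assumes p: "p \<in> \<Omega>"
  shows "D1 Q p = 0" "D2 Q p = 0" "D1 R p = 0" "D2 R p = 0"
proof -
  note sm = smooth_PQRS
  have "lap (\<lambda>q. P q * R q + Q q * S q - (Q q * Q q + R q * R q)) p = lap (\<lambda>q. 0) p"
    by (rule lap_cong[OF p]) (simp add: gauss_codazzi(4) power2_eq_square)
  also have "\<dots> = 0" by (simp add: lap_def)
  finally have L: "D1 P p * D1 R p + D2 P p * D2 R p + (D1 Q p * D1 S p + D2 Q p * D2 S p)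
     - (D1 Q p * D1 Q p + D2 Q p * D2 Q p + (D1 R p * D1 R p + D2 R p * D2 R p)) = 0"
    by (simp add: lap_arith smooth_on_add smooth_on_mult open_chart sm p lap_PQRS[OF p])
  define a b where a_b_def: "a = D2 Q p" "b = D1 Q p"
  have vals: "D1 P p = 2 * n - a" "D2 P p = b" "D1 Q p = b" "D2 Q p = a" "D1 R p = a" "D2 R p = - b"
    "D1 S p = - b" "D2 S p = - 2 * n - a"
    using gauss_codazzi[OF p] trace_relations[OF p] by (simp_all add: a_b_def)
  \<comment> \<open>The contributions 2 n a and -2 n a cancel, since \<open>t1\<close> and
    \<open>t2\<close> have opposite slopes n and -n.\<close>
  have "4 * (a\<^sup>2 + b\<^sup>2) = 0"
    using L unfolding vals by (simp add: algebra_simps power2_eq_square)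
  then have "a = 0 \<and> b = 0" unfolding mult_eq_0_iff sum_power2_eq_zero_iff by simp
  then show "D1 Q p = 0" "D2 Q p = 0" "D1 R p = 0" "D2 R p = 0"
    using gauss_codazzi[OF p] trace_relations[OF p] by (simp_all add: a_b_def)
qed

text \<open>Eliminate \<open>P\<close> and \<open>S\<close> from the Gauss relation by the trace
  relations. With \<open>Q\<close> and \<open>R\<close> constant, its derivative along
  \<open>E1\<close> is 2 n R and along \<open>E2\<close> is -2 n Q.\<close>

lemma vanishing_QR:
  assumes p: "p \<in> \<Omega>"
  shows "Q p = 0" "R p = 0"
proof -
  note d = smooth_PQRS[THEN smooth_on_differentiable, OF p] smooth_t[THEN smooth_on_differentiable, OF p]
  have z: "(2 * t1 q - R q) * R q + Q q * (2 * t2 q - Q q) - (Q q * Q q + R q * R q) = 0" if "q \<in> \<Omega>" for q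
  proof -
    have "P q = 2 * t1 q - R q" "S q = 2 * t2 q - Q q" using trace_relations(1,2)[OF that] by simp_all
    then show ?thesis using gauss_codazzi(4)[OF that] by (simp add: power2_eq_square)
  qed
  have "dderiv X (\<lambda>q. (2 * t1 q - R q) * R q + Q q * (2 * t2 q - Q q) - (Q q * Q q + R q * R q)) p = dderiv X (\<lambda>q. 0) p" for X
    by (rule dderiv_cong[OF open_chart p]) (rule z)
  from this[of E1] this[of E2] show "Q p = 0" "R p = 0"
    using n_pos constant_QR[OF p] D_t[OF p] by (simp_all add: dderiv_arith d derivative_intros)
qed

lemma flat_structure_y:
  assumes p: "p \<in> \<Omega>"
  shows "D1 (D1 (\<lambda>q. y q $ k)) p = 2 * t1 p * D1 (\<lambda>q. y q $ k) p + Yfield $ k"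
    "D1 (D2 (\<lambda>q. y q $ k)) p = 0" "D2 (D1 (\<lambda>q. y q $ k)) p = 0"
    "D2 (D2 (\<lambda>q. y q $ k)) p = 2 * t2 p * D2 (\<lambda>q. y q $ k) p + Yfield $ k"
  using structure_y[OF p, of k] vanishing_QR[OF p] compatibility(1,2)[OF p] trace_relations(1,2)[OF p]
    D_commute[OF smooth_yk p, of k] by simp_all

end

section \<open>Integration of the structure equations\<close>

lemma DERIV_oriented_integral:
  fixes f :: "real \<Rightarrow> real"
  assumes "continuous_on UNIV f"
  shows "((\<lambda>t. LBINT s=0..t. f s) has_real_derivative f t) (at t)"
proof -
  \<comment> \<open>The margin of 1 puts \<open>t\<close> into the interior of the interval, for
    either sign of \<open>t\<close>.\<close>
  define a b where "a = min 0 t - 1" and "b = max 0 t + 1"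
  have "((\<lambda>u. LBINT s=ereal 0..u. f s) has_vector_derivative f t) (at t within {a..b})"
    by (rule interval_integral_FTC2) (auto simp: a_def b_def intro: continuous_on_subset[OF assms])
  moreover have "at t within {a..b} = at t"
    by (rule at_within_interior) (auto simp: a_def b_def)
  ultimately show ?thesis
    by (simp add: has_real_derivative_iff_has_vector_derivative zero_ereal_def)
qed

definition gaussint :: "real \<Rightarrow> real \<Rightarrow> real" where
  "gaussint a t = (LBINT s=0..t. exp (a/2 * s^2))"

definition gaussint2 :: "real \<Rightarrow> real \<Rightarrow> real" where
  "gaussint2 a t = (LBINT s=0..t. exp (a/2 * s^2) * gaussint (- a) s)"

lemma DERIV_gaussint: "(gaussint a has_real_derivative exp (a/2 * t^2)) (at t)"
  unfolding gaussint_def[abs_def]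
  by (rule DERIV_oriented_integral) (intro continuous_intros)

lemma DERIV_gaussint2: "(gaussint2 a has_real_derivative exp (a/2 * t^2) * gaussint (- a) t) (at t)"
proof -
  have "continuous_on UNIV (gaussint b)" for b
    using DERIV_gaussint DERIV_isCont by (metis continuous_at_imp_continuous_on)
  then show ?thesis
    unfolding gaussint2_def[abs_def]
    by (intro DERIV_oriented_integral continuous_intros)
qed

lemma model_surface_0:
  "model_surface c 0 0 u = vector [gaussint c (u $ 1), gaussint (- c) (u $ 2),
     gaussint2 c (u $ 1) + gaussint2 (- c) (u $ 2)]"
  by (simp add: model_surface_def gaussint_def gaussint2_def)

context flat_frame
begin

text \<open>The frame spans every tangent space, so both partials vanish; convexity then gives a
  single constant.\<close>

lemma constant_of_D:
  assumes "convex \<Omega>" "\<And>p. p \<in> \<Omega> \<Longrightarrow> f differentiable (at p)"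
    and "\<And>p. p \<in> \<Omega> \<Longrightarrow> D1 f p = 0" "\<And>p. p \<in> \<Omega> \<Longrightarrow> D2 f p = 0"
  obtains k where "\<And>p. p \<in> \<Omega> \<Longrightarrow> f p = k"
proof -
  have "(f has_derivative (\<lambda>h. 0)) (at p within \<Omega>)" if p: "p \<in> \<Omega>" for p
  proof -
    have "pd i f p = \<theta>1 i p * D1 f p + \<theta>2 i p * D2 f p" for i
    proof -
      have "(axis i 1 :: real^2) $ j = \<theta>1 i p * E1 p $ j + \<theta>2 i p * E2 p $ j" for j
        using arg_cong[OF frame_expand(1)[OF p, of "axis i 1"], of "\<lambda>v. v $ j"] by simp
      moreover have "pd i f p = (axis i 1 :: real^2) $ 1 * pd 1 f p + (axis i 1 :: real^2) $ 2 * pd 2 f p"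
        using exhaust_2[of i] by (auto simp: axis_def)
      ultimately show ?thesis by (simp add: dderiv_def algebra_simps)
    qed
    then have "pd i f p = 0" for i using assms(3,4)[OF p] by simp
    then show ?thesis
      using has_derivative_at_withinI[OF has_derivative_pd[OF assms(2)[OF p]]] by simp
  qed
  from has_derivative_zero_constant[OF assms(1) this] show thesis using that by blast
qed

definition u1 :: "real^2 \<Rightarrow> real" where "u1 p = t1 p / n"
text \<open>The minus sign compensates the eigenvalue -n, so that \<open>u2\<close> has slope 1
  along \<open>E2\<close>.\<close>

definition u2 :: "real^2 \<Rightarrow> real" where "u2 p = - (t2 p / n)"

lemma diff_u: assumes "p \<in> \<Omega>" shows "u1 differentiable (at p)" "u2 differentiable (at p)"
proof -
  note d = smooth_t[THEN smooth_on_differentiable, OF assms]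
  have "(\<lambda>p. (1/n) *\<^sub>R t1 p) differentiable (at p)" "(\<lambda>p. (-1/n) *\<^sub>R t2 p) differentiable (at p)"
    by (intro derivative_intros d)+
  then show "u1 differentiable (at p)" "u2 differentiable (at p)"
    by (simp_all add: u1_def[abs_def] u2_def[abs_def])
qed

lemma D_u:
  assumes "p \<in> \<Omega>"
  shows "D1 u1 p = 1" "D2 u1 p = 0" "D1 u2 p = 0" "D2 u2 p = 1"
proof -
  note d = smooth_t[THEN smooth_on_differentiable, OF assms]
  have "dderiv X (\<lambda>p. (1/n) * t1 p) p = (1/n) * dderiv X t1 p"
    "dderiv X (\<lambda>p. (-1/n) * t2 p) p = (-1/n) * dderiv X t2 p" for X
    unfolding dderiv_arith(3)[OF differentiable_const d(1)] dderiv_arith(3)[OF differentiable_const d(2)] by simp_all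
  then show "D1 u1 p = 1" "D2 u1 p = 0" "D1 u2 p = 0" "D2 u2 p = 1"
    using n_pos D_t[OF assms] by (simp_all add: u1_def[abs_def] u2_def[abs_def])
qed

lemma D_comp_u:
  assumes "p \<in> \<Omega>" "(\<phi> has_real_derivative D) (at (u1 p))" "(\<psi> has_real_derivative D') (at (u2 p))"
  shows "D1 (\<lambda>q. \<phi> (u1 q)) p = D" "D2 (\<lambda>q. \<phi> (u1 q)) p = 0"
    "D1 (\<lambda>q. \<psi> (u2 q)) p = 0" "D2 (\<lambda>q. \<psi> (u2 q)) p = D'"
    "(\<lambda>q. \<phi> (u1 q)) differentiable (at p)" "(\<lambda>q. \<psi> (u2 q)) differentiable (at p)"
  using dderiv_compose_real[OF diff_u(1)[OF assms(1)] assms(2)] dderiv_compose_real[OF diff_u(2)[OF assms(1)] assms(3)]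
    D_u[OF assms(1)] pd_compose_real(2)[OF diff_u(1)[OF assms(1)] assms(2)]
    pd_compose_real(2)[OF diff_u(2)[OF assms(1)] assms(3)]
  by simp_all

definition c1 :: real where "c1 = sqrt 2 * c"

lemma c1_eq: "c1 = 2 * n"
  by (simp add: c1_def n_def field_simps)

lemma DERIV_gaussian: "((\<lambda>t. exp (a/2 * t^2)) has_real_derivative exp (a/2 * s^2) * (a * s)) (at s)"
  by (auto intro!: derivative_eq_intros)

text \<open>The field \<open>exp (- c1 u1^2 / 2) D1 y - gaussint (- c1) u1 Y\<close> and its analogue for \<open>u2\<close> are
  constant vectors of the ambient space; they become the columns of the transformation.\<close>

lemma integration:
  assumes "convex \<Omega>"
  obtains v1 v2 b where
    "\<And>p. p \<in> \<Omega> \<Longrightarrow> D1 (\<lambda>q. y q $ k) p = exp (c1/2 * (u1 p)^2) * (v1 + gaussint (- c1) (u1 p) * Yfield $ k)"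
    "\<And>p. p \<in> \<Omega> \<Longrightarrow> D2 (\<lambda>q. y q $ k) p = exp (- c1/2 * (u2 p)^2) * (v2 + gaussint c1 (u2 p) * Yfield $ k)"
    "\<And>p. p \<in> \<Omega> \<Longrightarrow> y p $ k = v1 * gaussint c1 (u1 p) + v2 * gaussint (- c1) (u2 p)
        + Yfield $ k * (gaussint2 c1 (u1 p) + gaussint2 (- c1) (u2 p)) + b"
proof -
  define h where "h = (\<lambda>q. y q $ k)"
  define Y where "Y = Yfield $ k"
  have dh: "h differentiable (at p)" "D1 h differentiable (at p)" "D2 h differentiable (at p)" if "p \<in> \<Omega>" for p
    unfolding h_def using smooth_on_differentiable[OF _ that] smooth_D[OF smooth_yk] smooth_yk by blast+
  have t: "2 * t1 p = c1 * u1 p" "2 * t2 p = - (c1 * u2 p)" for p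
    using n_pos by (simp_all add: c1_eq u1_def u2_def)
  have str: "D1 (D1 h) p = c1 * u1 p * D1 h p + Y" "D1 (D2 h) p = 0" "D2 (D1 h) p = 0"
    "D2 (D2 h) p = - (c1 * u2 p) * D2 h p + Y" if "p \<in> \<Omega>" for p
    using flat_structure_y[OF that, of k] unfolding t h_def Y_def by simp_all
  have e: "exp (- c1/2 * s) * exp (c1/2 * s) = 1" for s
    by (simp add: exp_add[symmetric])
  let ?k1 = "\<lambda>q. exp (- c1/2 * (u1 q)^2) * D1 h q - gaussint (- c1) (u1 q) * Y"
  let ?k2 = "\<lambda>q. exp (c1/2 * (u2 q)^2) * D2 h q - gaussint c1 (u2 q) * Y"
  have k1: "?k1 differentiable (at p)" "D1 ?k1 p = 0" "D2 ?k1 p = 0"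
    and k2: "?k2 differentiable (at p)" "D1 ?k2 p = 0" "D2 ?k2 p = 0" if "p \<in> \<Omega>" for p
  proof -
    note a = D_comp_u[OF that DERIV_gaussian[of "- c1"] DERIV_gaussian[of c1]]
    note b = D_comp_u[OF that DERIV_gaussint[of "- c1"] DERIV_gaussint[of c1]]
    show "?k1 differentiable (at p)" "?k2 differentiable (at p)"
      by (intro derivative_intros a b dh that)+
    show "D1 ?k1 p = 0" "D2 ?k1 p = 0" "D1 ?k2 p = 0" "D2 ?k2 p = 0"
      by (simp_all only: dderiv_arith a b dh that derivative_intros str dderiv_const)
        (simp_all add: algebra_simps)
  qed
  obtain v1 where v1: "\<And>p. p \<in> \<Omega> \<Longrightarrow> ?k1 p = v1"
    using constant_of_D[OF assms k1] by blast
  obtain v2 where v2: "\<And>p. p \<in> \<Omega> \<Longrightarrow> ?k2 p = v2"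
    using constant_of_D[OF assms k2] by blast
  have D1h: "D1 h p = exp (c1/2 * (u1 p)^2) * (v1 + gaussint (- c1) (u1 p) * Y)" if "p \<in> \<Omega>" for p
    unfolding v1[OF that, symmetric] using e[of "(u1 p)^2"] by (simp add: algebra_simps)
  have D2h: "D2 h p = exp (- c1/2 * (u2 p)^2) * (v2 + gaussint c1 (u2 p) * Y)" if "p \<in> \<Omega>" for p
    unfolding v2[OF that, symmetric] using e[of "(u2 p)^2"] by (simp add: algebra_simps)
  let ?b = "\<lambda>q. h q - (v1 * gaussint c1 (u1 q) + v2 * gaussint (- c1) (u2 q)
      + Y * (gaussint2 c1 (u1 q) + gaussint2 (- c1) (u2 q)))"
  have b: "?b differentiable (at p)" "D1 ?b p = 0" "D2 ?b p = 0" if "p \<in> \<Omega>" for p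
  proof -
    note a = D_comp_u[OF that DERIV_gaussint[of c1] DERIV_gaussint[of "- c1"]]
    note b = D_comp_u[OF that DERIV_gaussint2[of c1] DERIV_gaussint2[of "- c1"]]
    show "?b differentiable (at p)"
      by (intro derivative_intros a b dh that)
    show "D1 ?b p = 0" "D2 ?b p = 0"
      by (simp_all add: dderiv_arith a b dh that derivative_intros D1h D2h algebra_simps)
  qed
  obtain b' where b': "\<And>p. p \<in> \<Omega> \<Longrightarrow> ?b p = b'"
    using constant_of_D[OF assms b] by blast
  show thesis
  proof (rule that)
    show "D1 (\<lambda>q. y q $ k) p = exp (c1/2 * (u1 p)^2) * (v1 + gaussint (- c1) (u1 p) * Yfield $ k)"
      if "p \<in> \<Omega>" for p using D1h[OF that] by (simp add: h_def Y_def)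
    show "D2 (\<lambda>q. y q $ k) p = exp (- c1/2 * (u2 p)^2) * (v2 + gaussint c1 (u2 p) * Yfield $ k)"
      if "p \<in> \<Omega>" for p using D2h[OF that] by (simp add: h_def Y_def)
    show "y p $ k = v1 * gaussint c1 (u1 p) + v2 * gaussint (- c1) (u2 p)
        + Yfield $ k * (gaussint2 c1 (u1 p) + gaussint2 (- c1) (u2 p)) + b'"
      if "p \<in> \<Omega>" for p using b'[OF that] by (simp add: h_def Y_def)
  qed
qed

lemma normal_form:
  assumes "convex \<Omega>" "\<Omega> \<noteq> {}"
  obtains F u where "calabi_transformation F" "continuous_on \<Omega> u"
    "\<And>p. p \<in> \<Omega> \<Longrightarrow> y p = F (model_surface (sqrt 2 * c) 0 0 (u p))"
proof -
  have "\<forall>k. \<exists>v1 v2 b. (\<forall>p\<in>\<Omega>. D1 (\<lambda>q. y q $ k) p = exp (c1/2 * (u1 p)^2) * (v1 + gaussint (- c1) (u1 p) * Yfield $ k)) \<and>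
    (\<forall>p\<in>\<Omega>. D2 (\<lambda>q. y q $ k) p = exp (- c1/2 * (u2 p)^2) * (v2 + gaussint c1 (u2 p) * Yfield $ k)) \<and>
    (\<forall>p\<in>\<Omega>. y p $ k = v1 * gaussint c1 (u1 p) + v2 * gaussint (- c1) (u2 p)
        + Yfield $ k * (gaussint2 c1 (u1 p) + gaussint2 (- c1) (u2 p)) + b)"
    by (rule allI, rule integration[OF assms(1)], blast)
  then obtain v1 v2 b :: "3 \<Rightarrow> real" where
    D: "\<And>k p. p \<in> \<Omega> \<Longrightarrow> D1 (\<lambda>q. y q $ k) p = exp (c1/2 * (u1 p)^2) * (v1 k + gaussint (- c1) (u1 p) * Yfield $ k)"
       "\<And>k p. p \<in> \<Omega> \<Longrightarrow> D2 (\<lambda>q. y q $ k) p = exp (- c1/2 * (u2 p)^2) * (v2 k + gaussint c1 (u2 p) * Yfield $ k)"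
    and y: "\<And>k p. p \<in> \<Omega> \<Longrightarrow> y p $ k = v1 k * gaussint c1 (u1 p) + v2 k * gaussint (- c1) (u2 p)
        + Yfield $ k * (gaussint2 c1 (u1 p) + gaussint2 (- c1) (u2 p)) + b k"
    by metis
  \<comment> \<open>The integration constants of the three ambient coordinates are assembled: those
    of k = 1, 2 form the linear part, v1 and v2 at k = 3 the shear, and the \<open>b k\<close> the
    translation.\<close>
  define A :: "real^2^2" where "A = vector [vector [v1 1, v2 1], vector [v1 2, v2 2]]"
  define q :: "real^2" where "q = vector [v1 3, v2 3]"
  define b' :: "real^3" where "b' = (\<chi> k. b k)"
  obtain p where p: "p \<in> \<Omega>" using assms(2) by blast
  \<comment> \<open>If a combination of the horizontal parts of \<open>v1\<close> and
    \<open>v2\<close> vanished, the same combination of the two tangent vectors, weighted to remove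
    the exponentials, would be vertical, against \<open>frame_independent\<close>.\<close>
  have indep: "\<alpha> = 0 \<and> \<beta> = 0" if "\<alpha> * v1 1 + \<beta> * v2 1 = 0" "\<alpha> * v1 2 + \<beta> * v2 2 = 0" for \<alpha> \<beta>
  proof -
    define a where "a = \<alpha> * exp (- c1/2 * (u1 p)^2)"
    define d where "d = \<beta> * exp (c1/2 * (u2 p)^2)"
    have ee: "exp (- c1/2 * s) * exp (c1/2 * s) = 1" for s :: real
      by (simp add: exp_add[symmetric])
    have a: "a * D1 (\<lambda>q. y q $ k) p = \<alpha> * (v1 k + gaussint (- c1) (u1 p) * Yfield $ k)" for k
      unfolding D[OF p] a_def using ee[of "(u1 p)^2"] by (simp add: algebra_simps)
    have d: "d * D2 (\<lambda>q. y q $ k) p = \<beta> * (v2 k + gaussint c1 (u2 p) * Yfield $ k)" for k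
      unfolding D[OF p] d_def using ee[of "(u2 p)^2"] by (simp add: algebra_simps)
    define \<gamma> where "\<gamma> = - (a * D1 (\<lambda>q. y q $ 3) p + d * D2 (\<lambda>q. y q $ 3) p)"
    have "a * D1 (\<lambda>q. y q $ k) p + d * D2 (\<lambda>q. y q $ k) p + \<gamma> * Yfield $ k = 0" for k
    proof -
      have "a * D1 (\<lambda>q. y q $ 1) p + d * D2 (\<lambda>q. y q $ 1) p + \<gamma> * Yfield $ 1 = 0"
        "a * D1 (\<lambda>q. y q $ 2) p + d * D2 (\<lambda>q. y q $ 2) p + \<gamma> * Yfield $ 2 = 0"
        unfolding a d using that by (simp_all add: algebra_simps)
      moreover have "a * D1 (\<lambda>q. y q $ 3) p + d * D2 (\<lambda>q. y q $ 3) p + \<gamma> * Yfield $ 3 = 0"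
        by (simp add: \<gamma>_def)
      ultimately show ?thesis using exhaust_3[of k] by metis
    qed
    from frame_independent(1,2)[OF p this] show ?thesis by (simp add: a_def d_def)
  qed
  have "det A \<noteq> 0"
  proof
    assume "det A = 0"
    then have z: "v1 1 * v2 2 = v2 1 * v1 2" by (simp add: det_2 A_def)
    have "v2 1 = 0 \<and> - v1 1 = 0" "v2 2 = 0 \<and> - v1 2 = 0"
      by (rule indep; use z in \<open>simp add: algebra_simps\<close>)+
    then show False using indep[of 1 0] by simp
  qed
  then have inv: "invertible A" using invertible_det_nz by blast
  let ?M = "(vector [vector [A$1$1, A$1$2, 0], vector [A$2$1, A$2$2, 0], vector [q$1, q$2, 1]] :: real^3^3)"
  define F where "F = (\<lambda>X. ?M *v X + b')"
  define u :: "real^2 \<Rightarrow> real^2" where "u p = vector [u1 p, u2 p]" for p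
  have "calabi_transformation F"
    unfolding calabi_transformation_def F_def using inv by blast
  moreover have "continuous_on \<Omega> u"
  proof -
    have "continuous_on \<Omega> (\<lambda>p. \<chi> i. u p $ i)"
    proof (rule continuous_on_vec_lambda)
      fix i :: 2
      have "continuous_on \<Omega> u1" "continuous_on \<Omega> u2"
        using diff_u by (meson continuous_at_imp_continuous_on differentiable_imp_continuous_within)+
      then show "continuous_on \<Omega> (\<lambda>p. u p $ i)"
        using exhaust_2[of i] by (auto simp: u_def)
    qed
    then show ?thesis by simp
  qed
  moreover have "y p = F (model_surface (sqrt 2 * c) 0 0 (u p))" if "p \<in> \<Omega>" for p
    unfolding c1_def[symmetric] model_surface_0 F_def vec_eq_iff forall_3
    by (simp add: y[OF that] matrix_vector_mult_def sum_3 u_def A_def q_def b'_def algebra_simps)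
  ultimately show thesis by (rule that)
qed

end

section \<open>Rigidity of overlapping models\<close>

lemma strict_mono_gaussint: "strict_mono (gaussint a)"
proof (rule strict_monoI)
  fix s t :: real assume "s < t"
  then show "gaussint a s < gaussint a t"
    by (rule DERIV_pos_imp_increasing) (use DERIV_gaussint in \<open>auto intro!: exI\<close>)
qed

lemma inj_gaussint: "inj (gaussint a)"
  using strict_mono_gaussint strict_mono_imp_inj_on by blast

lemma gaussint_minus: "gaussint a (- t) = - gaussint a t"
proof -
  have "(LBINT s=0..ereal (- t). exp (a/2 * s^2)) = (LBINT s=ereal t..0. exp (a/2 * (- s)^2))"
    by (subst interval_integral_reflect) simp
  also have "\<dots> = - (LBINT s=0..ereal t. exp (a/2 * s^2))"
    by (subst interval_integral_endpoints_reverse) simp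
  finally show ?thesis by (simp add: gaussint_def)
qed

text \<open>The integrand is odd because \<open>gaussint\<close> is. With \<open>gaussint\<close>
  odd and \<open>gaussint2\<close> even, reflections of the parameters act on the model with c2 = c3
  = 0 by affine maps.\<close>

lemma gaussint2_minus: "gaussint2 a (- t) = gaussint2 a t"
proof -
  have "(LBINT s=0..ereal (- t). exp (a/2 * s^2) * gaussint (- a) s)
     = (LBINT s=ereal t..0. exp (a/2 * (- s)^2) * gaussint (- a) (- s))"
    by (subst interval_integral_reflect) simp
  also have "\<dots> = - (LBINT s=0..ereal t. exp (a/2 * (- s)^2) * gaussint (- a) (- s))"
    by (subst interval_integral_endpoints_reverse) simp
  also have "\<dots> = (LBINT s=0..ereal t. exp (a/2 * s^2) * gaussint (- a) s)"
    by (simp add: gaussint_minus interval_lebesgue_integral_uminus)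
  finally show ?thesis by (simp add: gaussint2_def)
qed

lemma DERIV_inv_gaussint:
  "(inv (gaussint a) has_real_derivative inverse (exp (a/2 * x^2))) (at (gaussint a x))"
  unfolding has_field_derivative_def
proof (rule has_derivative_inverse_strong[of UNIV x "gaussint a" "inv (gaussint a)" "(*) (exp (a/2 * x^2))"])
  show "continuous_on UNIV (gaussint a)"
    using DERIV_gaussint DERIV_isCont by (metis continuous_at_imp_continuous_on)
  show "(gaussint a has_derivative (*) (exp (a/2 * x^2))) (at x)"
    using DERIV_gaussint[of a x] by (simp add: has_field_derivative_def)
qed (auto simp: inv_f_f[OF inj_gaussint] fun_eq_iff)

text \<open>Differentiability of \<open>\<phi>\<close> is part of the conclusion: injectivity of
  \<open>gaussint a\<close> forces \<open>\<phi>\<close> to be its smooth inverse applied to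
  \<open>\<psi>\<close>.\<close>

lemma DERIV_gaussint_implicit:
  assumes "open I" "t \<in> I" "\<And>s. s \<in> I \<Longrightarrow> gaussint a (\<phi> s) = \<psi> s" "(\<psi> has_real_derivative D) (at t)"
  shows "(\<phi> has_real_derivative D / exp (a/2 * (\<phi> t)^2)) (at t)"
proof -
  have "((\<lambda>s. inv (gaussint a) (\<psi> s)) has_real_derivative inverse (exp (a/2 * (\<phi> t)^2)) * D) (at t)"
    using DERIV_inv_gaussint[of a "\<phi> t"] assms(4) unfolding assms(3)[OF assms(2)]
    by (rule DERIV_chain2)
  then have "(\<phi> has_real_derivative inverse (exp (a/2 * (\<phi> t)^2)) * D) (at t)"
  proof (rule has_field_derivative_transform_within_open[OF _ assms(1,2)])
    show "inv (gaussint a) (\<psi> s) = \<phi> s" if "s \<in> I" for s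
      using inv_f_f[OF inj_gaussint, of a "\<phi> s"] unfolding assms(3)[OF that] .
  qed
  then show ?thesis unfolding divide_inverse mult.commute[of D] .
qed

lemma DERIV_eq_on_open:
  assumes "open I" "t \<in> I" "\<And>s. s \<in> I \<Longrightarrow> f s = h s"
    "(f has_real_derivative D) (at t)" "(h has_real_derivative D') (at t)"
  shows "D = D'"
proof -
  have "(h has_real_derivative D) (at t)"
    by (rule has_field_derivative_transform_within_open[OF assms(4,1,2)]) (rule assms(3))
  then show ?thesis by (rule DERIV_unique) (rule assms(5))
qed

lemma exp_sq_halves:
  fixes a s :: real
  shows "exp (- a/2 * s^2) / exp (a/2 * s^2) = exp (- a * s^2)" "exp (a/2 * s^2) * exp (a/2 * s^2) = exp (a * s^2)"
  by (simp_all add: exp_add[symmetric] exp_diff[symmetric])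

text \<open>\<open>\<phi>\<close> and \<open>\<psi>\<close> are the image coordinates of a
  coordinate line of the model under an affine map. Differentiating the height relation and dividing
  by exp(e s^2/2) gives the third conclusion, differentiating that the fourth. In view of the first
  two, the fourth says that the image has unit speed in the flat metric.\<close>

lemma overlap_line:
  assumes I: "open I"
    and \<phi>: "\<And>s. s \<in> I \<Longrightarrow> gaussint a (\<phi> s) = A * gaussint e s + k1"
    and \<psi>: "\<And>s. s \<in> I \<Longrightarrow> gaussint a' (\<psi> s) = A' * gaussint e s + k2"
    and h: "\<And>s. s \<in> I \<Longrightarrow> gaussint2 a (\<phi> s) + gaussint2 a' (\<psi> s) = q * gaussint e s + gaussint2 e s + k3"
    and s: "s \<in> I"
  shows "(\<phi> has_real_derivative A * exp (e/2 * s^2) / exp (a/2 * (\<phi> s)^2)) (at s)"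
    and "(\<psi> has_real_derivative A' * exp (e/2 * s^2) / exp (a'/2 * (\<psi> s)^2)) (at s)"
    and "A * gaussint (- a) (\<phi> s) + A' * gaussint (- a') (\<psi> s) = q + gaussint (- e) s"
    and "A^2 * exp (- a * (\<phi> s)^2) + A'^2 * exp (- a' * (\<psi> s)^2) = exp (- e * s^2)"
proof -
  have d\<phi>: "(\<phi> has_real_derivative A * exp (e/2 * s^2) / exp (a/2 * (\<phi> s)^2)) (at s)" if "s \<in> I" for s
    by (rule DERIV_gaussint_implicit[OF I that \<phi>])
      (auto intro!: derivative_eq_intros DERIV_gaussint)
  have d\<psi>: "(\<psi> has_real_derivative A' * exp (e/2 * s^2) / exp (a'/2 * (\<psi> s)^2)) (at s)" if "s \<in> I" for s
    by (rule DERIV_gaussint_implicit[OF I that \<psi>])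
      (auto intro!: derivative_eq_intros DERIV_gaussint)
  show "(\<phi> has_real_derivative A * exp (e/2 * s^2) / exp (a/2 * (\<phi> s)^2)) (at s)"
    "(\<psi> has_real_derivative A' * exp (e/2 * s^2) / exp (a'/2 * (\<psi> s)^2)) (at s)"
    by (rule d\<phi>[OF s], rule d\<psi>[OF s])
  have first: "A * gaussint (- a) (\<phi> s) + A' * gaussint (- a') (\<psi> s) = q + gaussint (- e) s" if s: "s \<in> I" for s
  proof -
    have "exp (a/2 * (\<phi> s)^2) * gaussint (- a) (\<phi> s) * (A * exp (e/2 * s^2) / exp (a/2 * (\<phi> s)^2))
       + exp (a'/2 * (\<psi> s)^2) * gaussint (- a') (\<psi> s) * (A' * exp (e/2 * s^2) / exp (a'/2 * (\<psi> s)^2))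
       = q * exp (e/2 * s^2) + exp (e/2 * s^2) * gaussint (- e) s"
      by (rule DERIV_eq_on_open[OF I s h])
        (auto intro!: derivative_eq_intros DERIV_chain2[OF DERIV_gaussint2] DERIV_gaussint DERIV_gaussint2 d\<phi>[OF s] d\<psi>[OF s])
    then have "exp (e/2 * s^2) * (A * gaussint (- a) (\<phi> s) + A' * gaussint (- a') (\<psi> s))
        = exp (e/2 * s^2) * (q + gaussint (- e) s)"
      by (simp add: algebra_simps)
    then show ?thesis by simp
  qed
  then show "A * gaussint (- a) (\<phi> s) + A' * gaussint (- a') (\<psi> s) = q + gaussint (- e) s" using s by blast
  have "A * (exp (- a/2 * (\<phi> s)^2) * (A * exp (e/2 * s^2) / exp (a/2 * (\<phi> s)^2)))
     + A' * (exp (- a'/2 * (\<psi> s)^2) * (A' * exp (e/2 * s^2) / exp (a'/2 * (\<psi> s)^2)))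
     = exp (- e/2 * s^2)"
    by (rule DERIV_eq_on_open[OF I s first])
      (auto intro!: derivative_eq_intros DERIV_chain2[OF DERIV_gaussint] DERIV_gaussint d\<phi>[OF s] d\<psi>[OF s] simp: mult_ac)
  then have "exp (e/2 * s^2) * (A^2 * (exp (- a/2 * (\<phi> s)^2) / exp (a/2 * (\<phi> s)^2))
     + A'^2 * (exp (- a'/2 * (\<psi> s)^2) / exp (a'/2 * (\<psi> s)^2))) = exp (- e/2 * s^2)"
    by (simp add: algebra_simps power2_eq_square)
  then have "A^2 * (exp (- a/2 * (\<phi> s)^2) / exp (a/2 * (\<phi> s)^2))
     + A'^2 * (exp (- a'/2 * (\<psi> s)^2) / exp (a'/2 * (\<psi> s)^2)) = exp (- e/2 * s^2) / exp (e/2 * s^2)"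
    by (simp add: field_simps)
  then show "A^2 * exp (- a * (\<phi> s)^2) + A'^2 * exp (- a' * (\<psi> s)^2) = exp (- e * s^2)"
    unfolding exp_sq_halves .
qed

lemma exp_sq_nonconstant:
  fixes e :: real
  assumes "open I" "I \<noteq> {}" "e \<noteq> 0"
  obtains s t where "s \<in> I" "t \<in> I" "s \<noteq> t" "exp (e * s^2) \<noteq> exp (e * t^2)"
proof -
  obtain s where s: "s \<in> I" using assms(2) by blast
  then obtain d where d: "d > 0" "ball s d \<subseteq> I" using assms(1) openE by blast
  \<comment> \<open>Moving away from the origin guarantees a different square.\<close>
  let ?t = "if s \<ge> 0 then s + d/2 else s - d/2"
  have t: "?t \<in> I" using d by (auto simp: dist_real_def subset_iff)
  have "s^2 \<noteq> ?t^2"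
    using d(1) by (auto simp: power2_eq_iff)
  then show thesis using that[OF s t] assms(3) d(1) by auto
qed

text \<open>\<open>iso\<close> means that \<open>\<phi>\<close> has slope D with D^2 = 1.
  Differentiating \<open>iso\<close> and dividing by it gives a \<phi> D = e s, and squaring removes
  D.\<close>

lemma rigid_line:
  assumes I: "open I" and a: "a^2 = e^2" and e: "e \<noteq> 0"
    and \<phi>: "\<And>s. s \<in> I \<Longrightarrow> (\<phi> has_real_derivative A * exp (e/2 * s^2) / exp (a/2 * (\<phi> s)^2)) (at s)"
    and iso: "\<And>s. s \<in> I \<Longrightarrow> A^2 * exp (- a * (\<phi> s)^2) = exp (- e * s^2)"
    and s: "s \<in> I"
  shows "(\<phi> s)^2 = s^2"
proof -
  define D where "D = A * exp (e/2 * s^2) / exp (a/2 * (\<phi> s)^2)"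
  have D2: "D^2 = 1"
  proof -
    have "D^2 = A^2 * (exp (e/2 * s^2) * exp (e/2 * s^2)) / (exp (a/2 * (\<phi> s)^2) * exp (a/2 * (\<phi> s)^2))"
      by (simp add: D_def power2_eq_square)
    also have "\<dots> = A^2 * exp (- a * (\<phi> s)^2) * exp (e * s^2)"
      unfolding exp_sq_halves by (simp add: exp_minus divide_inverse)
    also have "\<dots> = 1" unfolding iso[OF s] by (simp add: exp_add[symmetric])
    finally show ?thesis .
  qed
  have "A^2 * (exp (- a * (\<phi> s)^2) * (- a * (2 * \<phi> s * D))) = exp (- e * s^2) * (- e * (2 * s))"
    by (rule DERIV_eq_on_open[OF I s iso])
      (use \<phi>[OF s, folded D_def] in \<open>auto intro!: derivative_eq_intros\<close>)
  then have "(A^2 * exp (- a * (\<phi> s)^2)) * (a * (\<phi> s * D)) = exp (- e * s^2) * (e * s)"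
    by (simp add: algebra_simps)
  then have "a * (\<phi> s * D) = e * s" unfolding iso[OF s] by simp
  then have "(a * (\<phi> s * D))^2 = (e * s)^2" by simp
  then show ?thesis using a e by (simp add: power_mult_distrib D2)
qed

lemma rigid_line_same:
  assumes I: "open I" "I \<noteq> {}" and e: "e \<noteq> 0"
    and eq: "\<And>s. s \<in> I \<Longrightarrow> gaussint e (\<phi> s) = A * gaussint e s + k"
    and \<phi>: "\<And>s. s \<in> I \<Longrightarrow> (\<phi> has_real_derivative A * exp (e/2 * s^2) / exp (e/2 * (\<phi> s)^2)) (at s)"
    and iso: "\<And>s. s \<in> I \<Longrightarrow> A^2 * exp (- e * (\<phi> s)^2) = exp (- e * s^2)"
  shows "A = 1 \<or> A = -1" "k = 0" "\<And>s. s \<in> I \<Longrightarrow> \<phi> s = A * s"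
proof -
  have sq: "(\<phi> s)^2 = s^2" if "s \<in> I" for s
    by (rule rigid_line[OF I(1) refl e \<phi> iso that])
  obtain s0 where s0: "s0 \<in> I" using I by blast
  have "A^2 = 1" using iso[OF s0] sq[OF s0] by simp
  then show A: "A = 1 \<or> A = -1" by (simp add: power2_eq_1_iff)
  show k: "k = 0"
  proof (rule ccontr)
    assume "k \<noteq> 0"
    \<comment> \<open>The sign in \<phi>(s) = s or -s could depend on s. Where \<phi>(s) = A s the
      constant \<open>k\<close> would be zero, so the other sign holds throughout and
      \<open>gaussint e\<close> would be constant on \<open>I\<close>.\<close>
    have "- 2 * A * gaussint e s = k" if "s \<in> I" for s
    proof -
      have "\<phi> s = s \<or> \<phi> s = - s" using sq[OF that] by (simp add: power2_eq_iff)
      then show ?thesis using eq[OF that] A \<open>k \<noteq> 0\<close> by (auto simp: gaussint_minus)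
    qed
    moreover obtain s t where "s \<in> I" "t \<in> I" "s \<noteq> t"
      using exp_sq_nonconstant[OF I e] by metis
    ultimately have "- 2 * A * gaussint e s = - 2 * A * gaussint e t" by simp
    then have "gaussint e s = gaussint e t" using A by auto
    then show False using \<open>s \<noteq> t\<close> inj_gaussint injD by metis
  qed
  show "\<phi> s = A * s" if "s \<in> I" for s
  proof -
    have "gaussint e (\<phi> s) = gaussint e (A * s)" using eq[OF that] k A by (auto simp: gaussint_minus)
    then show ?thesis using inj_gaussint injD by metis
  qed
qed

text \<open>Rules out an exchange of the two coordinate directions: \<open>rigid_line\<close> still
  gives \<phi>(s)^2 = s^2, but then the constant A^2 would equal exp(-2 e s^2).\<close>

lemma no_rigid_line_opposite:
  assumes I: "open I" "I \<noteq> {}" and e: "e \<noteq> 0"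
    and \<phi>: "\<And>s. s \<in> I \<Longrightarrow> (\<phi> has_real_derivative A * exp (e/2 * s^2) / exp (- e/2 * (\<phi> s)^2)) (at s)"
    and iso: "\<And>s. s \<in> I \<Longrightarrow> A^2 * exp (e * (\<phi> s)^2) = exp (- e * s^2)"
  shows False
proof -
  have sq: "(\<phi> s)^2 = s^2" if "s \<in> I" for s
    by (rule rigid_line[OF I(1) _ e _ _ that, of "- e" \<phi> A]) (use \<phi> iso in auto)
  have "A^2 = exp (- (2 * e) * s^2)" if "s \<in> I" for s
  proof -
    have "A^2 * exp (e * s^2) * exp (- e * s^2) = exp (- e * s^2) * exp (- e * s^2)"
      using iso[OF that] sq[OF that] by simp
    then show ?thesis by (simp add: mult.assoc exp_add[symmetric])
  qed
  moreover obtain s t where "s \<in> I" "t \<in> I" "exp (- (2 * e) * s^2) \<noteq> exp (- (2 * e) * t^2)"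
    using exp_sq_nonconstant[OF I, of "- (2 * e)"] e by (metis mult_eq_0_iff neg_equal_0_iff_equal zero_neq_numeral)
  ultimately show False by metis
qed

section \<open>Composition and inversion of Calabi transformations\<close>

definition affmap :: "real^2^2 \<Rightarrow> real^2 \<Rightarrow> real^3 \<Rightarrow> real^3 \<Rightarrow> real^3" where
  "affmap P q b X = vector [P$1$1 * X$1 + P$1$2 * X$2 + b$1, P$2$1 * X$1 + P$2$2 * X$2 + b$2,
     q$1 * X$1 + q$2 * X$2 + X$3 + b$3]"

lemma calabi_transformation_iff:
  "calabi_transformation F \<longleftrightarrow> (\<exists>P q b. invertible P \<and> F = affmap P q b)"
proof -
  have "(\<lambda>X. (vector [vector [P$1$1, P$1$2, 0], vector [P$2$1, P$2$2, 0], vector [q$1, q$2, 1]] :: real^3^3) *v X + b)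
    = affmap P q b" for P q b
    by (simp add: fun_eq_iff vec_eq_iff forall_3 matrix_vector_mult_def sum_3 affmap_def)
  then show ?thesis by (simp add: calabi_transformation_def)
qed

lemma affmap_comp:
  "affmap P q b (affmap P' q' b' X) = affmap (P ** P')
     (vector [q$1 * P'$1$1 + q$2 * P'$2$1 + q'$1, q$1 * P'$1$2 + q$2 * P'$2$2 + q'$2]) (affmap P q b b') X"
  by (simp add: affmap_def vec_eq_iff forall_3 matrix_matrix_mult_def sum_2 algebra_simps)

lemma calabi_transformation_comp:
  assumes "calabi_transformation F" "calabi_transformation F'"
  shows "calabi_transformation (\<lambda>X. F (F' X))"
proof -
  obtain P q b P' q' b' where "invertible P" "F = affmap P q b" "invertible P'" "F' = affmap P' q' b'"
    using assms unfolding calabi_transformation_iff by blast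
  then show ?thesis
    unfolding calabi_transformation_iff using invertible_mult affmap_comp by blast
qed

lemma calabi_transformation_inverse:
  assumes "calabi_transformation F"
  obtains F' where "calabi_transformation F'" "\<And>X. F' (F X) = X" "\<And>X. F (F' X) = X"
proof -
  obtain P q b where P: "invertible P" and F: "F = affmap P q b"
    using assms unfolding calabi_transformation_iff by blast
  let ?R = "matrix_inv P"
  \<comment> \<open>Obtained by solving for X: the first two coordinates are R (X - b), and the
    third subtracts \<open>q\<close> applied to them and b3.\<close>
  define F' where "F' = affmap ?R (vector [- (q$1 * ?R$1$1 + q$2 * ?R$2$1), - (q$1 * ?R$1$2 + q$2 * ?R$2$2)])
    (vector [- (?R$1$1 * b$1 + ?R$1$2 * b$2), - (?R$2$1 * b$1 + ?R$2$2 * b$2),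
       q$1 * (?R$1$1 * b$1 + ?R$1$2 * b$2) + q$2 * (?R$2$1 * b$1 + ?R$2$2 * b$2) - b$3])"
  have e: "(P ** ?R) $ i $ j = (mat 1 :: real^2^2) $ i $ j" "(?R ** P) $ i $ j = (mat 1 :: real^2^2) $ i $ j" for i j
    using matrix_inv_works[OF P] by simp_all
  have r: "?R$1$1 * P$1$1 + ?R$1$2 * P$2$1 = 1" "?R$1$1 * P$1$2 + ?R$1$2 * P$2$2 = 0"
    "?R$2$1 * P$1$1 + ?R$2$2 * P$2$1 = 0" "?R$2$1 * P$1$2 + ?R$2$2 * P$2$2 = 1"
    "P$1$1 * ?R$1$1 + P$1$2 * ?R$2$1 = 1" "P$1$1 * ?R$1$2 + P$1$2 * ?R$2$2 = 0"
    "P$2$1 * ?R$1$1 + P$2$2 * ?R$2$1 = 0" "P$2$1 * ?R$1$2 + P$2$2 * ?R$2$2 = 1"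
    using e(2)[of 1 1] e(2)[of 1 2] e(2)[of 2 1] e(2)[of 2 2] e(1)[of 1 1] e(1)[of 1 2] e(1)[of 2 1] e(1)[of 2 2]
    by (simp_all add: matrix_matrix_mult_def mat_def sum_2)
  have R: "invertible ?R" using matrix_inv_works[OF P] unfolding invertible_def by blast
  have 1: "F' (F X) = X" for X
  proof -
    have a: "F' (F X) $ 1 = (?R$1$1 * P$1$1 + ?R$1$2 * P$2$1) * X$1 + (?R$1$1 * P$1$2 + ?R$1$2 * P$2$2) * X$2"
      and b: "F' (F X) $ 2 = (?R$2$1 * P$1$1 + ?R$2$2 * P$2$1) * X$1 + (?R$2$1 * P$1$2 + ?R$2$2 * P$2$2) * X$2"
      and c: "F' (F X) $ 3 = X$3
         + q$1 * (X$1 - ((?R$1$1 * P$1$1 + ?R$1$2 * P$2$1) * X$1 + (?R$1$1 * P$1$2 + ?R$1$2 * P$2$2) * X$2))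
         + q$2 * (X$2 - ((?R$2$1 * P$1$1 + ?R$2$2 * P$2$1) * X$1 + (?R$2$1 * P$1$2 + ?R$2$2 * P$2$2) * X$2))"
      by (simp_all add: F F'_def affmap_def algebra_simps)
    show ?thesis unfolding vec_eq_iff forall_3 a b c r by simp
  qed
  have 2: "F (F' X) = X" for X
  proof -
    have a: "F (F' X) $ 1 = (P$1$1 * ?R$1$1 + P$1$2 * ?R$2$1) * (X$1 - b$1)
        + (P$1$1 * ?R$1$2 + P$1$2 * ?R$2$2) * (X$2 - b$2) + b$1"
      and b: "F (F' X) $ 2 = (P$2$1 * ?R$1$1 + P$2$2 * ?R$2$1) * (X$1 - b$1)
        + (P$2$1 * ?R$1$2 + P$2$2 * ?R$2$2) * (X$2 - b$2) + b$2"
      and c: "F (F' X) $ 3 = X$3"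
      by (simp_all add: F F'_def affmap_def algebra_simps)
    show ?thesis unfolding vec_eq_iff forall_3 a b c r by simp
  qed
  have "calabi_transformation F'" unfolding calabi_transformation_iff F'_def using R by blast
  then show thesis using that 1 2 by blast
qed

section \<open>The model with c2 = c3 = 0 and the affine maps between its open pieces\<close>

definition model :: "real \<Rightarrow> real^2 \<Rightarrow> real^3" where
  "model c u = model_surface c 0 0 u"

lemma model_nth: "model c u $ 1 = gaussint c (u $ 1)" "model c u $ 2 = gaussint (- c) (u $ 2)"
  "model c u $ 3 = gaussint2 c (u $ 1) + gaussint2 (- c) (u $ 2)"
  by (simp_all add: model_def model_surface_0)

lemma inj_model: "inj (model c)"
proof (rule injI)
  fix u v assume "model c u = model c v"
  then have "gaussint c (u $ 1) = gaussint c (v $ 1)" "gaussint (- c) (u $ 2) = gaussint (- c) (v $ 2)"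
    using model_nth by metis+
  then show "u = v" using injD[OF inj_gaussint] by (auto simp: vec_eq_iff forall_2)
qed

definition flip :: "real \<Rightarrow> real \<Rightarrow> real^2 \<Rightarrow> real^2" where
  "flip s1 s2 u = vector [s1 * u $ 1, s2 * u $ 2]"

text \<open>The map induced on the parameters preserves the flat metric. Together with the
  nonconstant exponentials this makes \<open>P\<close> diagonal with entries 1 or -1 and forces the
  shear and the translation to vanish.\<close>

lemma model_overlap:
  assumes c: "c > 0" and V: "open V" "V \<noteq> {}" and F: "calabi_transformation F"
    and overlap: "\<And>u. u \<in> V \<Longrightarrow> \<exists>v. F (model c u) = model c v"
  obtains s1 s2 where "s1 \<in> {1, -1}" "s2 \<in> {1, -1}" "\<And>u. F (model c u) = model c (flip s1 s2 u)"
proof -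
  obtain P q b where P: "invertible P" and Fe: "F = affmap P q b"
    using F unfolding calabi_transformation_iff by blast
  obtain \<sigma> where \<sigma>: "\<And>u. u \<in> V \<Longrightarrow> affmap P q b (model c u) = model c (\<sigma> u)"
    using overlap unfolding Fe by metis
  obtain u0 where u0: "u0 \<in> V" using V(2) by blast
  obtain d where d: "d > 0" "ball u0 d \<subseteq> V" using V(1) u0 openE by blast
  define I where "I = ball (u0 $ 1) (d/2)"
  define J where "J = ball (u0 $ 2) (d/2)"
  have IJ: "open I" "open J" "I \<noteq> {}" "J \<noteq> {}" using d by (auto simp: I_def J_def)
  have IJV: "vector [x, z] \<in> V" if "x \<in> I" "z \<in> J" for x z
  proof -
    have "norm (vector [x, z] - u0) \<le> \<bar>(vector [x, z] - u0) $ 1\<bar> + \<bar>(vector [x, z] - u0) $ 2\<bar>"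
      using norm_le_l1_cart[of "vector [x, z] - u0"] by (simp add: sum_2)
    also have "\<dots> < d" using that by (simp add: I_def J_def dist_real_def abs_minus_commute)
    finally show ?thesis using d(2) by (auto simp: dist_norm norm_minus_commute)
  qed
  define \<eta>1 where "\<eta>1 x z = \<sigma> (vector [x, z]) $ 1" for x z
  define \<eta>2 where "\<eta>2 x z = \<sigma> (vector [x, z]) $ 2" for x z
  have E1: "gaussint c (\<eta>1 x z) = P$1$1 * gaussint c x + P$1$2 * gaussint (- c) z + b$1"
    and E2: "gaussint (- c) (\<eta>2 x z) = P$2$1 * gaussint c x + P$2$2 * gaussint (- c) z + b$2"
    and E3: "gaussint2 c (\<eta>1 x z) + gaussint2 (- c) (\<eta>2 x z) = q$1 * gaussint c x + q$2 * gaussint (- c) z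
      + (gaussint2 c x + gaussint2 (- c) z) + b$3"
    if "x \<in> I" "z \<in> J" for x z
    using arg_cong[OF \<sigma>[OF IJV[OF that]], of "\<lambda>X. X $ 1"] arg_cong[OF \<sigma>[OF IJV[OF that]], of "\<lambda>X. X $ 2"]
      arg_cong[OF \<sigma>[OF IJV[OF that]], of "\<lambda>X. X $ 3"]
    by (simp_all add: affmap_def model_nth \<eta>1_def \<eta>2_def)
  have x: "((\<lambda>x. \<eta>1 x z) has_real_derivative P$1$1 * exp (c/2 * x^2) / exp (c/2 * (\<eta>1 x z)^2)) (at x)"
    "((\<lambda>x. \<eta>2 x z) has_real_derivative P$2$1 * exp (c/2 * x^2) / exp (- c/2 * (\<eta>2 x z)^2)) (at x)"
    "P$1$1 * gaussint (- c) (\<eta>1 x z) + P$2$1 * gaussint (- (- c)) (\<eta>2 x z) = q$1 + gaussint (- c) x"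
    "(P$1$1)^2 * exp (- c * (\<eta>1 x z)^2) + (P$2$1)^2 * exp (- (- c) * (\<eta>2 x z)^2) = exp (- c * x^2)"
    if "x \<in> I" "z \<in> J" for x z
    by (rule overlap_line[OF IJ(1) _ _ _ that(1), where \<phi> = "\<lambda>x. \<eta>1 x z" and \<psi> = "\<lambda>x. \<eta>2 x z"
          and a = c and a' = "- c" and e = c and A = "P$1$1" and A' = "P$2$1" and q = "q$1"
          and ?k1.0 = "P$1$2 * gaussint (- c) z + b$1" and ?k2.0 = "P$2$2 * gaussint (- c) z + b$2"
          and ?k3.0 = "q$2 * gaussint (- c) z + gaussint2 (- c) z + b$3"];
        use E1[OF _ that(2)] E2[OF _ that(2)] E3[OF _ that(2)] in \<open>simp add: algebra_simps\<close>)+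
  have z: "((\<lambda>z. \<eta>1 x z) has_real_derivative P$1$2 * exp (- c/2 * z^2) / exp (c/2 * (\<eta>1 x z)^2)) (at z)"
    "((\<lambda>z. \<eta>2 x z) has_real_derivative P$2$2 * exp (- c/2 * z^2) / exp (- c/2 * (\<eta>2 x z)^2)) (at z)"
    "P$1$2 * gaussint (- c) (\<eta>1 x z) + P$2$2 * gaussint (- (- c)) (\<eta>2 x z) = q$2 + gaussint (- (- c)) z"
    "(P$1$2)^2 * exp (- c * (\<eta>1 x z)^2) + (P$2$2)^2 * exp (- (- c) * (\<eta>2 x z)^2) = exp (- (- c) * z^2)"
    if "x \<in> I" "z \<in> J" for x z
    by (rule overlap_line[OF IJ(2) _ _ _ that(2), where \<phi> = "\<lambda>z. \<eta>1 x z" and \<psi> = "\<lambda>z. \<eta>2 x z"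
          and a = c and a' = "- c" and e = "- c" and A = "P$1$2" and A' = "P$2$2" and q = "q$2"
          and ?k1.0 = "P$1$1 * gaussint c x + b$1" and ?k2.0 = "P$2$1 * gaussint c x + b$2"
          and ?k3.0 = "q$1 * gaussint c x + gaussint2 c x + b$3"];
        use E1[OF that(1)] E2[OF that(1)] E3[OF that(1)] in \<open>simp add: algebra_simps\<close>)+
  \<comment> \<open>The z-derivative of the third relation along x-lines: the images of the two
    coordinate directions remain orthogonal.\<close>
  have mixed: "P$1$1 * P$1$2 * exp (- c * (\<eta>1 x z)^2) + P$2$1 * P$2$2 * exp (c * (\<eta>2 x z)^2) = 0"
    if xz: "x \<in> I" "z \<in> J" for x z
  proof -
    have "P$1$1 * (exp (- c/2 * (\<eta>1 x z)^2) * (P$1$2 * exp (- c/2 * z^2) / exp (c/2 * (\<eta>1 x z)^2)))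
       + P$2$1 * (exp (c/2 * (\<eta>2 x z)^2) * (P$2$2 * exp (- c/2 * z^2) / exp (- c/2 * (\<eta>2 x z)^2))) = 0"
    proof (rule DERIV_eq_on_open[OF IJ(2) xz(2)])
      show "P$1$1 * gaussint (- c) (\<eta>1 x z) + P$2$1 * gaussint c (\<eta>2 x z) = q$1 + gaussint (- c) x"
        if "z \<in> J" for z using x(3)[OF xz(1) that] by simp
      show "((\<lambda>z. P$1$1 * gaussint (- c) (\<eta>1 x z) + P$2$1 * gaussint c (\<eta>2 x z)) has_real_derivative
        P$1$1 * (exp (- c/2 * (\<eta>1 x z)^2) * (P$1$2 * exp (- c/2 * z^2) / exp (c/2 * (\<eta>1 x z)^2)))
       + P$2$1 * (exp (c/2 * (\<eta>2 x z)^2) * (P$2$2 * exp (- c/2 * z^2) / exp (- c/2 * (\<eta>2 x z)^2)))) (at z)"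
        by (intro DERIV_add DERIV_cmult DERIV_chain2[OF DERIV_gaussint] z xz)
    qed simp
    then have "exp (- c/2 * z^2) * (P$1$1 * P$1$2 * (exp (- c/2 * (\<eta>1 x z)^2) / exp (c/2 * (\<eta>1 x z)^2))
       + P$2$1 * P$2$2 * (exp (- (- c)/2 * (\<eta>2 x z)^2) / exp (- c/2 * (\<eta>2 x z)^2))) = 0"
      by (simp add: algebra_simps)
    then show ?thesis unfolding exp_sq_halves by simp
  qed
  obtain x0 z0 where x0: "x0 \<in> I" and z0: "z0 \<in> J" using IJ by blast
  have prod0: "P$1$1 * P$1$2 = 0" "P$2$1 * P$2$2 = 0"
  proof -
    have "P$2$1 * P$2$2 = 0"
    proof (rule ccontr)
      assume nz: "P$2$1 * P$2$2 \<noteq> 0"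
      \<comment> \<open>By \<open>mixed\<close> the exponential in \<eta>2 is a constant multiple of
        the one in \<eta>1. The two unit-speed relations then become proportional, exp(-c x^2) L =
        exp(c z^2) K, which fails because the left side varies with x.\<close>
      define \<kappa> where "\<kappa> = - (P$1$1 * P$1$2) / (P$2$1 * P$2$2)"
      have \<beta>: "exp (c * (\<eta>2 x z)^2) = \<kappa> * exp (- c * (\<eta>1 x z)^2)" if "x \<in> I" "z \<in> J" for x z
        using mixed[OF that] nz by (simp add: \<kappa>_def field_simps)
      define K where "K = (P$1$1)^2 + (P$2$1)^2 * \<kappa>"
      define L where "L = (P$1$2)^2 + (P$2$2)^2 * \<kappa>"
      have K: "exp (- c * (\<eta>1 x z)^2) * K = exp (- c * x^2)" if "x \<in> I" "z \<in> J" for x z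
        using x(4)[OF that] \<beta>[OF that] by (simp add: K_def algebra_simps)
      have L: "exp (- c * (\<eta>1 x z)^2) * L = exp (c * z^2)" if "x \<in> I" "z \<in> J" for x z
        using z(4)[OF that] \<beta>[OF that] by (simp add: L_def algebra_simps)
      have KL: "exp (- c * x^2) * L = exp (c * z0^2) * K" if "x \<in> I" for x
        unfolding K[OF that z0, symmetric] L[OF that z0, symmetric] by simp
      have L0: "L \<noteq> 0" using L[OF x0 z0] by auto
      obtain s t where st: "s \<in> I" "t \<in> I" "exp (- c * s^2) \<noteq> exp (- c * t^2)"
        using exp_sq_nonconstant[OF IJ(1,3), of "- c"] c by (metis less_irrefl neg_equal_0_iff_equal)
      have "exp (- c * s^2) * L = exp (- c * t^2) * L" using KL[OF st(1)] KL[OF st(2)] by (simp only:)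
      then have "exp (- c * s^2) = exp (- c * t^2)" using L0 by (metis mult_right_cancel)
      then show False using st(3) by (simp only: simp_thms)
    qed
    then show "P$2$1 * P$2$2 = 0" "P$1$1 * P$1$2 = 0" using mixed[OF x0 z0] by auto
  qed
  have det: "P$1$1 * P$2$2 - P$1$2 * P$2$1 \<noteq> 0"
    using P invertible_det_nz[of P] by (simp add: det_2)
  have P11: "P$1$1 \<noteq> 0"
  proof
    \<comment> \<open>Then \<open>P\<close> would interchange the coordinate directions, although
      their exponents have opposite signs.\<close>
    assume z11: "P$1$1 = 0"
    then have z22: "P$2$2 = 0" using det prod0 by auto
    show False
      by (rule no_rigid_line_opposite[OF IJ(1,3), of c "\<lambda>x. \<eta>2 x z0" "P$2$1"])
        (use c x(2)[OF _ z0] x(4)[OF _ z0] z11 in simp_all)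
  qed
  then have P12: "P$1$2 = 0" using prod0 by simp
  then have P22: "P$2$2 \<noteq> 0" using det by simp
  then have P21: "P$2$1 = 0" using prod0 by simp
  have A: "P$1$1 = 1 \<or> P$1$1 = -1" "b$1 = 0" "\<And>x. x \<in> I \<Longrightarrow> \<eta>1 x z0 = P$1$1 * x"
    by (rule rigid_line_same[OF IJ(1,3), of c "\<lambda>x. \<eta>1 x z0" "P$1$1" "b$1"];
        use c E1[OF _ z0] x(1)[OF _ z0] x(4)[OF _ z0] P12 P21 in simp)+
  have B: "P$2$2 = 1 \<or> P$2$2 = -1" "b$2 = 0" "\<And>z. z \<in> J \<Longrightarrow> \<eta>2 x0 z = P$2$2 * z"
    by (rule rigid_line_same[OF IJ(2,4), of "- c" "\<lambda>z. \<eta>2 x0 z" "P$2$2" "b$2"];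
        use c E2[OF x0] z(2)[OF x0] z(4)[OF x0] P12 P21 in simp)+
  \<comment> \<open>The diagonal entries are 1 or -1, so they pass through the odd function
    \<open>gaussint\<close> and disappear inside the even \<open>gaussint2\<close>.\<close>
  have odd: "P$1$1 * (P$1$1 * t) = t" "P$2$2 * (P$2$2 * t) = t"
    "gaussint a (P$1$1 * t) = P$1$1 * gaussint a t" "gaussint a (P$2$2 * t) = P$2$2 * gaussint a t"
    "gaussint2 a (P$1$1 * t) = gaussint2 a t" "gaussint2 a (P$2$2 * t) = gaussint2 a t" for a t
    using A(1) B(1) by (auto simp: gaussint_minus gaussint2_minus)
  have q1: "q$1 = 0" using x(3)[OF x0 z0] P21 A(3)[OF x0] odd by simp
  have q2: "q$2 = 0" using z(3)[OF x0 z0] P12 B(3)[OF z0] odd by simp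
  have b3: "b$3 = 0" using E3[OF x0 z0] q1 q2 A(3)[OF x0] B(3)[OF z0] odd by simp
  \<comment> \<open>All parameters of \<open>F\<close> are now determined, so the identity holds for
    every \<open>u\<close> and not merely on \<open>V\<close>.\<close>
  have "F (model c u) = model c (flip (P$1$1) (P$2$2) u)" for u
    unfolding vec_eq_iff forall_3
    by (simp add: Fe affmap_def model_nth flip_def odd P12 P21 A(2) B(2) q1 q2 b3)
  then show thesis using that[of "P$1$1" "P$2$2"] A(1) B(1) by blast
qed

section \<open>From local to global\<close>

lemma calabi_patch_subset: "calabi_patch \<Omega> y \<Longrightarrow> B \<subseteq> \<Omega> \<Longrightarrow> calabi_patch B y"
  unfolding calabi_patch_def using smooth_on_subset by blast

lemma flat_chart_subset:
  assumes "flat_chart \<Omega> y c" "open B" "B \<subseteq> \<Omega>"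
  shows "flat_chart B y c"
proof -
  interpret flat_chart \<Omega> y c by (rule assms)
  show ?thesis
    using assms(2,3) calabi_patch_subset[OF patch] flat c_pos norm_c N_sym N_trace
    by unfold_locales auto
qed

lemma flat_chart_normal_form:
  assumes "flat_chart \<Omega> y c" "p0 \<in> \<Omega>"
  obtains B F u where "open B" "p0 \<in> B" "B \<subseteq> \<Omega>" "calabi_transformation F" "continuous_on B u"
    "\<And>p. p \<in> B \<Longrightarrow> y p = F (model (sqrt 2 * c) (u p))"
proof -
  interpret flat_chart \<Omega> y c by (rule assms)
  obtain B1 E1 E2 where B1: "open B1" "p0 \<in> B1" "B1 \<subseteq> \<Omega>" "smooth_on B1 E1" "smooth_on B1 E2"
    "\<And>p. p \<in> B1 \<Longrightarrow> gip (g p) (E1 p) (E1 p) = 1" "\<And>p. p \<in> B1 \<Longrightarrow> gip (g p) (E2 p) (E2 p) = 1"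
    "\<And>p. p \<in> B1 \<Longrightarrow> gip (g p) (E1 p) (E2 p) = 0"
    "\<And>p. p \<in> B1 \<Longrightarrow> Nm p (E1 p) = n *\<^sub>R E1 p" "\<And>p. p \<in> B1 \<Longrightarrow> Nm p (E2 p) = (- n) *\<^sub>R E2 p"
    using eigenframe[OF assms(2)] by metis
  \<comment> \<open>A ball is taken because the integration of the structure equations needs a
    convex domain.\<close>
  obtain d where d: "d > 0" "ball p0 d \<subseteq> B1" using B1(1,2) openE by blast
  have "ball p0 d \<subseteq> \<Omega>" using d(2) B1(3) by blast
  then interpret b: flat_chart "ball p0 d" y c
    by (rule flat_chart_subset[OF assms(1) open_ball])
  interpret flat_frame "ball p0 d" y c E1 E2
    using d(2) B1(6-) smooth_on_subset[OF B1(4) d(2)] smooth_on_subset[OF B1(5) d(2)]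
    by unfold_locales auto
  have "convex (ball p0 d)" "ball p0 d \<noteq> {}" using d(1) by auto
  then obtain F u where "calabi_transformation F" "continuous_on (ball p0 d) u"
    "\<And>p. p \<in> ball p0 d \<Longrightarrow> y p = F (model_surface (sqrt 2 * c) 0 0 (u p))"
    by (rule normal_form) (rule that, assumption, assumption, blast)
  then show thesis
    using that[of "ball p0 d" F u] d \<open>ball p0 d \<subseteq> \<Omega>\<close> by (auto simp: model_def)
qed

section \<open>Reflections of the parameter plane and gluing of patches\<close>

lemma flip_flip: "s1 \<in> {1, -1} \<Longrightarrow> s2 \<in> {1, -1} \<Longrightarrow> flip s1 s2 (flip s1 s2 u) = u"
  by (auto simp: flip_def vec_eq_iff forall_2)

lemma continuous_flip: "continuous_on S (flip s1 s2)"
proof -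
  have "continuous_on S (\<lambda>u. \<chi> i. flip s1 s2 u $ i)"
  proof (rule continuous_on_vec_lambda)
    fix i :: 2
    have "continuous_on S (\<lambda>u::real^2. s1 * u $ 1)" "continuous_on S (\<lambda>u::real^2. s2 * u $ 2)"
      by (intro continuous_intros)+
    then show "continuous_on S (\<lambda>u. flip s1 s2 u $ i)"
      using exhaust_2[of i] by (auto simp: flip_def)
  qed
  then show ?thesis by simp
qed

lemma open_flip:
  assumes "s1 \<in> {1, -1}" "s2 \<in> {1, -1}" "open W"
  shows "open (flip s1 s2 ` W)"
proof -
  have "flip s1 s2 ` W = flip s1 s2 -` W"
    using flip_flip[OF assms(1,2)] by (auto simp: image_iff) metis
  then show ?thesis
    using open_vimage[OF assms(3) continuous_flip] by simp
qed

text \<open>Openness of \<open>u\<close> as a map serves the gluing: overlaps of patches have open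
  parameter images, as \<open>model_overlap\<close> demands, and the parameter set of the whole
  surface comes out open.\<close>

definition good_patch :: "('m::topological_space \<Rightarrow> real^3) \<Rightarrow> real \<Rightarrow> 'm set \<Rightarrow> (real^3 \<Rightarrow> real^3) \<Rightarrow> ('m \<Rightarrow> real^2) \<Rightarrow> bool" where
  "good_patch x c Q F u \<longleftrightarrow> open Q \<and> calabi_transformation F \<and> (\<forall>m\<in>Q. x m = F (model c (u m))) \<and>
     (\<forall>W\<subseteq>Q. open W \<longrightarrow> open (u ` W))"

text \<open>Both transformations parametrize the same complete affine image of the model, up to a
  reflection of the parameters.\<close>

definition congruent_models :: "real \<Rightarrow> (real^3 \<Rightarrow> real^3) \<Rightarrow> (real^3 \<Rightarrow> real^3) \<Rightarrow> bool" where
  "congruent_models c F F' \<longleftrightarrow> (\<exists>s1\<in>{1, -1}. \<exists>s2\<in>{1, -1}. \<forall>u. F (model c u) = F' (model c (flip s1 s2 u)))"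

lemma congruent_models_refl: "congruent_models c F F"
proof -
  have "flip 1 1 u = u" for u by (simp add: flip_def vec_eq_iff forall_2)
  then have "\<forall>u. F (model c u) = F (model c (flip 1 1 u))" by simp
  then show ?thesis unfolding congruent_models_def by blast
qed

lemma congruent_models_trans:
  assumes "congruent_models c F F'" "congruent_models c F' F''"
  shows "congruent_models c F F''"
proof -
  obtain s1 s2 t1 t2 where s: "s1 \<in> {1, -1}" "s2 \<in> {1, -1}" "t1 \<in> {1, -1}" "t2 \<in> {1, -1}"
    and 1: "\<And>u. F (model c u) = F' (model c (flip s1 s2 u))" and 2: "\<And>u. F' (model c u) = F'' (model c (flip t1 t2 u))"
    using assms unfolding congruent_models_def by blast
  have "flip t1 t2 (flip s1 s2 u) = flip (t1 * s1) (t2 * s2) u" for u by (simp add: flip_def mult.assoc)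
  then have "\<forall>u. F (model c u) = F'' (model c (flip (t1 * s1) (t2 * s2) u))" using 1 2 by simp
  moreover have "t1 * s1 \<in> {1, -1}" "t2 * s2 \<in> {1, -1}" using s by auto
  ultimately show ?thesis unfolding congruent_models_def by blast
qed

lemma good_patches_overlap:
  assumes c: "c > 0" and g: "good_patch x c Q F u" "good_patch x c Q' F' u'" and m: "m \<in> Q" "m \<in> Q'"
  shows "congruent_models c F F'"
proof -
  have F: "calabi_transformation F" "calabi_transformation F'" using g by (auto simp: good_patch_def)
  obtain H where H: "calabi_transformation H" "\<And>X. H (F' X) = X" "\<And>X. F' (H X) = X"
    using calabi_transformation_inverse[OF F(2)] by metis
  have W: "open (u ` (Q \<inter> Q'))" "u ` (Q \<inter> Q') \<noteq> {}"
    using g m by (auto simp: good_patch_def)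
  have "\<exists>v. H (F (model c \<xi>)) = model c v" if \<xi>: "\<xi> \<in> u ` (Q \<inter> Q')" for \<xi>
  proof -
    obtain m' where m': "m' \<in> Q" "m' \<in> Q'" "\<xi> = u m'" using \<xi> by auto
    have "F (model c \<xi>) = x m'" using g(1) m' by (simp add: good_patch_def)
    also have "\<dots> = F' (model c (u' m'))" using g(2) m' by (simp add: good_patch_def)
    finally have "F (model c \<xi>) = F' (model c (u' m'))" .
    then show ?thesis using H(2) by metis
  qed
  from model_overlap[OF c W calabi_transformation_comp[OF H(1) F(1)] this]
  obtain s1 s2 where "s1 \<in> {1, -1}" "s2 \<in> {1, -1}" "\<And>u. H (F (model c u)) = model c (flip s1 s2 u)"
    by blast
  then show ?thesis unfolding congruent_models_def using H(3) by metis
qed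

lemma good_patches_cover:
  fixes x :: "'m::topological_space \<Rightarrow> real^3"
  assumes c: "c > 0" and conn: "connected (UNIV :: 'm set)"
    and cover: "\<And>m. \<exists>Q F u. m \<in> Q \<and> good_patch x c Q F u"
  obtains U where "open U" "calabi_equivalent (range x) (model c ` U)"
proof -
  obtain m0 Q0 F0 u0 where g0: "m0 \<in> Q0" "good_patch x c Q0 F0 u0" using cover by blast
  have F0: "calabi_transformation F0" using g0 by (simp add: good_patch_def)
  \<comment> \<open>\<open>S\<close> is open because it contains each of its patches, and closed
    because patches that share a point are congruent; connectedness then makes it
    everything.\<close>
  define S where "S = {m. \<exists>Q F u. m \<in> Q \<and> good_patch x c Q F u \<and> congruent_models c F F0}"
  have "open S"
  proof (subst open_subopen, rule ballI)
    fix m assume "m \<in> S"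
    then obtain Q F u where Q: "m \<in> Q" "good_patch x c Q F u" "congruent_models c F F0" by (auto simp: S_def)
    then have "open Q" "Q \<subseteq> S" by (auto simp: good_patch_def S_def)
    then show "\<exists>T. open T \<and> m \<in> T \<and> T \<subseteq> S" using Q(1) by blast
  qed
  moreover have "open (- S)"
  proof (subst open_subopen, rule ballI)
    fix m assume m: "m \<in> - S"
    obtain Q F u where Q: "m \<in> Q" "good_patch x c Q F u" using cover by blast
    have "Q \<subseteq> - S"
    proof
      fix m' assume m': "m' \<in> Q"
      show "m' \<in> - S"
      proof
        assume "m' \<in> S"
        then obtain Q' F' u' where "m' \<in> Q'" "good_patch x c Q' F' u'" "congruent_models c F' F0"
          by (auto simp: S_def)
        then have "congruent_models c F F0"
          using good_patches_overlap[OF c Q(2) _ m'] congruent_models_trans by blast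
        then show False using m Q by (auto simp: S_def)
      qed
    qed
    moreover have "open Q" using Q(2) by (simp add: good_patch_def)
    ultimately show "\<exists>T. open T \<and> m \<in> T \<and> T \<subseteq> - S" using Q(1) by blast
  qed
  moreover have "m0 \<in> S" using g0 congruent_models_refl by (auto simp: S_def)
  ultimately have "S = UNIV"
    using connectedD[OF conn, of S "- S"] by auto
  then have good: "\<exists>Q F u. m \<in> Q \<and> good_patch x c Q F u \<and> congruent_models c F F0" for m
    unfolding S_def by blast
  \<comment> \<open>All parameters at which the fixed model \<open>F0\<close> meets the surface. The
    reflected parameters of any patch lie in \<open>U\<close>, and injectivity of the model shows
    that they surround each point of \<open>U\<close>.\<close>
  define U where "U = {\<xi>. F0 (model c \<xi>) \<in> range x}"
  obtain H where H: "calabi_transformation H" "\<And>X. H (F0 X) = X" "\<And>X. F0 (H X) = X"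
    using calabi_transformation_inverse[OF F0] by metis
  have "open U"
  proof (subst open_subopen, rule ballI)
    fix \<xi> assume "\<xi> \<in> U"
    then obtain m where m: "F0 (model c \<xi>) = x m" by (auto simp: U_def)
    obtain Q F u where Q: "m \<in> Q" "good_patch x c Q F u" "congruent_models c F F0" using good by blast
    then obtain s1 s2 where s: "s1 \<in> {1, -1}" "s2 \<in> {1, -1}"
      "\<And>v. F (model c v) = F0 (model c (flip s1 s2 v))"
      unfolding congruent_models_def by blast
    have xQ: "x m' = F0 (model c (flip s1 s2 (u m')))" if "m' \<in> Q" for m'
      using Q(2) that s(3) by (simp add: good_patch_def)
    let ?T = "flip s1 s2 ` (u ` Q)"
    have "open ?T" using Q(2) by (intro open_flip s) (auto simp: good_patch_def)
    moreover have "\<xi> \<in> ?T"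
    proof -
      have "model c \<xi> = model c (flip s1 s2 (u m))" using m xQ[OF Q(1)] H(2) by metis
      then have "\<xi> = flip s1 s2 (u m)" using inj_model injD by metis
      then show ?thesis using Q(1) by blast
    qed
    moreover have "?T \<subseteq> U" unfolding U_def using xQ by (auto simp: image_iff) metis
    ultimately show "\<exists>T. open T \<and> \<xi> \<in> T \<and> T \<subseteq> U" by blast
  qed
  moreover have "H ` range x = model c ` U"
  proof (intro equalityI subsetI)
    fix X assume "X \<in> H ` range x"
    then obtain m where X: "X = H (x m)" by blast
    obtain Q F u where Q: "m \<in> Q" "good_patch x c Q F u" "congruent_models c F F0" using good by blast
    then obtain s1 s2 where "x m = F0 (model c (flip s1 s2 (u m)))"
      unfolding congruent_models_def good_patch_def by metis
    then show "X \<in> model c ` U" unfolding X U_def using H(2) by (metis (mono_tags, lifting) imageI mem_Collect_eq rangeI)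
  next
    fix X assume "X \<in> model c ` U"
    then obtain \<xi> m where "X = model c \<xi>" "F0 (model c \<xi>) = x m" by (auto simp: U_def)
    then show "X \<in> H ` range x" using H(2) by (metis image_eqI rangeI)
  qed
  ultimately show thesis
    using that H(1) unfolding calabi_equivalent_def by blast
qed

theorem theorem4p6:
  fixes \<A> :: "'m::{t2_space,second_countable_topology} chart set"
    and x :: "'m \<Rightarrow> real^3" and c :: real
  assumes "calabi_surface \<A> x"
    and "flat_calabi \<A> x"
    and "calabi_affine_maximal \<A> x"
    and "\<forall>(\<Omega>, y)\<in>local_reps \<A> x. \<forall>p\<in>\<Omega>. tchebychev y p \<noteq> 0"
    and "c > 0"
    and "\<forall>(\<Omega>, y)\<in>local_reps \<A> x. \<forall>p\<in>\<Omega>.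
           endo_norm (calabi_metric y p) (covariant_deriv (calabi_metric y) (tchebychev y) p) = c"
  shows "\<exists>c1 c2 c3 :: real. c1 = sqrt 2 * c \<and>
           (\<exists>U. open U \<and> calabi_equivalent (range x) (model_surface c1 c2 c3 ` U))"
proof -
  have atlas: "smooth_atlas \<A>" and conn: "connected (UNIV :: 'm set)"
    using assms(1) by (auto simp: calabi_surface_def)
  have "\<exists>Q F u. m \<in> Q \<and> good_patch x (sqrt 2 * c) Q F u" for m
  proof -
    obtain U \<phi> where ch: "(U, \<phi>) \<in> \<A>" and mU: "m \<in> U"
    proof -
      have "m \<in> (\<Union>(U, \<phi>)\<in>\<A>. U)" using atlas by (simp add: smooth_atlas_def)
      then show thesis using that by auto
    qed
    define \<Omega> where "\<Omega> = \<phi> ` U"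
    define y where "y = x \<circ> inv_into U \<phi>"
    have oU: "open U" and o\<Omega>: "open \<Omega>" and hom: "homeomorphism U \<Omega> \<phi> (inv_into U \<phi>)"
      using atlas ch unfolding smooth_atlas_def \<Omega>_def by auto
    have rep: "(\<Omega>, y) \<in> local_reps \<A> x"
      unfolding local_reps_def \<Omega>_def y_def using ch by force
    have xy: "x m' = y (\<phi> m')" if "m' \<in> U" for m'
      using that hom by (simp add: y_def homeomorphism_def)
    have pre: "open {m' \<in> U. \<phi> m' \<in> B}" if "open B" for B
    proof -
      have "open (U \<inter> \<phi> -` B)"
        using hom by (intro continuous_open_preimage oU that) (simp add: homeomorphism_def)
      moreover have "U \<inter> \<phi> -` B = {m' \<in> U. \<phi> m' \<in> B}" by blast
      ultimately show ?thesis by (simp only:)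
    qed
    have patch: "calabi_patch \<Omega> y" using assms(1) rep unfolding calabi_surface_def by blast
    interpret C: calabi_chart \<Omega> y by unfold_locales (rule o\<Omega>, rule patch)
    have p0: "\<phi> m \<in> \<Omega>" using mU by (simp add: \<Omega>_def)
    obtain B v where B: "open B" "\<phi> m \<in> B" "B \<subseteq> \<Omega>" "open (horiz y ` B)" "smooth_on (horiz y ` B) v"
      "\<And>p. p \<in> B \<Longrightarrow> v (horiz y p) = p"
      using smooth_inverse_function[OF o\<Omega> smooth_horiz[OF o\<Omega> C.smooth_y] p0 C.jac_horiz] by metis
    define V where "V = horiz y ` B"
    \<comment> \<open>\<open>v\<close> inverts the projection on \<open>B\<close>, so the height
      becomes a smooth function of the horizontal coordinates.\<close>
    define f where "f a = y (v a) $ 3" for a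
    have sf: "smooth_on V f"
      unfolding f_def
      by (rule smooth_on_comp[OF _ o\<Omega> _ B(5)[folded V_def] smooth_on_nth[OF o\<Omega> C.smooth_y]])
        (use B(3,4,6) in \<open>auto simp: V_def\<close>)
    interpret Gr: calabi_graph B y V f
    proof
      show "calabi_patch B y" by (rule calabi_patch_subset[OF patch B(3)])
      show "y q $ 3 = f (horiz y q)" if "q \<in> B" for q by (simp add: f_def B(6)[OF that])
    qed (use B sf in \<open>auto simp: V_def\<close>)
    have lap0: "laplacian (hessian f) Gr.ldet a = 0" if a: "a \<in> V" for a
    proof -
      \<comment> \<open>The open piece of the surface that corresponds to \<open>B\<close>: its
        image is the graph of \<open>f\<close>, so affine maximality applies to it.\<close>
      let ?Q = "{m' \<in> U. \<phi> m' \<in> B}"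
      have "x ` ?Q = y ` B"
      proof (intro equalityI subsetI)
        fix X assume "X \<in> y ` B"
        then obtain p where p: "p \<in> B" "X = y p" by blast
        then obtain m' where "m' \<in> U" "p = \<phi> m'" using B(3) \<Omega>_def by blast
        then have "X = x m'" "m' \<in> ?Q" using p xy by auto
        then show "X \<in> x ` ?Q" by (rule image_eqI)
      qed (use xy in auto)
      also have "\<dots> = graph_param f ` V"
      proof -
        have "y p = graph_param f (horiz y p)" if "p \<in> B" for p
          using Gr.height[OF that] by (simp add: vec_eq_iff forall_3)
        then show ?thesis unfolding V_def image_image by (rule image_cong[OF refl])
      qed
      finally have "laplacian (calabi_metric (graph_param f)) (\<lambda>b. ln (det (hessian f b))) a = 0"
        using assms(3) pre[OF B(1)] Gr.open_V sf a unfolding calabi_affine_maximal_def by blast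
      then show ?thesis
        using laplacian_cong[OF Gr.open_V a calabi_metric_graph_param[OF Gr.open_V sf]]
        by (simp add: Gr.ldet_def[abs_def])
    qed
    have "flat_chart B y c"
    proof
      show "curvature (calabi_metric y) p i j k = 0" if "p \<in> B" for p i j k
        using assms(2) rep B(3) that unfolding flat_calabi_def by blast
      show "endo_norm (calabi_metric y p) (covariant_deriv (calabi_metric y) (tchebychev y) p) = c" if "p \<in> B" for p
        using assms(6) rep B(3) that by blast
      show "covariant_deriv (calabi_metric y) (tchebychev y) p 1 $ 1 +
          covariant_deriv (calabi_metric y) (tchebychev y) p 2 $ 2 = 0" if "p \<in> B" for p
        using Gr.trace_covariant_tchebychev[OF that] lap0[OF Gr.wV[OF that]] by simp
    qed (rule assms(5), rule Gr.covariant_tchebychev_sym)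
    then obtain B' F u where B': "open B'" "\<phi> m \<in> B'" "B' \<subseteq> B" "calabi_transformation F" "continuous_on B' u"
      "\<And>p. p \<in> B' \<Longrightarrow> y p = F (model (sqrt 2 * c) (u p))"
      using flat_chart_normal_form[OF _ B(2)] by metis
    \<comment> \<open>\<open>u p\<close> determines \<open>y p\<close> and hence
      \<open>horiz y p\<close>, from which \<open>v\<close> recovers \<open>p\<close>.\<close>
    have inj: "inj_on u B'"
    proof (rule inj_onI)
      fix p p' assume p: "p \<in> B'" "p' \<in> B'" "u p = u p'"
      then have "horiz y p = horiz y p'" using B'(6) by (simp add: horiz_def)
      then show "p = p'" using B(6) B'(3) p(1,2) by (metis subsetD)
    qed
    let ?Q = "{m' \<in> U. \<phi> m' \<in> B'}"
    have gp: "good_patch x (sqrt 2 * c) ?Q F (u \<circ> \<phi>)"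
      unfolding good_patch_def
    proof (intro conjI ballI allI impI)
      show "open ?Q" by (rule pre[OF B'(1)])
      show "x m' = F (model (sqrt 2 * c) ((u \<circ> \<phi>) m'))" if "m' \<in> ?Q" for m'
        using that xy B'(6) by simp
      \<comment> \<open>\<open>u\<close> is continuous and injective between planes, so invariance
        of domain makes it open.\<close>
      show "open ((u \<circ> \<phi>) ` W)" if W: "W \<subseteq> ?Q" "open W" for W
      proof -
        have "W \<subseteq> U" using W(1) by blast
        then have "openin (top_of_set U) W" using W(2) oU by (simp add: openin_open_eq)
        then have "openin (top_of_set \<Omega>) (\<phi> ` W)" using homeomorphism_imp_open_map[OF hom] by blast
        then have o: "open (\<phi> ` W)" using o\<Omega> openin_open_eq by blast
        have s: "\<phi> ` W \<subseteq> B'" using W(1) by blast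
        have "open (u ` (\<phi> ` W))"
          using invariance_of_domain[OF continuous_on_subset[OF B'(5) s] o inj_on_subset[OF inj s]] .
        then show ?thesis by (simp add: image_comp)
      qed
    qed (rule B'(4))
    have "m \<in> ?Q" using mU B'(2) by simp
    with gp show ?thesis by (intro exI conjI)
  qed
  moreover have "sqrt 2 * c > 0" using assms(5) by simp
  ultimately obtain U where "open U" "calabi_equivalent (range x) (model (sqrt 2 * c) ` U)"
    using good_patches_cover[OF _ conn] by metis
  \<comment> \<open>The witnesses c2 = c3 = 0 are built into \<open>model\<close>.\<close>
  then show ?thesis unfolding model_def by blast
qed

end
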